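(* Let $f(x)=(x^k+c)^m-ax^n\in\mathbb{Z}[x]$ ($a,c\in\mathbb{Z}$, $k,m,n\in\mathbb{N}$, $km>n$) be irreducible over $\mathbb{Q}$, of degree $d=km$. Assume: (1) $q=km-n$ is a prime with $d/2<q<d-2$; (2) there is a prime $p$ with $p\mid c$, $p\mid a$, $p^2\nmid a$; (3) $k(m-1)$ is odd; (4) there is a prime $\ell$ with $v_\ell(a)$ odd and $\ell\nmid kmc$. Then the Galois group of $f(x)$ over $\mathbb{Q}$ is the symmetric group $S_d$.
   Context: $v_\ell$ denotes the $\ell$-adic valuation. *)

theory Defs
  imports Complex_Main "HOL-Computational_Algebra.Computational_Algebra"
begin

definition complex_roots :: "int poly \<Rightarrow> complex set" where
  "complex_roots f = {z. poly (map_poly of_int f) z = 0}"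

definition is_subfield_C :: "complex set \<Rightarrow> bool" where
  "is_subfield_C K \<longleftrightarrow> 0 \<in> K \<and> 1 \<in> K \<and>
     (\<forall>x\<in>K. \<forall>y\<in>K. x + y \<in> K \<and> x * y \<in> K) \<and>
     (\<forall>x\<in>K. - x \<in> K) \<and> (\<forall>x\<in>K. inverse x \<in> K)"

text \<open>The splitting field of f over Q inside C: the smallest subfield of C
  containing all complex roots of f (every subfield of C contains Q).\<close>
definition splitting_field_C :: "int poly \<Rightarrow> complex set" where
  "splitting_field_C f = \<Inter>{K. is_subfield_C K \<and> complex_roots f \<subseteq> K}"

text \<open>Field automorphisms of the splitting field (these automatically fix Q),
  i.e. the elements of Gal(f/Q).\<close>
definition gal_auts :: "int poly \<Rightarrow> (complex \<Rightarrow> complex) set" where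
  "gal_auts f = {\<sigma>. bij_betw \<sigma> (splitting_field_C f) (splitting_field_C f) \<and>
     (\<forall>x\<in>splitting_field_C f. \<forall>y\<in>splitting_field_C f.
        \<sigma> (x + y) = \<sigma> x + \<sigma> y \<and> \<sigma> (x * y) = \<sigma> x * \<sigma> y)}"

definition galois_perm_group :: "int poly \<Rightarrow> (complex \<Rightarrow> complex) set" where
  "galois_perm_group f = (\<lambda>\<sigma>. restrict \<sigma> (complex_roots f)) ` gal_auts f"

definition sym_group_roots :: "int poly \<Rightarrow> (complex \<Rightarrow> complex) set" where
  "sym_group_roots f = (\<lambda>\<pi>. restrict \<pi> (complex_roots f)) `
      {\<pi>. bij_betw \<pi> (complex_roots f) (complex_roots f)}"

end

(* The roots alpha of f lying on the edge of slope -1/q of the p-adic Newton polygon force q to divide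
   the order of the Galois group G, so G contains an element of order q, which is a q-cycle because
   d < 2q. A transitive group of degree d with a q-cycle, d/2 < q < d-2, contains every 3-cycle
   (Jordan): translates of the support of the cycle make G highly transitive, a Sylow argument lets
   permutations of the n = d-q fixed points be realised in the normaliser of the q-cycle, and a
   commutator of two of them is, up to a power of the cycle, a 3-cycle. Finally G is not alternating
   because the l-adic valuation of the discriminant of f is k(m-1) v_l(a), which is odd.

   Instead of completions, the proof uses a valuation ring of the complex numbers above the prime,
   obtained as a maximal subring not containing 1/p. *)
theory Submission
  imports Defs "HOL-Number_Theory.Cong" "HOL-Combinatorics.Permutations"
begin

section \<open>Finite permutation groups\<close>

text \<open>The valuation ring \<open>V\<close> comes from Zorn's lemma: its value group is unknown
  and automorphisms need not preserve it, so ramification indices are not at hand. A valuation is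
  always expressed by saying that some quotient is a unit of \<open>V\<close>, and integrality
  enters only through rational numbers. Each of the two primes thus calls for a rational number of
  known valuation: at p the sum of the distinct conjugates of a product of roots on the edge, at l a
  supposed rational square root of the discriminant or of its negative. The edge runs from n to d
  because 2n < d: every coefficient of (x^k + c)^m of index at most n is divisible by p^2, which
  leaves -a to decide at n, while n \<le> q keeps the terms of lower index above the edge. The bound
  q < d - 2 leaves the cycle three fixed points, the least number carrying two transpositions whose
  commutator is a 3-cycle. Being alternating is expressed not by signs of permutations but by fixing
  a square root of plus or minus the discriminant. Its square is determined only up to sign, which
  is why the parity argument has to rule out both signs.\<close>

lemma funpow_mod_period:
  assumes "(g ^^ q) x = x" shows "(g ^^ i) x = (g ^^ (i mod q)) x"
proof -
  have fixa: "((g ^^ q) ^^ a) x = x" for a using assms by (induction a) auto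
  have "g ^^ i = g ^^ (i mod q + q * (i div q))" by simp
  also have "\<dots> = g ^^ (i mod q) \<circ> (g ^^ q) ^^ (i div q)"
    by (simp only: funpow_add funpow_mult)
  finally show ?thesis by (simp add: fixa)
qed

lemma prime_period_inj_on:
  assumes q: "prime (q :: nat)" and per: "(g ^^ q) x = x" and x: "g x \<noteq> x"
  shows "inj_on (\<lambda>i. (g ^^ i) x) {..<q}"
proof -
  have "i = j" if ij: "i \<le> j" "j < q" "(g ^^ i) x = (g ^^ j) x" for i j
  proof (rule ccontr)
    assume "i \<noteq> j"
    \<comment> \<open>\<open>g\<close> need not be injective, so \<open>g ^^ i\<close> cannot be
      cancelled. Going on from the \<open>j\<close>-th iterate by \<open>q - j\<close> steps closes
      the cycle and gives a period \<open>k\<close> strictly between 0 and \<open>q\<close>; it is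
      invertible modulo \<open>q\<close>, so \<open>g\<close> itself would fix
      \<open>x\<close>.\<close>
    define k where "k = q - j + i"
    have "(g ^^ k) x = (g ^^ (q - j)) ((g ^^ j) x)"
      using ij(3) by (simp add: k_def funpow_add)
    also have "\<dots> = (g ^^ (q - j + j)) x" by (simp only: funpow_add comp_apply)
    also have "\<dots> = x" using ij per by simp
    finally have k: "(g ^^ k) x = x" .
    have "0 < k" "k < q" using ij \<open>i \<noteq> j\<close> by (auto simp: k_def)
    then have "coprime k q" using q
      by (metis coprime_commute dvd_imp_le linorder_not_less prime_imp_coprime)
    then obtain a where a: "[k * a = 1] (mod q)" using cong_solve_coprime_nat by auto
    have "((g ^^ k) ^^ a) x = x" for a using k by (induction a) auto
    then have "(g ^^ (k * a)) x = x" by (simp add: funpow_mult mult.commute)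
    then have "(g ^^ 1) x = x"
      using a funpow_mod_period[OF per, of "k * a"] funpow_mod_period[OF per, of 1]
      by (simp add: cong_def)
    then show False using x by simp
  qed
  then show ?thesis by (metis (no_types, lifting) inj_onI lessThan_iff linorder_le_cases)
qed

lemma prime_period_card_orbit:
  assumes q: "prime (q :: nat)" and per: "(g ^^ q) x = x" and x: "g x \<noteq> x"
  shows "card (range (\<lambda>i. (g ^^ i) x)) = q" "finite (range (\<lambda>i. (g ^^ i) x))"
proof -
  have "q > 0" using q by (rule prime_gt_0_nat)
  then have *: "range (\<lambda>i. (g ^^ i) x) = (\<lambda>i. (g ^^ i) x) ` {..<q}"
    using funpow_mod_period[OF per] by (auto simp: image_iff) (metis mod_less_divisor lessThan_iff)
  show "finite (range (\<lambda>i. (g ^^ i) x))" by (simp add: *)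
  show "card (range (\<lambda>i. (g ^^ i) x)) = q"
    using card_image[OF prime_period_inj_on[OF assms]] * by simp
qed

text \<open>The moved points split into orbits of exactly \<open>q\<close> points. The congruence
  serves three times: for rotated tuples in Cauchy's theorem, for cosets in Sylow conjugacy, and for
  the points of \<open>R\<close> themselves.\<close>

lemma prime_dvd_card_nonfixed:
  assumes q: "prime (q :: nat)" and fin: "finite X" and F: "\<And>x. x \<in> X \<Longrightarrow> F x \<in> X"
    and per: "\<And>x. x \<in> X \<Longrightarrow> (F ^^ q) x = x"
  shows "q dvd card {x \<in> X. F x \<noteq> x}"
proof -
  define Y where "Y = {x \<in> X. F x \<noteq> x}"
  define orb where "orb x = range (\<lambda>i. (F ^^ i) x)" for x
  have inX: "(F ^^ i) x \<in> X" if "x \<in> X" for i x using that F by (induction i) auto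
  \<comment> \<open>A further power of \<open>F\<close> undoes \<open>F ^^ i\<close>; this supplies
    the injectivity of \<open>F\<close> on \<open>X\<close> and the symmetry of lying in the same
    orbit.\<close>
  have retn: "(F ^^ (q - i mod q)) ((F ^^ i) x) = x" if "x \<in> X" for i x
  proof -
    have "q > 0" using q by (rule prime_gt_0_nat)
    then have *: "q - i mod q + i mod q = q" by (simp add: less_imp_le)
    have "(F ^^ (q - i mod q)) ((F ^^ i) x) = (F ^^ (q - i mod q + i mod q)) x"
      by (simp only: funpow_mod_period[OF per[OF that], of i] funpow_add comp_apply)
    then show ?thesis unfolding * using per that by simp
  qed
  have inY: "(F ^^ i) x \<in> Y" if "x \<in> Y" for i x
  proof -
    have x: "x \<in> X" "F x \<noteq> x" using that by (auto simp: Y_def)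
    have "F ((F ^^ i) x) \<noteq> (F ^^ i) x"
    proof
      assume *: "F ((F ^^ i) x) = (F ^^ i) x"
      have "(F ^^ j) ((F ^^ i) x) = (F ^^ i) x" for j using * by (induction j) auto
      then have "(F ^^ i) x = x" using retn[OF x(1), of i] by simp
      then show False using * x by simp
    qed
    then show ?thesis using inX[OF x(1)] by (simp add: Y_def)
  qed
  have subo: "orb y \<subseteq> orb x" if "y \<in> orb x" for x y
    using that by (auto simp: orb_def simp flip: comp_apply[of "F ^^ _"] funpow_add)
  have syo: "x \<in> orb y" if "x \<in> X" "y \<in> orb x" for x y
    using that retn[OF that(1)] by (auto simp: orb_def) (metis rangeI)
  have union: "\<Union> (orb ` Y) = Y"
  proof
    show "\<Union> (orb ` Y) \<subseteq> Y" using inY by (auto simp: orb_def)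
    have "x \<in> orb x" for x unfolding orb_def by (rule range_eqI[of _ _ 0]) simp
    then show "Y \<subseteq> \<Union> (orb ` Y)" by blast
  qed
  have "q dvd card (\<Union> (orb ` Y))"
  proof (rule dvd_partition)
    show "finite (\<Union> (orb ` Y))" unfolding union using fin by (simp add: Y_def)
    show "\<forall>c\<in>orb ` Y. q dvd card c"
      by (auto simp: orb_def Y_def prime_period_card_orbit(1)[OF q per])
    show "\<forall>c1\<in>orb ` Y. \<forall>c2\<in>orb ` Y. c1 \<noteq> c2 \<longrightarrow> c1 \<inter> c2 = {}"
    proof (intro ballI impI)
      fix c1 c2 assume c: "c1 \<in> orb ` Y" "c2 \<in> orb ` Y" "c1 \<noteq> c2"
      then obtain x y where xy: "x \<in> X" "y \<in> X" "c1 = orb x" "c2 = orb y" by (auto simp: Y_def)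
      have "orb x = orb y" if "z \<in> orb x" "z \<in> orb y" for z
        using subo syo xy that by (metis subset_antisym)
      then show "c1 \<inter> c2 = {}" using c xy by auto
    qed
  qed
  then show ?thesis unfolding union by (simp add: Y_def)
qed

section \<open>Finite permutation groups: Cauchy, orbits, Sylow conjugacy\<close>

locale perm_group =
  fixes R :: "'a set" and G :: "('a \<Rightarrow> 'a) set"
  assumes finite_R: "finite R"
    and permutes_R: "p \<in> G \<Longrightarrow> p permutes R"
    and id_in: "id \<in> G"
    and comp_in: "p \<in> G \<Longrightarrow> p' \<in> G \<Longrightarrow> p \<circ> p' \<in> G"
begin

lemma finite_G: "finite G"
proof (rule finite_subset)
  show "G \<subseteq> {p. p permutes R}" using permutes_R by blast
  show "finite {p. p permutes R}" using finite_R by (rule finite_permutations)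
qed

lemma funpow_in: "p \<in> G \<Longrightarrow> p ^^ i \<in> G"
  by (induction i) (auto simp: comp_in id_in simp flip: id_def)

lemma inj_in: "p \<in> G \<Longrightarrow> inj p"
  using permutes_R permutes_inj by blast

text \<open>Two powers of \<open>p\<close> coincide by finiteness, and cancelling gives a power that
  inverts \<open>p\<close>. Hence closure under composition is all that has to be checked for each
  subgroup.\<close>

lemma inv_in:
  assumes "p \<in> G"
  shows "inv p \<in> G"
proof -
  have "\<not> inj_on (\<lambda>i. p ^^ i) (UNIV :: nat set)"
    using finite_G funpow_in[OF assms] finite_imageD[of "\<lambda>i. p ^^ i" "UNIV :: nat set"]
    by (metis finite_subset image_subsetI infinite_UNIV_nat)
  then obtain i j :: nat where ij: "i < j" "p ^^ i = p ^^ j"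
    unfolding inj_on_def by (metis nat_neq_iff)
  define k where "k = j - i - 1"
  have "p ^^ j = p ^^ i \<circ> (p \<circ> p ^^ k)"
    using ij(1) by (simp add: k_def flip: funpow.simps(2) funpow_add)
  then have "p ^^ i \<circ> (p \<circ> p ^^ k) = p ^^ i \<circ> id" using ij by simp
  then have "p \<circ> p ^^ k = id"
    using inj_in[OF funpow_in[OF assms]] by (metis fun.inj_map inj_eq)
  moreover have "bij p" using permutes_R[OF assms] by (rule permutes_bij)
  ultimately have "inv p = p ^^ k"
    by (metis bij_is_inj comp_assoc inv_o_cancel id_comp comp_id)
  then show ?thesis using funpow_in[OF assms] by simp
qed

lemma inv_apply: "p \<in> G \<Longrightarrow> inv p (p x) = x" "p \<in> G \<Longrightarrow> p (inv p x) = x"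
  using permutes_R permutes_inverses by metis+

lemma image_R: "p \<in> G \<Longrightarrow> x \<in> R \<Longrightarrow> p x \<in> R"
  using permutes_R permutes_in_image by metis

lemma sub_perm_group:
  assumes "\<And>p. p \<in> K \<Longrightarrow> p \<in> G" "id \<in> K" "\<And>p p'. p \<in> K \<Longrightarrow> p' \<in> K \<Longrightarrow> p \<circ> p' \<in> K"
  shows "perm_group R K"
  using assms finite_R permutes_R by unfold_locales auto

text \<open>McKay's argument: rotation acts on the \<open>q\<close>-tuples in \<open>G\<close> with
  product \<open>id\<close>. Their number \<open>card G ^ (q - 1)\<close> is divisible by
  \<open>q\<close>, hence so is the number of constant ones, and the tuple of identities cannot be
  alone.\<close>

lemma cauchy:
  assumes q: "prime (q :: nat)" and dvd: "q dvd card G"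
  shows "\<exists>g\<in>G. g \<noteq> id \<and> g ^^ q = id"
proof -
  define X where "X = {xs. length xs = q \<and> set xs \<subseteq> G \<and> foldr (\<circ>) xs id = id}"
  define Y where "Y = {xs. set xs \<subseteq> G \<and> length xs = q - 1}"
  have q1: "q > 1" using q by (rule prime_gt_1_nat)
  have fold_in: "foldr (\<circ>) xs id \<in> G" if "set xs \<subseteq> G" for xs
    using that by (induction xs) (auto simp: id_in comp_in)
  have fold_app: "foldr (\<circ>) (xs @ ys) id = foldr (\<circ>) xs id \<circ> foldr (\<circ>) ys id" for xs ys :: "('a \<Rightarrow> 'a) list"
    by (induction xs) (auto simp: comp_assoc)
  have bij: "bij p" if "p \<in> G" for p using permutes_R[OF that] by (rule permutes_bij)
  \<comment> \<open>The last \<open>q - 1\<close> entries are free and determine the first.\<close>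
  have "bij_betw (\<lambda>xs. inv (foldr (\<circ>) xs id) # xs) Y X"
  proof (rule bij_betw_imageI)
    show "inj_on (\<lambda>xs. inv (foldr (\<circ>) xs id) # xs) Y" by (rule inj_onI) simp
    show "(\<lambda>xs. inv (foldr (\<circ>) xs id) # xs) ` Y = X"
    proof (intro equalityI subsetI)
      fix ys assume "ys \<in> (\<lambda>xs. inv (foldr (\<circ>) xs id) # xs) ` Y"
      then show "ys \<in> X" using q1 fold_in inv_in bij
        by (auto simp: X_def Y_def bij_is_inj)
    next
      fix ys assume ys: "ys \<in> X"
      then obtain y xs where [simp]: "ys = y # xs" using q1 by (cases ys) (auto simp: X_def)
      have "y \<circ> foldr (\<circ>) xs id = id" "foldr (\<circ>) xs id \<in> G"
        using ys fold_in by (auto simp: X_def)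
      then have "y = inv (foldr (\<circ>) xs id)"
        by (metis bij bij_is_surj comp_assoc surj_iff id_comp comp_id)
      moreover have "xs \<in> Y" using ys by (auto simp: X_def Y_def)
      ultimately show "ys \<in> (\<lambda>xs. inv (foldr (\<circ>) xs id) # xs) ` Y" by auto
    qed
  qed
  then have "card Y = card X" by (rule bij_betw_same_card)
  moreover have "card Y = card G ^ (q - 1)"
    unfolding Y_def by (rule card_lists_length_eq[OF finite_G])
  ultimately have "card X = card G ^ (q - 1)" by simp
  then have dvdX: "q dvd card X" using dvd_trans[OF dvd dvd_power[of "q - 1" "card G"]] q1 by simp
  have finX: "finite X"
    by (rule finite_subset[OF _ finite_lists_length_eq[OF finite_G, of q]]) (auto simp: X_def)
  have "q dvd card {xs \<in> X. rotate1 xs \<noteq> xs}"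
  proof (rule prime_dvd_card_nonfixed[OF q finX])
    fix xs assume xs: "xs \<in> X"
    then obtain y ys where [simp]: "xs = y # ys" using q1 by (cases xs) (auto simp: X_def)
    have "y \<in> G" "y \<circ> foldr (\<circ>) ys id = id" using xs by (auto simp: X_def)
    then have "foldr (\<circ>) ys id \<circ> y = id"
      by (metis bij bij_is_inj comp_assoc comp_id id_comp inv_o_cancel)
    then have "foldr (\<circ>) ys y = id" using fold_app[of ys "[y]"] by simp
    then show "rotate1 xs \<in> X" using xs by (auto simp: X_def)
    show "(rotate1 ^^ q) xs = xs"
      using xs by (metis (mono_tags, lifting) X_def mem_Collect_eq mod_self rotate_def rotate_id)
  qed
  moreover have "card X = card {xs \<in> X. rotate1 xs \<noteq> xs} + card {xs \<in> X. rotate1 xs = xs}"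
    using finX by (subst card_Un_disjoint[symmetric]) (auto intro: arg_cong[where f = card])
  ultimately have dvdFix: "q dvd card {xs \<in> X. rotate1 xs = xs}"
    using dvdX by (simp add: dvd_add_right_iff)
  have fold_repl: "((\<circ>) g ^^ i) id = g ^^ i" for i and g :: "'a \<Rightarrow> 'a"
    by (induction i) auto
  have "set (replicate q (id :: 'a \<Rightarrow> 'a)) \<subseteq> G" using id_in by auto
  then have one: "replicate q id \<in> {xs \<in> X. rotate1 xs = xs}"
    by (auto simp: X_def fold_repl)
  have "card {xs \<in> X. rotate1 xs = xs} \<noteq> 0" using one finX by auto
  with dvdFix have "card {xs \<in> X. rotate1 xs = xs} \<ge> q" by (simp add: dvd_imp_le)
  then have "card {xs \<in> X. rotate1 xs = xs} > 1" using q1 by simp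
  then have "{xs \<in> X. rotate1 xs = xs} \<noteq> {replicate q id}" by (metis card_1_singleton_iff less_irrefl One_nat_def)
  then obtain xs where xs: "xs \<in> X" "rotate1 xs = xs" "xs \<noteq> replicate q id"
    using one by blast
  have "card (set xs) = 1" using rotate1_fixpoint_card[OF xs(2)] xs(1) q1 by (auto simp: X_def)
  then obtain g where g: "set xs = {g}" by (auto simp: card_1_singleton_iff)
  then have "xs = replicate q g"
    using xs(1) by (auto simp: X_def intro!: replicate_eqI)
  then have "g \<in> G" "g ^^ q = id" "g \<noteq> id" using xs g by (auto simp: X_def fold_repl)
  then show ?thesis by blast
qed

text \<open>The fibres of \<open>\<lambda>p. p x\<close> on \<open>G\<close> are left cosets of the
  stabiliser of \<open>x\<close>.\<close>

lemma card_orbit_mult: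
  assumes x: "x \<in> R"
  shows "card G = card ((\<lambda>p. p x) ` G) * card {p \<in> G. p x = x}"
proof -
  have "card G = (\<Sum>y\<in>(\<lambda>p. p x) ` G. card {p \<in> G. p x = y})"
    using sum.image_gen[OF finite_G, of "\<lambda>_. 1 :: nat" "\<lambda>p. p x"] by simp
  also have "\<dots> = (\<Sum>y\<in>(\<lambda>p. p x) ` G. card {p \<in> G. p x = x})"
  proof (rule sum.cong)
    fix y assume "y \<in> (\<lambda>p. p x) ` G"
    then obtain h where h: "h \<in> G" "y = h x" by auto
    have "bij_betw (\<lambda>p. h \<circ> p) {p \<in> G. p x = x} {p \<in> G. p x = y}"
    proof (rule bij_betwI[where g = "\<lambda>p. inv h \<circ> p"])
      show "(\<lambda>p. h \<circ> p) \<in> {p \<in> G. p x = x} \<rightarrow> {p \<in> G. p x = y}"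
        using h comp_in by auto
      show "(\<lambda>p. inv h \<circ> p) \<in> {p \<in> G. p x = y} \<rightarrow> {p \<in> G. p x = x}"
        using h comp_in inv_in inv_apply by auto
    qed (use h inv_apply in \<open>auto simp: fun_eq_iff\<close>)
    then show "card {p \<in> G. p x = y} = card {p \<in> G. p x = x}" by (rule bij_betw_same_card[symmetric])
  qed simp
  finally show ?thesis by simp
qed

text \<open>Sylow conjugacy for groups of prime degree: count fixed points of \<open>g'\<close> on the left
  cosets of \<open>\<langle>g\<rangle>\<close>, which are in bijection with a point stabiliser.\<close>
lemma prime_cycles_conjugate:
  assumes q: "prime (q :: nat)" and card: "card R = q"
    and g: "g \<in> G" "g \<noteq> id" "g ^^ q = id" and g': "g' \<in> G" "g' ^^ q = id"
  shows "\<exists>h\<in>G. \<exists>e. g' \<circ> h = h \<circ> g ^^ e"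
proof (rule ccontr)
  assume contra: "\<not> ?thesis"
  define C where "C h = range (\<lambda>i. h \<circ> g ^^ i)" for h :: "'a \<Rightarrow> 'a"
  define X where "X = C ` G"
  define F where "F A = (\<lambda>p. g' \<circ> p) ` A" for A :: "('a \<Rightarrow> 'a) set"
  have F_C: "F (C h) = C (g' \<circ> h)" for h
    by (simp add: F_def C_def image_image comp_assoc)
  have pow_F: "(F ^^ i) (C h) = C (g' ^^ i \<circ> h)" for i h
    by (induction i) (auto simp: F_C comp_def)
  have C_self: "h \<in> C h" for h
    unfolding C_def by (rule range_eqI[of _ _ 0]) (simp flip: id_def)
  \<comment> \<open>A coset \<open>C h\<close> fixed by \<open>g'\<close> contains
    \<open>g' \<circ> h\<close>, which is just the conclusion; under \<open>contra\<close> every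
    coset moves.\<close>
  have nofix: "F A \<noteq> A" if "A \<in> X" for A
  proof
    assume "F A = A"
    then obtain h where h: "h \<in> G" "C (g' \<circ> h) = C h" using \<open>A \<in> X\<close> \<open>F A = A\<close> F_C by (auto simp: X_def)
    then have "g' \<circ> h \<in> C h" using C_self[of "g' \<circ> h"] by simp
    then show False using contra h by (auto simp: C_def)
  qed
  have "q dvd card {A \<in> X. F A \<noteq> A}"
  proof (rule prime_dvd_card_nonfixed[OF q])
    show "finite X" using finite_G by (simp add: X_def)
    show "F A \<in> X" if "A \<in> X" for A using that F_C g' comp_in by (auto simp: X_def)
    show "(F ^^ q) A = A" if "A \<in> X" for A using that pow_F g' by (auto simp: X_def)
  qed
  then have dvdX: "q dvd card X" using nofix by (simp add: conj_absorb cong: conj_cong)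
  obtain x where x: "g x \<noteq> x" using g(2) by (auto simp: fun_eq_iff)
  have xR: "x \<in> R" using x permutes_R[OF g(1)] permutes_not_in by metis
  have per: "(g ^^ q) x = x" using g by simp
  have orbR: "range (\<lambda>i. (g ^^ i) x) = R"
  proof (rule card_subset_eq[OF finite_R])
    show "range (\<lambda>i. (g ^^ i) x) \<subseteq> R" using image_R[OF funpow_in[OF g(1)] xR] by auto
    show "card (range (\<lambda>i. (g ^^ i) x)) = card R"
      using prime_period_card_orbit(1)[OF q per x] card by simp
  qed
  \<comment> \<open>The powers of \<open>g\<close> are transitive on \<open>R\<close>, and a power
    fixing \<open>x\<close> is the identity. So every left coset contains exactly one element fixing
    \<open>x\<close>.\<close>
  define K where "K = {p \<in> G. p x = x}"
  have "bij_betw C K X"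
  proof (rule bij_betw_imageI)
    show "inj_on C K"
    proof (rule inj_onI)
      fix h h' assume h: "h \<in> K" "h' \<in> K" "C h = C h'"
      then have "h \<in> C h'" using C_self by metis
      then obtain i where i: "h = h' \<circ> g ^^ i" by (auto simp: C_def)
      then have "h' ((g ^^ i) x) = h' x" using h by (auto simp: K_def)
      then have gi: "(g ^^ i) x = x" using h inj_in by (metis (no_types, lifting) K_def injD mem_Collect_eq)
      have "g ^^ i = id"
      proof
        fix y show "(g ^^ i) y = id y"
        proof (cases "y \<in> R")
          case True
          then obtain j where "y = (g ^^ j) x" using orbR by auto
          then have "(g ^^ i) y = (g ^^ j) ((g ^^ i) x)"
            by (metis add.commute comp_apply funpow_add)
          then show ?thesis using gi \<open>y = _\<close> by simp
        next
          case False
          then show ?thesis using permutes_R[OF funpow_in[OF g(1)]] permutes_not_in by fastforce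
        qed
      qed
      then show "h = h'" using i by simp
    qed
    show "C ` K = X"
    proof (intro equalityI subsetI)
      fix A assume "A \<in> X"
      then obtain h where h: "h \<in> G" "A = C h" by (auto simp: X_def)
      have "inv h x \<in> R" using image_R[OF inv_in[OF h(1)] xR] .
      then obtain i where i: "(g ^^ i) x = inv h x" using orbR by auto
      define k where "k = h \<circ> g ^^ i"
      have "k \<in> K" using h i funpow_in[OF g(1)] comp_in inv_apply by (auto simp: K_def k_def)
      moreover have "C k = C h"
      proof (intro equalityI subsetI)
        fix p assume "p \<in> C k"
        then obtain j where "p = h \<circ> g ^^ i \<circ> g ^^ j" by (auto simp: C_def k_def)
        then have "p = h \<circ> g ^^ (i + j)" by (simp add: comp_assoc funpow_add)
        then show "p \<in> C h" by (auto simp: C_def)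
      next
        fix p assume "p \<in> C h"
        then obtain j where j: "p = h \<circ> g ^^ j" by (auto simp: C_def)
        \<comment> \<open>\<open>g ^^ (q * i - i)\<close> is the inverse of \<open>g ^^ i\<close>
          written with a natural exponent.\<close>
        have "q > 0" using q by (rule prime_gt_0_nat)
        then have "i \<le> q * i" by simp
        then have "i + (q * i - i + j) = q * i + j" by linarith
        then have "g ^^ i \<circ> g ^^ (q * i - i + j) = (g ^^ q) ^^ i \<circ> g ^^ j"
          by (metis funpow_add funpow_mult)
        then have "p = k \<circ> g ^^ (q * i - i + j)" using j g by (simp add: k_def comp_assoc)
        then show "p \<in> C k" by (auto simp: C_def)
      qed
      ultimately show "A \<in> C ` K" using h by auto
    qed (auto simp: X_def K_def)
  qed
  then have dvdK: "q dvd card K" using dvdX bij_betw_same_card by metis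
  have "perm_group R K"
    by (rule sub_perm_group) (auto simp: K_def id_in comp_in)
  then obtain k where k: "k \<in> K" "k \<noteq> id" "k ^^ q = id"
    using perm_group.cauchy[OF _ q dvdK] by blast
  obtain z where z: "k z \<noteq> z" using k(2) by (auto simp: fun_eq_iff)
  have kG: "k \<in> G" "k x = x" using k by (auto simp: K_def)
  have zR: "z \<in> R" using z permutes_R[OF kG(1)] permutes_not_in by metis
  have zx: "(k ^^ i) z \<noteq> x" for i
  proof
    assume "(k ^^ i) z = x"
    moreover have "(k ^^ i) x = x" using kG(2) by (induction i) auto
    ultimately have "z = x" using inj_in[OF funpow_in[OF kG(1)]] by (metis injD)
    then show False using z kG by simp
  qed
  have "range (\<lambda>i. (k ^^ i) z) \<subseteq> R - {x}"
    using image_R[OF funpow_in[OF kG(1)] zR] zx by auto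
  then have "q \<le> card (R - {x})"
    using card_mono[of "R - {x}" "range (\<lambda>i. (k ^^ i) z)"] finite_R
      prime_period_card_orbit(1)[OF q, of k z] z k(3) by simp
  then show False using card xR finite_R q by (metis One_nat_def card_Diff1_less linorder_not_less)
qed

text \<open>The moved points come in orbits of size \<open>q\<close>, and there is room for only
  one: an element of order \<open>q\<close> is a single \<open>q\<close>-cycle.\<close>

lemma prime_order_support:
  assumes q: "prime (q :: nat)" and small: "card R < 2 * q"
    and h: "h \<in> G" "h \<noteq> id" "h ^^ q = id"
  shows "{z. h z \<noteq> z} \<subseteq> R" "card {z. h z \<noteq> z} = q"
    "h x \<noteq> x \<Longrightarrow> range (\<lambda>i. (h ^^ i) x) = {z. h z \<noteq> z}"
proof -
  show sub: "{z. h z \<noteq> z} \<subseteq> R" using permutes_R[OF h(1)] permutes_not_in by fastforce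
  then have fin: "finite {z. h z \<noteq> z}" using finite_R by (rule finite_subset)
  have eq: "{z. h z \<noteq> z} = {z \<in> R. h z \<noteq> z}" using sub by auto
  have "q dvd card {z. h z \<noteq> z}" unfolding eq
    by (rule prime_dvd_card_nonfixed[OF q finite_R]) (use image_R[OF h(1)] h in auto)
  then obtain k where k: "card {z. h z \<noteq> z} = q * k" by auto
  have "card {z. h z \<noteq> z} \<noteq> 0" using h(2) fin by (auto simp: fun_eq_iff)
  moreover have "card {z. h z \<noteq> z} < 2 * q" using card_mono[OF finite_R sub] small by simp
  ultimately have "k \<noteq> 0" "k < 2" using k by (auto simp: mult.commute)
  then have "k = 1" by simp
  then show card: "card {z. h z \<noteq> z} = q" using k by simp
  show "range (\<lambda>i. (h ^^ i) x) = {z. h z \<noteq> z}" if x: "h x \<noteq> x"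
  proof (rule card_subset_eq[OF fin])
    show "range (\<lambda>i. (h ^^ i) x) \<subseteq> {z. h z \<noteq> z}"
    proof clarify
      fix i assume "h ((h ^^ i) x) = (h ^^ i) x"
      then have "(h ^^ i) (h x) = (h ^^ i) x" by (simp add: funpow_swap1)
      then show False using x inj_in[OF funpow_in[OF h(1)]] by (metis injD)
    qed
    show "card (range (\<lambda>i. (h ^^ i) x)) = card {z. h z \<noteq> z}"
      using prime_period_card_orbit(1)[OF q, of h x] x h card by simp
  qed
qed

lemma conj_funpow:
  assumes "h \<in> G"
  shows "(h \<circ> p \<circ> inv h) ^^ i = h \<circ> p ^^ i \<circ> inv h"
  by (induction i) (use inv_apply[OF assms] in \<open>auto simp: fun_eq_iff\<close>)

end

section \<open>Jordan's theorem: a cycle of large prime length\<close>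

locale transitive_prime_cycle = perm_group +
  fixes q :: nat and g :: "'a \<Rightarrow> 'a"
  assumes transitive: "x \<in> R \<Longrightarrow> y \<in> R \<Longrightarrow> \<exists>p\<in>G. p x = y"
    and prime_q: "prime q" and small: "card R < 2 * q"
    and g: "g \<in> G" "g \<noteq> id" "g ^^ q = id"
begin

text \<open>Among the translates \<open>h(\<Gamma>)\<close> of the support \<open>\<Gamma>\<close> of \<open>g\<close> that contain \<open>y\<close>, one with
  \<open>h(\<Gamma>) - \<Gamma>\<close> of least size has \<open>h(\<Gamma>) - \<Gamma> = {y}\<close>: otherwise a power of the conjugate of \<open>g\<close>
  by \<open>h\<close> moves \<open>\<Gamma>\<close> to a better translate.\<close>
lemma slide:
  assumes y: "y \<in> R" "g y = y"
  shows "\<exists>u\<in>G. (\<forall>z. g z = z \<and> z \<noteq> y \<longrightarrow> u z = z) \<and> g (u y) \<noteq> u y"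
proof -
  define S where "S = {z. g z \<noteq> z}"
  note supp = prime_order_support[OF prime_q small g, folded S_def]
  obtain w where w: "w \<in> S" using g(2) by (auto simp: S_def fun_eq_iff)
  obtain h0 where "h0 \<in> G" "h0 w = y" using transitive supp(1) w y by blast
  then have "h0 \<in> G \<and> y \<in> h0 ` S" using w by auto
  then obtain h where h: "h \<in> G" "y \<in> h ` S"
    and least: "\<And>h'. h' \<in> G \<Longrightarrow> y \<in> h' ` S \<Longrightarrow> card (h ` S - S) \<le> card (h' ` S - S)"
    using ex_has_least_nat[of "\<lambda>h. h \<in> G \<and> y \<in> h ` S" h0 "\<lambda>h. card (h ` S - S)"] by blast
  define u where "u = h \<circ> g \<circ> inv h"
  have u: "u \<in> G" "u ^^ q = id"
    using h(1) g comp_in inv_in conj_funpow[OF h(1), of q g] inv_apply[OF h(1)]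
    by (auto simp: u_def fun_eq_iff)
  have suppu: "{z. u z \<noteq> z} = h ` S"
  proof (intro equalityI subsetI)
    fix z assume "z \<in> {z. u z \<noteq> z}"
    then have "inv h z \<in> S" using inv_apply[OF h(1)] by (auto simp: u_def S_def)
    then show "z \<in> h ` S" using inv_apply[OF h(1)] by (metis image_eqI)
  next
    fix z assume "z \<in> h ` S"
    then obtain s where s: "s \<in> S" "z = h s" by auto
    then show "z \<in> {z. u z \<noteq> z}"
      using inv_apply[OF h(1)] inj_in[OF h(1)] by (auto simp: u_def S_def dest: injD)
  qed
  have "u \<noteq> id" using suppu h(2) by auto
  note suppu' = prime_order_support[OF prime_q small u(1) this u(2), unfolded suppu]
  define B where "B = h ` S - S"
  have yB: "y \<in> B" using h(2) y by (simp add: B_def S_def)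
  have finB: "finite B" using finite_subset[OF supp(1) finite_R] by (simp add: B_def)
  have "z = y" if z: "z \<in> B" for z
  proof (rule ccontr)
    assume zy: "z \<noteq> y"
    have "u y \<noteq> y" "u z \<noteq> z" using yB z suppu by (auto simp: B_def)
    have "z \<in> range (\<lambda>i. (u ^^ i) y)" using suppu'(3)[OF \<open>u y \<noteq> y\<close>] z by (simp add: B_def)
    then obtain s where s: "z = (u ^^ s) y" by auto
    define v where "v = u ^^ s"
    have v: "v \<in> G" "v y \<noteq> y" "v ^^ q = id"
    proof -
      have "v ^^ q = (u ^^ q) ^^ s" by (simp add: v_def funpow_mult mult.commute)
      then show "v ^^ q = id" using u(2) by simp
    qed (use s zy u funpow_in[OF u(1), of s] in \<open>auto simp: v_def\<close>)
    have vS: "v x \<in> h ` S" if "x \<in> h ` S" for x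
      using suppu'(3)[of x] that suppu by (auto simp: v_def)
    \<comment> \<open>If \<open>v\<close> kept \<open>B\<close>, the orbit of \<open>y\<close> under
      \<open>v\<close> would give \<open>q\<close> points of \<open>B\<close>; but \<open>B\<close>
      lies in \<open>R - S\<close>, which has fewer than \<open>q\<close> points.\<close>
    have "\<exists>a\<in>B. inv v a \<notin> B"
    proof (rule ccontr)
      assume "\<not> ?thesis"
      then have "inv v ` B \<subseteq> B" by auto
      moreover have "inj_on (inv v) B" using inj_in[OF inv_in[OF v(1)]] inj_on_subset by blast
      ultimately have "inv v ` B = B" using finB by (metis endo_inj_surj)
      then have vB: "v b \<in> B" if "b \<in> B" for b
        using that inv_apply[OF v(1)] by (metis imageE)
      have "(v ^^ i) y \<in> B" for i using yB vB by (induction i) auto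
      then have "card (range (\<lambda>i. (v ^^ i) y)) \<le> card B"
        by (intro card_mono finB) auto
      then have "q \<le> card B"
        using prime_period_card_orbit(1)[OF prime_q, of v y] v by simp
      moreover have "card B \<le> card (R - S)"
        using image_R[OF h(1)] supp(1) finite_R by (intro card_mono) (auto simp: B_def)
      moreover have "card (R - S) = card R - q"
        using supp(1,2) finite_R by (metis card_Diff_subset finite_subset)
      moreover have "q \<le> card R" using supp(1,2) finite_R by (metis card_mono)
      ultimately show False using small by simp
    qed
    then obtain a where a: "a \<in> B" "inv v a \<notin> B" by auto
    have "u a \<noteq> a" using a suppu by (auto simp: B_def)
    have "z \<in> range (\<lambda>i. (u ^^ i) a)" using suppu'(3)[OF \<open>u a \<noteq> a\<close>] z by (simp add: B_def)
    then obtain k where k: "z = (u ^^ k) a" by auto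
    \<comment> \<open>\<open>r\<close> commutes with \<open>v\<close>, both being powers of
      \<open>u\<close>, and takes \<open>a\<close> to \<open>z\<close>, hence \<open>inv v a\<close>
      to \<open>y\<close>. Since \<open>inv v a\<close> lies in \<open>S\<close> and
      \<open>a\<close> does not, the translate of \<open>S\<close> by \<open>r\<close> contains
      \<open>y\<close> but not \<open>z\<close>, and so beats the translate by
      \<open>h\<close>.\<close>
    define r where "r = u ^^ k"
    have r: "r \<in> G" "r a = z" using k u funpow_in by (auto simp: r_def)
    have rv: "r (v x) = v (r x)" for x
      by (simp add: r_def v_def flip: comp_apply[of "u ^^ _" "u ^^ _"] funpow_add) (simp add: add.commute)
    have "v (r (inv v a)) = z" using rv[of "inv v a"] inv_apply[OF v(1)] r by simp
    moreover have "v y = z" using s by (simp add: v_def)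
    ultimately have ry: "r (inv v a) = y" using inj_in[OF v(1)] by (metis injD)
    have "inv v a \<in> h ` S"
    proof -
      have "inv v a \<in> {x. u x \<noteq> x}"
      proof
        show "u (inv v a) \<noteq> inv v a"
        proof
          assume "u (inv v a) = inv v a"
          then have "(u ^^ i) (inv v a) = inv v a" for i by (induction i) auto
          then have "v (inv v a) = inv v a" by (simp add: v_def)
          then have "a = inv v a" using inv_apply[OF v(1)] by simp
          then show False using a by simp
        qed
      qed
      then show ?thesis using suppu by simp
    qed
    then have "inv v a \<in> S" using a by (simp add: B_def)
    then have "y \<in> r ` S" using ry by auto
    have rS: "r x \<in> h ` S" if "x \<in> h ` S" for x
      using suppu'(3)[of x] that suppu by (auto simp: r_def)
    have "r ` S - S \<subseteq> B"
    proof
      fix x assume "x \<in> r ` S - S"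
      then obtain t where t: "t \<in> S" "x = r t" "x \<notin> S" by auto
      have "t \<in> h ` S"
      proof (rule ccontr)
        assume "t \<notin> h ` S"
        then have "u t = t" using suppu by auto
        then have "(u ^^ i) t = t" for i by (induction i) auto
        then show False using t by (simp add: r_def)
      qed
      then show "x \<in> B" using rS t by (simp add: B_def)
    qed
    moreover have "z \<notin> r ` S"
    proof
      assume "z \<in> r ` S"
      then obtain t where "t \<in> S" "r t = r a" using r by auto
      then have "a \<in> S" using inj_in[OF r(1)] by (metis injD)
      then show False using a by (simp add: B_def)
    qed
    ultimately have "r ` S - S \<subset> B" using z by auto
    then have "card (r ` S - S) < card (h ` S - S)"
      using finB unfolding B_def[symmetric] by (rule psubset_card_mono[rotated])
    then show False using least[OF r(1) \<open>y \<in> r ` S\<close>] by simp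
  qed
  then have B: "B = {y}" using yB by blast
  have "u z = z" if "g z = z" "z \<noteq> y" for z
    using that B suppu by (auto simp: B_def S_def)
  moreover have "u y \<noteq> y" using suppu h(2) by auto
  moreover have "u y \<in> S"
  proof -
    have "u y \<in> h ` S" using suppu'(3)[OF \<open>u y \<noteq> y\<close>] by (metis funpow_0 funpow_simps_right(2) comp_apply rangeI)
    then show ?thesis using B \<open>u y \<noteq> y\<close> by (auto simp: B_def)
  qed
  ultimately show ?thesis using u(1) by (auto simp: S_def)
qed

text \<open>A point fixed by \<open>g\<close> is slid into the support by an element fixing all
  other fixed points, and a power of \<open>g\<close> then brings it to \<open>w\<close>; neither
  move disturbs \<open>D\<close>. Letting \<open>D\<close> grow through the fixed points of
  \<open>g\<close> makes \<open>G\<close> highly transitive.\<close>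

lemma pointwise_stabiliser_transitive:
  assumes D: "\<And>x. x \<in> D \<Longrightarrow> g x = x" and z: "z \<in> R - D" "z' \<in> R - D"
  shows "\<exists>u\<in>G. (\<forall>x\<in>D. u x = x) \<and> u z = z'"
proof -
  obtain w where w: "g w \<noteq> w" using g(2) by (auto simp: fun_eq_iff)
  note supp = prime_order_support[OF prime_q small g]
  have gD: "(g ^^ i) x = x" if "x \<in> D" for i x using D[OF that] by (induction i) auto
  have orb: "\<exists>i. (g ^^ i) x = w" if "g x \<noteq> x" for x
    using supp(3)[OF that] w by (metis (mono_tags, lifting) mem_Collect_eq rangeE)
  have to_w: "\<exists>u\<in>G. (\<forall>x\<in>D. u x = x) \<and> u z = w" if z: "z \<in> R - D" for z
  proof (cases "g z = z")
    case False
    then show ?thesis using orb[of z] gD funpow_in[OF g(1)] by metis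
  next
    case True
    then obtain u where u: "u \<in> G" "\<forall>x. g x = x \<and> x \<noteq> z \<longrightarrow> u x = x" "g (u z) \<noteq> u z"
      using slide z by blast
    obtain i where "(g ^^ i) (u z) = w" using orb u(3) by blast
    moreover have "u x = x" if "x \<in> D" for x using u(2) D that z by auto
    ultimately have "g ^^ i \<circ> u \<in> G" "(g ^^ i \<circ> u) z = w" "\<forall>x\<in>D. (g ^^ i \<circ> u) x = x"
      using comp_in[OF funpow_in[OF g(1)] u(1)] gD by auto
    then show ?thesis by blast
  qed
  obtain u u' where u: "u \<in> G" "\<forall>x\<in>D. u x = x" "u z = w"
    and u': "u' \<in> G" "\<forall>x\<in>D. u' x = x" "u' z' = w" using to_w z by meson
  have "inv u' \<circ> u \<in> G" "(inv u' \<circ> u) z = z'" "\<forall>x\<in>D. (inv u' \<circ> u) x = x"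
    using comp_in[OF inv_in[OF u'(1)] u(1)] u u' inv_apply[OF u'(1)] by (auto, metis+)
  then show ?thesis by blast
qed

text \<open>A Frattini argument. High transitivity gives \<open>v\<close> with the required effect
  on the fixed points of \<open>g\<close>. It maps the support \<open>S\<close> to itself, so
  \<open>g\<close> and its conjugate \<open>g'\<close> are both \<open>q\<close>-cycles in the
  pointwise stabiliser \<open>K\<close> of the fixed points, a group of degree \<open>q\<close>.
  Sylow conjugacy in \<open>K\<close> corrects \<open>v\<close> to an element normalising the powers
  of \<open>g\<close>, without changing it on the fixed points.\<close>

lemma normalising_swap:
  assumes y: "y \<in> R" "g y = y" "y' \<in> R" "g y' = y'" "y \<noteq> y'"
  shows "\<exists>u\<in>G. \<exists>e. u \<circ> g = g ^^ e \<circ> u \<and> u y = y' \<and> u y' = y \<and>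
    (\<forall>z. g z = z \<and> z \<noteq> y \<and> z \<noteq> y' \<longrightarrow> u z = z)"
proof -
  define S where "S = {z. g z \<noteq> z}"
  note supp = prime_order_support[OF prime_q small g, folded S_def]
  define D where "D = {z. g z = z} - {y, y'}"
  obtain e1 where e1: "e1 \<in> G" "\<forall>x\<in>D. e1 x = x" "e1 y' = y"
    using pointwise_stabiliser_transitive[of D y' y] y by (auto simp: D_def)
  have "e1 y \<noteq> e1 y'" using y inj_in[OF e1(1)] by (metis injD)
  have "e1 y \<notin> D"
  proof
    assume "e1 y \<in> D"
    then have "e1 (e1 y) = e1 y" using e1 by blast
    then have "e1 y = y" using inj_in[OF e1(1)] by (metis injD)
    then show False using \<open>e1 y \<noteq> e1 y'\<close> e1 by simp
  qed
  \<comment> \<open>The second move must respect \<open>e1 y' = y\<close>, so \<open>y\<close> joins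
    the points to be fixed.\<close>
  then have "e1 y \<in> R - insert y D" "y' \<in> R - insert y D"
    using y image_R[OF e1(1) y(1)] \<open>e1 y \<noteq> e1 y'\<close> e1(3) by (auto simp: D_def)
  moreover have "g x = x" if "x \<in> insert y D" for x using that y by (auto simp: D_def)
  ultimately obtain e2 where e2: "e2 \<in> G" "\<forall>x\<in>insert y D. e2 x = x" "e2 (e1 y) = y'"
    using pointwise_stabiliser_transitive[of "insert y D" "e1 y" y'] by blast
  define v where "v = e2 \<circ> e1"
  have v: "v \<in> G" "v y = y'" "v y' = y" "\<And>z. g z = z \<Longrightarrow> z \<noteq> y \<Longrightarrow> z \<noteq> y' \<Longrightarrow> v z = z"
    using e1 e2 comp_in by (auto simp: v_def D_def)
  have vD: "g (v z) = v z \<longleftrightarrow> g z = z" for z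
  proof -
    have *: "g (v z) = v z" if "g z = z" for z using v that y by metis
    have "g z = z" if "g (v z) = v z"
    proof -
      have "v (v (v z)) = v z" using v that y by metis
      then have "v (v z) = z" using inj_in[OF v(1)] by (metis injD)
      then show ?thesis using *[OF that] by simp
    qed
    then show ?thesis using * by blast
  qed
  define g' where "g' = v \<circ> g \<circ> inv v"
  define K where "K = {p \<in> G. \<forall>z. g z = z \<longrightarrow> p z = z}"
  interpret K: perm_group S K
  proof
    show "finite S" using supp(1) finite_R finite_subset by blast
    show "p permutes S" if "p \<in> K" for p
      using that permutes_superset[OF permutes_R[of p], of S] by (auto simp: K_def S_def)
  qed (auto simp: K_def id_in comp_in)
  have g'K: "g' \<in> K"
  proof -
    have "g' z = z" if "g z = z" for z
    proof -
      have "g (inv v z) = inv v z" using vD[of "inv v z"] inv_apply[OF v(1)] that by simp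
      then show ?thesis using inv_apply[OF v(1)] by (simp add: g'_def)
    qed
    then show ?thesis using v(1) g(1) comp_in inv_in by (auto simp: K_def g'_def)
  qed
  have g'q: "g' ^^ q = id"
    using conj_funpow[OF v(1), of q g] g inv_apply[OF v(1)] by (auto simp: g'_def fun_eq_iff)
  have "g \<in> K" using g by (simp add: K_def)
  then obtain h e where h: "h \<in> K" "g' \<circ> h = h \<circ> g ^^ e"
    using K.prime_cycles_conjugate[OF prime_q supp(2) _ g(2,3) g'K g'q] by blast
  have hG: "h \<in> G" "\<And>z. g z = z \<Longrightarrow> inv h z = z"
    using h(1) inv_apply(1) by (auto simp: K_def, metis)
  define u where "u = inv h \<circ> v"
  have "u \<in> G" using hG v comp_in inv_in by (simp add: u_def)
  moreover have "u \<circ> g = g ^^ e \<circ> u"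
  proof
    fix x
    have "h ((g ^^ e) (inv h (v x))) = g' (h (inv h (v x)))" using h(2) by (metis comp_apply)
    also have "\<dots> = v (g x)" using inv_apply[OF hG(1)] inv_apply[OF v(1)] by (simp add: g'_def)
    finally have "h ((g ^^ e) (inv h (v x))) = h (inv h (v (g x)))"
      using inv_apply[OF hG(1)] by simp
    then have "(g ^^ e) (inv h (v x)) = inv h (v (g x))" using inj_in[OF hG(1)] by (metis injD)
    then show "(u \<circ> g) x = (g ^^ e \<circ> u) x" by (simp add: u_def)
  qed
  moreover have "u y = y'" "u y' = y" "\<forall>z. g z = z \<and> z \<noteq> y \<and> z \<noteq> y' \<longrightarrow> u z = z"
    using v hG y by (auto simp: u_def)
  ultimately show ?thesis by blast
qed

text \<open>Conjugation by normalising elements raises \<open>g\<close> to powers, and exponents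
  commute; hence the commutator \<open>k\<close> of two of them centralises \<open>g\<close>. On the
  support of \<open>g\<close> it is therefore a power of \<open>g\<close> and dies in
  \<open>k ^^ q\<close>. On the fixed points it is the commutator of two transpositions sharing a
  point, a 3-cycle, which survives because 3 does not divide \<open>q\<close>.\<close>

lemma three_cycle_in:
  assumes large: "q + 3 \<le> card R" and abc: "a \<in> R" "b \<in> R" "c \<in> R" "a \<noteq> b" "b \<noteq> c" "a \<noteq> c"
  shows "transpose a b \<circ> transpose b c \<in> G"
proof -
  define S where "S = {z. g z \<noteq> z}"
  note supp = prime_order_support[OF prime_q small g, folded S_def]
  have "3 \<le> card (R - S)"
    using supp(1,2) finite_R large card_Diff_subset[of S R] finite_subset[of S R] by simp
  then obtain T where T: "T \<subseteq> R - S" "card T = 3" by (meson obtain_subset_with_card_n)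
  then obtain y1 y2 y3 where y: "T = {y1, y2, y3}" "y1 \<noteq> y2" "y2 \<noteq> y3" "y1 \<noteq> y3"
    by (auto simp: card_3_iff)
  then have yR: "y1 \<in> R" "y2 \<in> R" "y3 \<in> R" and gy: "g y1 = y1" "g y2 = y2" "g y3 = y3"
    using T by (auto simp: S_def)
  obtain s1 d1 where s1: "s1 \<in> G" "s1 \<circ> g = g ^^ d1 \<circ> s1" "s1 y1 = y2" "s1 y2 = y1"
    "\<And>z. g z = z \<Longrightarrow> z \<noteq> y1 \<Longrightarrow> z \<noteq> y2 \<Longrightarrow> s1 z = z"
    using normalising_swap[of y1 y2] yR gy y by blast
  obtain s2 d2 where s2: "s2 \<in> G" "s2 \<circ> g = g ^^ d2 \<circ> s2" "s2 y2 = y3" "s2 y3 = y2"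
    "\<And>z. g z = z \<Longrightarrow> z \<noteq> y2 \<Longrightarrow> z \<noteq> y3 \<Longrightarrow> s2 z = z"
    using normalising_swap[of y2 y3] yR gy y by blast
  have pow: "s ((g ^^ i) x) = (g ^^ (d * i)) (s x)" if "s \<circ> g = g ^^ d \<circ> s" for s d i x
  proof (induction i)
    case (Suc i)
    have "s (g x) = (g ^^ d) (s x)" for x using that by (metis comp_apply)
    then have "s ((g ^^ Suc i) x) = (g ^^ d) ((g ^^ (d * i)) (s x))" using Suc by simp
    then show ?case by (simp add: funpow_add)
  qed simp
  define A where "A = s1 \<circ> s2"
  define B where "B = s2 \<circ> s1"
  define E where "E = d1 * d2"
  have A: "A \<in> G" "A (g x) = (g ^^ E) (A x)" for x
    using s1 s2 comp_in pow[OF s1(2), of d2 "s2 x"] pow[OF s2(2), of 1 x]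
    by (auto simp: A_def E_def)
  have B: "B \<in> G" "B (g x) = (g ^^ E) (B x)" for x
    using s1 s2 comp_in pow[OF s2(2), of d1 "s1 x"] pow[OF s1(2), of 1 x]
    by (auto simp: B_def E_def mult.commute)
  define k where "k = inv B \<circ> A"
  have kG: "k \<in> G" using A B comp_in inv_in by (simp add: k_def)
  have kg: "k (g x) = g (k x)" for x
  proof -
    have "B (g (k x)) = (g ^^ E) (B (k x))" using B by blast
    also have "\<dots> = B (k (g x))" using A inv_apply[OF B(1)] by (simp add: k_def)
    finally show ?thesis using inj_in[OF B(1)] by (metis injD)
  qed
  then have kgi: "k ((g ^^ i) x) = (g ^^ i) (k x)" for i x by (induction i) auto
  have BI: "inv B (B z) = z" for z using inv_apply[OF B(1)] by simp
  have "B y1 = y3" "B y2 = y1" "B y3 = y2" using s1 s2 y gy by (auto simp: B_def)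
  moreover have "A y1 = y2" "A y2 = y3" "A y3 = y1" using s1 s2 y gy by (auto simp: A_def)
  ultimately have ky: "k y1 = y3" "k y3 = y2" "k y2 = y1"
    using BI by (auto simp: k_def, metis+)
  have kD: "k z = z" if "g z = z" "z \<notin> T" for z
  proof -
    have "A z = z" "B z = z" using that s1(5) s2(5) y by (auto simp: A_def B_def)
    then show ?thesis using BI by (metis k_def comp_apply)
  qed
  define l where "l = k ^^ q"
  have lG: "l \<in> G" using kG funpow_in by (simp add: l_def)
  have lS: "l w = w" if w: "g w \<noteq> w" for w
  proof -
    have "g (k w) \<noteq> k w" using kg[of w] w inj_in[OF kG] by (metis injD)
    then have "k w \<in> range (\<lambda>i. (g ^^ i) w)" using supp(3)[OF w] by (simp add: S_def)
    then obtain j where j: "k w = (g ^^ j) w" by auto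
    have "(k ^^ i) w = (g ^^ (j * i)) w" for i
    proof (induction i)
      case (Suc i)
      have "(k ^^ Suc i) w = (g ^^ (j * i)) ((g ^^ j) w)" using Suc kgi j by simp
      also have "\<dots> = (g ^^ (j * i + j)) w" by (simp add: funpow_add)
      finally show ?case by (simp add: add.commute)
    qed simp
    then have "l w = (g ^^ (q * j)) w" by (simp add: l_def mult.commute)
    also have "\<dots> = ((g ^^ q) ^^ j) w" by (simp add: funpow_mult)
    finally show ?thesis using g(3) by (simp flip: id_def)
  qed
  have lD: "l z = z" if "g z = z" "z \<notin> T" for z
  proof -
    have "(k ^^ i) z = z" for i using kD[OF that] by (induction i) auto
    then show ?thesis by (simp add: l_def)
  qed
  \<comment> \<open>For \<open>q = 3\<close> the bounds \<open>q + 3 \<le> card R\<close> and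
    \<open>card R < 2 * q\<close> contradict each other.\<close>
  have q3: "q mod 3 = 1 \<or> q mod 3 = 2"
  proof (rule ccontr)
    assume "\<not> ?thesis"
    then have "3 dvd q" by presburger
    then have "q = 3" using prime_q by (metis One_nat_def numeral_eq_one_iff prime_nat_iff semiring_norm(86))
    then show False using small large by simp
  qed
  have lT: "l y = (k ^^ (q mod 3)) y" if "y \<in> T" for y
    unfolding l_def using that ky y(1) by (intro funpow_mod_period) (auto simp: numeral_3_eq_3)
  \<comment> \<open>On \<open>T\<close> the map \<open>l\<close> is \<open>k\<close> or its inverse
    according to \<open>q\<close> modulo 3; renaming the points merges the two cases.\<close>
  have "\<exists>x1 x2 x3. T = {x1, x2, x3} \<and> x1 \<noteq> x2 \<and> x2 \<noteq> x3 \<and> x1 \<noteq> x3 \<and> l x1 = x2 \<and> l x2 = x3 \<and> l x3 = x1"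
    using q3
  proof
    assume "q mod 3 = 1"
    then have "l z = k z" if "z \<in> T" for z using lT[OF that] by simp
    then have "l y1 = y3" "l y3 = y2" "l y2 = y1" using y(1) ky by simp_all
    moreover have "T = {y1, y3, y2}" using y(1) by (simp add: insert_commute)
    ultimately show ?thesis using y(2,3,4) by metis
  next
    assume "q mod 3 = 2"
    then have "l z = k (k z)" if "z \<in> T" for z using lT[OF that] by (simp add: numeral_2_eq_2)
    then have "l y1 = y2" "l y2 = y3" "l y3 = y1" using y(1) ky by simp_all
    then show ?thesis using y by metis
  qed
  then obtain x1 x2 x3 where x: "T = {x1, x2, x3}" "x1 \<noteq> x2" "x2 \<noteq> x3" "x1 \<noteq> x3"
    and lx: "l x1 = x2" "l x2 = x3" "l x3 = x1" by blast
  have l_other: "l z = z" if "z \<notin> T" for z using lS lD that by blast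
  have xR: "x1 \<in> R" "x2 \<in> R" "x3 \<in> R" and gx: "g x1 = x1" "g x2 = x2" "g x3 = x3"
    using T x by (auto simp: S_def)
  \<comment> \<open>Transitivity on triples, one point at a time: each further element fixes the
    targets already reached. Conjugating \<open>l\<close> then gives every 3-cycle.\<close>
  obtain p1 where p1: "p1 \<in> G" "p1 a = x1" using transitive abc xR by meson
  obtain p2 where p2: "p2 \<in> G" "p2 x1 = x1" "p2 (p1 b) = x2"
  proof -
    have "p1 b \<noteq> x1" using p1 abc inj_in[OF p1(1)] by (metis injD)
    then show ?thesis
      using pointwise_stabiliser_transitive[of "{x1}" "p1 b" x2] that image_R[OF p1(1)] abc gx x xR by auto
  qed
  obtain p3 where p3: "p3 \<in> G" "p3 x1 = x1" "p3 x2 = x2" "p3 (p2 (p1 c)) = x3"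
  proof -
    have "p1 c \<noteq> x1" using p1 abc inj_in[OF p1(1)] by (metis injD)
    then have "p2 (p1 c) \<noteq> x1" using p2 inj_in[OF p2(1)] by (metis injD)
    moreover have "p1 c \<noteq> p1 b" using abc inj_in[OF p1(1)] by (metis injD)
    then have "p2 (p1 c) \<noteq> x2" using p2 inj_in[OF p2(1)] by (metis injD)
    ultimately show ?thesis
      using pointwise_stabiliser_transitive[of "{x1, x2}" "p2 (p1 c)" x3] that
        image_R[OF p2(1) image_R[OF p1(1)]] abc gx x xR by auto
  qed
  define v where "v = p3 \<circ> p2 \<circ> p1"
  have v: "v \<in> G" "v a = x1" "v b = x2" "v c = x3"
    using p1 p2 p3 comp_in by (auto simp: v_def)
  have "transpose a b \<circ> transpose b c = inv v \<circ> l \<circ> v"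
  proof
    fix z
    have *: "v ((transpose a b \<circ> transpose b c) z) = l (v z)"
    proof (cases "z \<in> {a, b, c}")
      case True
      then show ?thesis using v lx abc by (auto simp: transpose_def)
    next
      case False
      then have "v z \<notin> T" using v x(1) inj_in[OF v(1)] by (auto dest: injD)
      then show ?thesis using False l_other by (auto simp: transpose_def)
    qed
    show "(transpose a b \<circ> transpose b c) z = (inv v \<circ> l \<circ> v) z"
      using arg_cong[OF *, of "inv v"] inv_apply[OF v(1)] by simp
  qed
  then show ?thesis using v(1) lG comp_in inv_in by simp
qed

end

section \<open>Groups containing all 3-cycles\<close>

lemma permutes_three_cycles_cases:
  assumes fin: "finite R" and st: "s \<in> R" "t \<in> R" "s \<noteq> t"
    and id: "id \<in> A" and comp: "\<And>p p'. p \<in> A \<Longrightarrow> p' \<in> A \<Longrightarrow> p \<circ> p' \<in> A"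
    and cyc: "\<And>a b c. a \<in> R \<Longrightarrow> b \<in> R \<Longrightarrow> c \<in> R \<Longrightarrow> a \<noteq> b \<Longrightarrow> b \<noteq> c \<Longrightarrow> a \<noteq> c
      \<Longrightarrow> transpose a b \<circ> transpose b c \<in> A"
    and p: "p permutes R"
  shows "p \<in> A \<or> transpose s t \<circ> p \<in> A"
proof -
  have two: "transpose a b \<circ> transpose b c \<in> A" if "a \<in> R" "b \<in> R" "c \<in> R" "a \<noteq> b" "b \<noteq> c" for a b c
    using that cyc id by (cases "a = c") (auto simp: transpose_commute)
  \<comment> \<open>Two transpositions are linked by inserting \<open>transpose b c\<close> twice;
    each half is then a 3-cycle or the identity.\<close>
  have pair: "transpose a b \<circ> transpose c d \<in> A"
    if "a \<in> R" "b \<in> R" "c \<in> R" "d \<in> R" "a \<noteq> b" "c \<noteq> d" for a b c d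
  proof (cases "b = c")
    case True
    then show ?thesis using two that by blast
  next
    case False
    then have "(transpose a b \<circ> transpose b c) \<circ> (transpose b c \<circ> transpose c d) \<in> A"
      using two that comp by metis
    then show ?thesis by (simp add: comp_assoc transpose_comp_involutory flip: comp_assoc[of "transpose b c"])
  qed
  show ?thesis using p fin
  proof (induction rule: permutes_induct)
    case id
    then show ?case using assms(5) by blast
  next
    \<comment> \<open>Multiplying by one more transposition exchanges the two alternatives: this is
      the parity of \<open>p\<close> without signs.\<close>
    case (swap a b p)
    show ?case
    proof (cases "p \<in> A")
      case True
      then have "(transpose s t \<circ> transpose a b) \<circ> p \<in> A"
        using pair swap st comp by blast
      then have "transpose s t \<circ> (transpose a b \<circ> p) \<in> A" by (simp only: comp_assoc)
      then show ?thesis by blast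
    next
      case False
      then have "(transpose a b \<circ> transpose s t) \<circ> (transpose s t \<circ> p) \<in> A"
        using pair swap st comp by blast
      moreover have "(transpose a b \<circ> transpose s t) \<circ> (transpose s t \<circ> p) = transpose a b \<circ> p"
        by (simp add: fun_eq_iff)
      ultimately have "transpose a b \<circ> p \<in> A" by (simp only:)
      then show ?thesis by blast
    qed
  qed
qed

text \<open>An element of \<open>G\<close> outside \<open>A\<close> puts the transposition of
  \<open>s\<close> and \<open>t\<close> into \<open>G\<close>, and together with \<open>A\<close>
  this gives every permutation. Later \<open>A\<close> consists of the elements fixing a square root
  of plus or minus the discriminant.\<close>

lemma (in perm_group) symmetric_or_three_cycles:
  assumes cyc: "\<And>a b c. a \<in> R \<Longrightarrow> b \<in> R \<Longrightarrow> c \<in> R \<Longrightarrow> a \<noteq> b \<Longrightarrow> b \<noteq> c \<Longrightarrow> a \<noteq> c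
      \<Longrightarrow> transpose a b \<circ> transpose b c \<in> A"
    and A: "A \<subseteq> G" "id \<in> A" "\<And>p p'. p \<in> A \<Longrightarrow> p' \<in> A \<Longrightarrow> p \<circ> p' \<in> A"
    and st: "s \<in> R" "t \<in> R" "s \<noteq> t"
  shows "G = {p. p permutes R} \<or> G \<subseteq> A"
proof (cases "G \<subseteq> A")
  case False
  note cases = permutes_three_cycles_cases[OF finite_R st A(2,3) cyc]
  obtain p where p: "p \<in> G" "p \<notin> A" using False by blast
  then have "transpose s t \<circ> p \<in> G" using cases permutes_R A by blast
  then have "transpose s t \<circ> p \<circ> inv p \<in> G" using comp_in inv_in p by blast
  then have st_in: "transpose s t \<in> G" using inv_apply[OF p(1)] by (simp add: comp_assoc fun_eq_iff comp_def)
  have "p \<in> G" if "p permutes R" for p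
  proof (cases "p \<in> A")
    case False
    then have "transpose s t \<circ> (transpose s t \<circ> p) \<in> G" using cases[OF _ _ _ _ _ _ _ _ that] A st_in comp_in by blast
    then show ?thesis by (simp add: comp_def)
  qed (use A in blast)
  then show ?thesis using permutes_R by blast
qed simp

section \<open>Embeddings of subfields of the complex numbers\<close>

definition polys_over :: "'a::zero set \<Rightarrow> 'a poly set" where
  "polys_over K = {p. \<forall>i. coeff p i \<in> K}"

text \<open>\<open>s\<close> is a total function of which only the values on \<open>K\<close>
  matter, apart from which nothing is prescribed. The condition \<open>s 1 = 1\<close> excludes the
  zero map and so makes \<open>s\<close> injective on the field \<open>K\<close>.\<close>

definition embedding_C :: "complex set \<Rightarrow> (complex \<Rightarrow> complex) \<Rightarrow> bool" where
  "embedding_C K s \<longleftrightarrow> is_subfield_C K \<and> s 1 = 1 \<and>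
     (\<forall>x\<in>K. \<forall>y\<in>K. s (x + y) = s x + s y \<and> s (x * y) = s x * s y)"

locale subring_C =
  fixes K :: "complex set"
  assumes zero_in [simp]: "0 \<in> K" and one_in [simp]: "1 \<in> K"
    and add_in: "x \<in> K \<Longrightarrow> y \<in> K \<Longrightarrow> x + y \<in> K"
    and mult_in: "x \<in> K \<Longrightarrow> y \<in> K \<Longrightarrow> x * y \<in> K"
    and minus_in: "x \<in> K \<Longrightarrow> - x \<in> K"
begin

lemma diff_in: "x \<in> K \<Longrightarrow> y \<in> K \<Longrightarrow> x - y \<in> K"
  using add_in[OF _ minus_in, of x y] by simp

lemma sum_in: "(\<And>i. i \<in> A \<Longrightarrow> g i \<in> K) \<Longrightarrow> (\<Sum>i\<in>A. g i) \<in> K"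
  by (induction A rule: infinite_finite_induct) (auto intro: add_in)

lemma prod_in: "(\<And>i. i \<in> A \<Longrightarrow> g i \<in> K) \<Longrightarrow> (\<Prod>i\<in>A. g i) \<in> K"
  by (induction A rule: infinite_finite_induct) (auto intro: mult_in)

lemma power_in: "x \<in> K \<Longrightarrow> x ^ i \<in> K"
  by (induction i) (auto intro: mult_in)

lemma of_nat_in: "of_nat i \<in> K"
  by (induction i) (auto intro: add_in)

lemma of_int_in: "of_int i \<in> K"
  by (cases i rule: int_cases2) (auto intro: of_nat_in minus_in)

lemma polys_over_const: "c \<in> K \<Longrightarrow> [:c:] \<in> polys_over K"
  by (auto simp: polys_over_def coeff_pCons split: nat.split)

lemma polys_over_add: "p \<in> polys_over K \<Longrightarrow> r \<in> polys_over K \<Longrightarrow> p + r \<in> polys_over K"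
  by (auto simp: polys_over_def intro: add_in)

lemma polys_over_minus: "p \<in> polys_over K \<Longrightarrow> - p \<in> polys_over K"
  by (auto simp: polys_over_def intro: minus_in)

lemma polys_over_diff: "p \<in> polys_over K \<Longrightarrow> r \<in> polys_over K \<Longrightarrow> p - r \<in> polys_over K"
  by (auto simp: polys_over_def intro: diff_in)

lemma polys_over_mult: "p \<in> polys_over K \<Longrightarrow> r \<in> polys_over K \<Longrightarrow> p * r \<in> polys_over K"
  by (auto simp: polys_over_def coeff_mult intro!: sum_in mult_in)

lemma polys_over_monom: "c \<in> K \<Longrightarrow> monom c n \<in> polys_over K"
  by (auto simp: polys_over_def)

lemma polys_over_pderiv: "p \<in> polys_over K \<Longrightarrow> pderiv p \<in> polys_over K"
  by (auto simp: polys_over_def coeff_pderiv intro!: mult_in of_nat_in[of "Suc _", simplified])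

lemma poly_in: "p \<in> polys_over K \<Longrightarrow> x \<in> K \<Longrightarrow> poly p x \<in> K"
  by (auto simp: poly_altdef polys_over_def intro!: sum_in mult_in power_in)

lemma adjoin_subring: "subring_C ((\<lambda>h. poly h x) ` polys_over K)"
proof
  show "0 \<in> (\<lambda>h. poly h x) ` polys_over K" using polys_over_const[of 0] by force
  show "1 \<in> (\<lambda>h. poly h x) ` polys_over K" using polys_over_const[of 1] by force
next
  fix a b assume "a \<in> (\<lambda>h. poly h x) ` polys_over K" "b \<in> (\<lambda>h. poly h x) ` polys_over K"
  then obtain p r where p: "p \<in> polys_over K" "a = poly p x" and r: "r \<in> polys_over K" "b = poly r x" by auto
  show "a + b \<in> (\<lambda>h. poly h x) ` polys_over K"
    using p r polys_over_add by (intro image_eqI[of _ _ "p + r"]) auto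
  show "a * b \<in> (\<lambda>h. poly h x) ` polys_over K"
    using p r polys_over_mult by (intro image_eqI[of _ _ "p * r"]) auto
next
  fix a assume "a \<in> (\<lambda>h. poly h x) ` polys_over K"
  then obtain p where p: "p \<in> polys_over K" "a = poly p x" by auto
  then show "- a \<in> (\<lambda>h. poly h x) ` polys_over K"
    using polys_over_minus by (intro image_eqI[of _ _ "- p"]) auto
qed

lemma adjoin_contains: "K \<subseteq> (\<lambda>h. poly h x) ` polys_over K" "x \<in> (\<lambda>h. poly h x) ` polys_over K"
proof -
  show "K \<subseteq> (\<lambda>h. poly h x) ` polys_over K"
    using polys_over_const by (auto intro!: image_eqI[where x = "[:_:]"])
  have "[:0, 1:] \<in> polys_over K" by (auto simp: polys_over_def coeff_pCons split: nat.split)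
  then show "x \<in> (\<lambda>h. poly h x) ` polys_over K" by (intro image_eqI[of _ _ "[:0, 1:]"]) auto
qed

end

locale subfield_C =
  fixes K :: "complex set"
  assumes subfield: "is_subfield_C K"

sublocale subfield_C \<subseteq> subring_C
  using subfield by unfold_locales (auto simp: is_subfield_C_def)

context subfield_C
begin

lemma inverse_in: "x \<in> K \<Longrightarrow> inverse x \<in> K"
  using subfield by (auto simp: is_subfield_C_def)

lemma divide_in: "x \<in> K \<Longrightarrow> y \<in> K \<Longrightarrow> x / y \<in> K"
  using mult_in[OF _ inverse_in, of x y] by (simp add: field_simps)

text \<open>\<open>K\<close> is a set and not a type, so quotient and remainder have to be followed
  inside \<open>polys_over K\<close>.\<close>

lemma polys_over_division:
  assumes "p \<in> polys_over K" and d: "d \<in> polys_over K" "d \<noteq> 0"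
  shows "\<exists>u\<in>polys_over K. \<exists>r\<in>polys_over K. p = u * d + r \<and> (r = 0 \<or> degree r < degree d)"
  using assms(1)
proof (induction "degree p" arbitrary: p rule: less_induct)
  case less
  show ?case
  proof (cases "p = 0 \<or> degree p < degree d")
    case True
    then show ?thesis using less.prems polys_over_const[of 0]
      by (intro bexI[of _ 0] bexI[of _ p]) auto
  next
    case False
    define t where "t = monom (lead_coeff p / lead_coeff d) (degree p - degree d)"
    have t: "t \<in> polys_over K" unfolding t_def
      using less.prems d by (intro polys_over_monom divide_in) (auto simp: polys_over_def)
    have tne: "lead_coeff p / lead_coeff d \<noteq> 0" using False d by simp
    define p' where "p' = p - t * d"
    have p': "p' \<in> polys_over K" unfolding p'_def by (intro polys_over_diff polys_over_mult less.prems t d)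
    have deg_td: "degree (t * d) = degree p"
      using False d tne by (subst degree_mult_eq) (auto simp: t_def degree_monom_eq)
    have lc: "lead_coeff (t * d) = lead_coeff p"
      using d tne by (simp add: lead_coeff_mult t_def degree_monom_eq)
    have IH: "\<exists>u\<in>polys_over K. \<exists>r\<in>polys_over K. p' = u * d + r \<and> (r = 0 \<or> degree r < degree d)"
    proof (cases "p' = 0")
      case True
      then show ?thesis using polys_over_const[of 0] by (intro bexI[of _ 0] bexI[of _ 0]) auto
    next
      case p'0: False
      have le: "degree p' \<le> degree p" using deg_td by (simp add: p'_def degree_diff_le)
      have "coeff p' (degree p) = 0" using lc deg_td by (simp add: p'_def)
      then have "degree p' \<noteq> degree p" using p'0 by (metis leading_coeff_0_iff)
      then show ?thesis using less.hyps[of p'] p' le by simp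
    qed
    then obtain u r where ur: "u \<in> polys_over K" "r \<in> polys_over K" "p' = u * d + r"
      "r = 0 \<or> degree r < degree d" by blast
    have "p = (u + t) * d + r" using ur(3) by (simp add: p'_def algebra_simps)
    then show ?thesis using ur t polys_over_add by blast
  qed
qed

end

locale embedding = subfield_C K for K +
  fixes s :: "complex \<Rightarrow> complex"
  assumes emb: "embedding_C K s"
begin

lemma s_add: "x \<in> K \<Longrightarrow> y \<in> K \<Longrightarrow> s (x + y) = s x + s y"
  and s_mult: "x \<in> K \<Longrightarrow> y \<in> K \<Longrightarrow> s (x * y) = s x * s y"
  and s_1 [simp]: "s 1 = 1"
  using emb by (auto simp: embedding_C_def)

lemma s_0 [simp]: "s 0 = 0"
  using s_add[of 0 0] by simp

lemma s_minus: "x \<in> K \<Longrightarrow> s (- x) = - s x"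
  using s_add[of x "- x"] minus_in by (simp add: add_eq_0_iff2)

lemma s_diff: "x \<in> K \<Longrightarrow> y \<in> K \<Longrightarrow> s (x - y) = s x - s y"
  using s_add[of x "- y"] s_minus[of y] minus_in by simp

lemma s_nonzero: "x \<in> K \<Longrightarrow> x \<noteq> 0 \<Longrightarrow> s x \<noteq> 0"
  using s_mult[of x "inverse x"] inverse_in by auto

lemma s_inverse: "x \<in> K \<Longrightarrow> s (inverse x) = inverse (s x)"
  using s_mult[of x "inverse x"] inverse_in s_nonzero
  by (cases "x = 0") (auto simp: field_simps)

lemma s_inj: "x \<in> K \<Longrightarrow> y \<in> K \<Longrightarrow> s x = s y \<Longrightarrow> x = y"
  using s_nonzero[of "x - y"] s_diff[of x y] diff_in by auto

lemma s_sum: "(\<And>i. i \<in> A \<Longrightarrow> g i \<in> K) \<Longrightarrow> s (\<Sum>i\<in>A. g i) = (\<Sum>i\<in>A. s (g i))"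
  by (induction A rule: infinite_finite_induct) (auto simp: s_add sum_in)

lemma s_prod: "(\<And>i. i \<in> A \<Longrightarrow> g i \<in> K) \<Longrightarrow> s (\<Prod>i\<in>A. g i) = (\<Prod>i\<in>A. s (g i))"
  by (induction A rule: infinite_finite_induct) (auto simp: s_mult prod_in)

lemma s_power: "x \<in> K \<Longrightarrow> s (x ^ i) = s x ^ i"
  by (induction i) (auto simp: s_mult power_in)

lemma s_of_nat: "s (of_nat i) = of_nat i"
  by (induction i) (auto simp: s_add of_nat_in)

lemma s_of_int: "s (of_int i) = of_int i"
  by (cases i rule: int_cases2) (auto simp: s_of_nat s_minus of_nat_in)

lemma coeff_map [simp]: "coeff (map_poly s p) i = s (coeff p i)"
  by (simp add: coeff_map_poly)

lemma map_add: "p \<in> polys_over K \<Longrightarrow> r \<in> polys_over K \<Longrightarrow> map_poly s (p + r) = map_poly s p + map_poly s r"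
  by (rule poly_eqI) (auto simp: polys_over_def s_add)

lemma map_mult: "p \<in> polys_over K \<Longrightarrow> r \<in> polys_over K \<Longrightarrow> map_poly s (p * r) = map_poly s p * map_poly s r"
  by (rule poly_eqI) (auto simp: polys_over_def coeff_mult s_sum s_mult mult_in)

lemma map_pderiv: "p \<in> polys_over K \<Longrightarrow> map_poly s (pderiv p) = pderiv (map_poly s p)"
proof (rule poly_eqI)
  fix n assume p: "p \<in> polys_over K"
  show "coeff (map_poly s (pderiv p)) n = coeff (pderiv (map_poly s p)) n"
    using p s_mult[OF of_nat_in[of "Suc n"], of "coeff p (Suc n)"] s_of_nat[of "Suc n"]
    by (simp add: coeff_pderiv polys_over_def)
qed

lemma degree_map: "p \<in> polys_over K \<Longrightarrow> degree (map_poly s p) = degree p"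
  using s_nonzero[of "lead_coeff p"]
  by (cases "p = 0") (auto intro!: map_poly_degree_eq simp: polys_over_def)

lemma map_eq_0: "p \<in> polys_over K \<Longrightarrow> map_poly s p = 0 \<longleftrightarrow> p = 0"
  using s_nonzero[of "lead_coeff p"] by (auto simp: polys_over_def poly_eq_iff)

end

lemma embedding_iff: "embedding K s \<longleftrightarrow> embedding_C K s"
  by (auto simp: embedding_def embedding_axioms_def subfield_C_def embedding_C_def)

section \<open>Simple algebraic extensions and their embeddings\<close>

locale min_poly = subfield_C K for K +
  fixes x :: complex and \<mu> :: "complex poly"
  assumes mu: "\<mu> \<in> polys_over K" "\<mu> \<noteq> 0" "poly \<mu> x = 0"
    and minimal: "h \<in> polys_over K \<Longrightarrow> h \<noteq> 0 \<Longrightarrow> poly h x = 0 \<Longrightarrow> degree \<mu> \<le> degree h"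
begin

lemma degree_pos: "degree \<mu> > 0"
  using mu by (metis degree_0_id gr0I poly_0 poly_const_conv pCons_0_0 degree_eq_zeroE)

lemma reduce:
  assumes "h \<in> polys_over K"
  shows "\<exists>r\<in>polys_over K. \<exists>u\<in>polys_over K. h = u * \<mu> + r \<and> degree r < degree \<mu>"
  using polys_over_division[OF assms mu(1,2)] degree_pos by (metis degree_0)

lemma multiple:
  assumes "h \<in> polys_over K" "poly h x = 0"
  shows "\<exists>u\<in>polys_over K. h = u * \<mu>"
proof -
  obtain u r where ur: "u \<in> polys_over K" "r \<in> polys_over K" "h = u * \<mu> + r" "degree r < degree \<mu>"
    using reduce[OF assms(1)] by blast
  then have "poly r x = 0" using assms mu by simp
  then have "r = 0" using minimal[OF ur(2)] ur(4) by fastforce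
  then show ?thesis using ur by auto
qed

text \<open>Euclid's algorithm: dividing \<open>\<mu>\<close> by \<open>h\<close> and evaluating at
  \<open>x\<close> turns an inverse of the remainder into one of \<open>h\<close>. If the remainder
  vanishes, \<open>h\<close> divides \<open>\<mu>\<close>, and minimality makes it constant.\<close>

lemma inverse_aux:
  assumes "h \<in> polys_over K" "degree h < degree \<mu>" "poly h x \<noteq> 0"
  shows "\<exists>u\<in>polys_over K. poly u x * poly h x = 1"
  using assms
proof (induction "degree h" arbitrary: h rule: less_induct)
  case less
  have "h \<noteq> 0" using less.prems by auto
  then obtain u r where ur: "u \<in> polys_over K" "r \<in> polys_over K" "\<mu> = u * h + r"
    "r = 0 \<or> degree r < degree h"
    using polys_over_division[OF mu(1) less.prems(1)] by blast
  have *: "poly r x = - (poly u x * poly h x)"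
    using mu(3) ur(3) by (metis add_eq_0_iff poly_add poly_mult)
  show ?case
  proof (cases "poly r x = 0")
    case False
    then have "degree r < degree h" using ur by auto
    then obtain v where v: "v \<in> polys_over K" "poly v x * poly r x = 1"
      using less.hyps[of r] ur less.prems False by auto
    then show ?thesis
      using * ur by (intro bexI[of _ "- (v * u)"]) (auto intro: polys_over_minus polys_over_mult simp: mult.assoc)
  next
    case True
    have "r = 0" using minimal[OF ur(2)] True ur(4) less.prems(2) by fastforce
    then have \<mu>: "\<mu> = u * h" using ur by simp
    have "poly u x = 0" using * True less.prems by simp
    moreover have "u \<noteq> 0" using \<mu> mu by auto
    ultimately have "degree \<mu> \<le> degree u" using minimal ur by blast
    moreover have "degree \<mu> = degree u + degree h"
      using \<mu> \<open>u \<noteq> 0\<close> \<open>h \<noteq> 0\<close> by (simp add: degree_mult_eq)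
    ultimately have "degree h = 0" by simp
    then obtain c where c: "h = [:c:]" by (metis degree_eq_zeroE)
    then have "c \<noteq> 0" "coeff h 0 = c" using less.prems by auto
    then have "c \<in> K" using less.prems by (auto simp: polys_over_def)
    then show ?thesis
      using c \<open>c \<noteq> 0\<close> by (intro bexI[of _ "[:inverse c:]"]) (auto intro: polys_over_const inverse_in)
  qed
qed

lemma inverse_exists:
  assumes "h \<in> polys_over K" "poly h x \<noteq> 0"
  shows "\<exists>u\<in>polys_over K. poly u x * poly h x = 1"
proof -
  obtain u r where ur: "u \<in> polys_over K" "r \<in> polys_over K" "h = u * \<mu> + r" "degree r < degree \<mu>"
    using reduce[OF assms(1)] by blast
  then have "poly r x = poly h x" using mu by simp
  then show ?thesis using inverse_aux[of r] ur assms by metis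
qed

lemma adjoin_subfield: "is_subfield_C ((\<lambda>h. poly h x) ` polys_over K)"
proof -
  interpret A: subring_C "(\<lambda>h. poly h x) ` polys_over K" by (rule adjoin_subring)
  have inv: "inverse a \<in> (\<lambda>h. poly h x) ` polys_over K" if a: "a \<in> (\<lambda>h. poly h x) ` polys_over K" for a
  proof (cases "a = 0")
    case True
    then show ?thesis using A.zero_in by simp
  next
    case False
    obtain p where p: "p \<in> polys_over K" "a = poly p x" using a by auto
    then obtain u where u: "u \<in> polys_over K" "poly u x * a = 1"
      using inverse_exists[OF p(1)] False by blast
    then have "inverse a = poly u x" by (metis inverse_unique mult.commute)
    then show ?thesis using u by auto
  qed
  show ?thesis
    unfolding is_subfield_C_def
    by (intro conjI ballI A.zero_in A.one_in A.add_in A.mult_in A.minus_in inv)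
qed

text \<open>The prescribed value at \<open>poly h x\<close> depends on \<open>h\<close> only modulo
  \<open>\<mu>\<close>, because the image of \<open>\<mu>\<close> under \<open>s\<close> vanishes at
  \<open>y\<close>.\<close>

lemma extend:
  assumes "embedding K s" and y: "poly (map_poly s \<mu>) y = 0"
  shows "\<exists>t. embedding ((\<lambda>h. poly h x) ` polys_over K) t \<and>
    (\<forall>h\<in>polys_over K. t (poly h x) = poly (map_poly s h) y)"
proof -
  interpret embedding K s by (rule assms)
  have well: "poly (map_poly s h) y = poly (map_poly s h') y"
    if h: "h \<in> polys_over K" "h' \<in> polys_over K" "poly h x = poly h' x" for h h'
  proof -
    obtain u where u: "u \<in> polys_over K" "h - h' = u * \<mu>"
      using multiple[OF polys_over_diff[OF h(1,2)]] h(3) by auto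
    then have "h = h' + u * \<mu>" by (simp add: algebra_simps)
    then have "map_poly s h = map_poly s h' + map_poly s u * map_poly s \<mu>"
      using u h mu by (simp add: map_add map_mult polys_over_mult)
    then show ?thesis using y by simp
  qed
  define t where "t z = poly (map_poly s (SOME h. h \<in> polys_over K \<and> poly h x = z)) y" for z
  have t: "t (poly h x) = poly (map_poly s h) y" if "h \<in> polys_over K" for h
    unfolding t_def using someI[of "\<lambda>h'. h' \<in> polys_over K \<and> poly h' x = poly h x" h] that
    by (intro well) auto
  have "embedding_C ((\<lambda>h. poly h x) ` polys_over K) t"
    unfolding embedding_C_def
  proof (intro conjI ballI)
    show "t 1 = 1" using t[of "[:1:]"] polys_over_const[of 1] by (simp add: map_poly_pCons)
    fix a b assume "a \<in> (\<lambda>h. poly h x) ` polys_over K" "b \<in> (\<lambda>h. poly h x) ` polys_over K"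
    then obtain p r where p: "p \<in> polys_over K" "a = poly p x" and r: "r \<in> polys_over K" "b = poly r x" by auto
    show "t (a + b) = t a + t b"
      using t[OF polys_over_add[OF p(1) r(1)]] t p r by (simp add: map_add)
    show "t (a * b) = t a * t b"
      using t[OF polys_over_mult[OF p(1) r(1)]] t p r by (simp add: map_mult)
  qed (rule adjoin_subfield)
  then show ?thesis using t embedding_iff by blast
qed

text \<open>The extension of \<open>s\<close> taking \<open>x\<close> to \<open>y\<close> is
  injective. It carries the derivative of \<open>\<mu>\<close> at \<open>x\<close>, nonzero by
  minimality, to the derivative of the image polynomial at \<open>y\<close>.\<close>

lemma embedded_roots_simple:
  assumes "embedding K s" and y: "poly (map_poly s \<mu>) y = 0"
  shows "poly (pderiv (map_poly s \<mu>)) y \<noteq> 0"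
proof -
  interpret embedding K s by (rule assms)
  obtain t where t: "embedding ((\<lambda>h. poly h x) ` polys_over K) t"
    "\<forall>h\<in>polys_over K. t (poly h x) = poly (map_poly s h) y" using extend[OF assms] by blast
  interpret T: embedding "(\<lambda>h. poly h x) ` polys_over K" t by (rule t)
  have d: "pderiv \<mu> \<in> polys_over K" by (intro polys_over_pderiv mu)
  have "pderiv \<mu> \<noteq> 0" using degree_pos by (simp add: pderiv_eq_0_iff)
  moreover have "degree (pderiv \<mu>) < degree \<mu>" using degree_pos by (simp add: degree_pderiv)
  ultimately have "poly (pderiv \<mu>) x \<noteq> 0" using minimal[OF d] by fastforce
  then have "t (poly (pderiv \<mu>) x) \<noteq> 0" using d by (intro T.s_nonzero) auto
  then show ?thesis using t(2) d mu by (simp add: map_pderiv)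
qed

lemma card_embedded_roots:
  assumes "embedding K s"
  shows "card {y. poly (map_poly s \<mu>) y = 0} = degree \<mu>" "rsquarefree (map_poly s \<mu>)"
proof -
  interpret embedding K s by (rule assms)
  show *: "rsquarefree (map_poly s \<mu>)"
    unfolding rsquarefree_roots using embedded_roots_simple[OF assms] by blast
  have "map_poly s \<mu> \<noteq> 0" using mu map_eq_0 by simp
  have "map_poly s \<mu> = smult (lead_coeff (map_poly s \<mu>)) (\<Prod>z|poly (map_poly s \<mu>) z = 0. [:-z, 1:])"
    by (rule complex_poly_decompose_rsquarefree[OF *, symmetric])
  then have "degree (map_poly s \<mu>) = degree (\<Prod>z|poly (map_poly s \<mu>) z = 0. [:-z, 1:])"
    using \<open>map_poly s \<mu> \<noteq> 0\<close> by (metis degree_smult_eq leading_coeff_0_iff)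
  also have "\<dots> = card {y. poly (map_poly s \<mu>) y = 0}"
    by (subst degree_prod_sum_eq) auto
  finally show "card {y. poly (map_poly s \<mu>) y = 0} = degree \<mu>" using mu degree_map by simp
qed

text \<open>Reduced modulo \<open>\<mu>\<close>, \<open>h\<close> is nonconstant of degree below
  \<open>degree \<mu>\<close>, so its image cannot take one value at all of the
  \<open>degree \<mu>\<close> distinct roots. This is how two embeddings come to differ at an
  element outside \<open>K\<close>.\<close>

lemma separating_roots:
  assumes "embedding K s" and h: "h \<in> polys_over K" and hx: "poly h x \<notin> K"
  shows "\<exists>y y'. poly (map_poly s \<mu>) y = 0 \<and> poly (map_poly s \<mu>) y' = 0 \<and>
    poly (map_poly s h) y \<noteq> poly (map_poly s h) y'"
proof (rule ccontr)
  assume contra: "\<not> ?thesis"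
  interpret embedding K s by (rule assms)
  obtain u r where ur: "u \<in> polys_over K" "r \<in> polys_over K" "h = u * \<mu> + r" "degree r < degree \<mu>"
    using reduce[OF h] by blast
  have rx: "poly r x = poly h x" using ur mu by simp
  have sr: "poly (map_poly s h) y = poly (map_poly s r) y" if "poly (map_poly s \<mu>) y = 0" for y
    using ur that mu by (simp add: map_add map_mult polys_over_mult)
  have "degree r \<noteq> 0"
  proof
    assume "degree r = 0"
    then obtain c where "r = [:c:]" by (metis degree_eq_zeroE)
    then have "poly h x = coeff r 0" using rx by simp
    then show False using ur(2) hx by (simp add: polys_over_def)
  qed
  have "card {y. poly (map_poly s \<mu>) y = 0} > 0"
    using card_embedded_roots(1)[OF assms(1)] degree_pos by simp
  then obtain y where y: "poly (map_poly s \<mu>) y = 0" by (metis (mono_tags, lifting) Collect_empty_eq card.empty less_irrefl)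
  define w where "w = map_poly s r - [:poly (map_poly s r) y:]"
  have "degree (map_poly s r) = degree r" using ur degree_map by simp
  then have "coeff w (degree r) \<noteq> 0"
  proof -
    have "r \<noteq> 0" using \<open>degree r \<noteq> 0\<close> by auto
    then have "s (lead_coeff r) \<noteq> 0" using ur(2) by (intro s_nonzero) (auto simp: polys_over_def)
    then show ?thesis using \<open>degree r \<noteq> 0\<close> by (auto simp: w_def coeff_pCons split: nat.splits)
  qed
  then have "w \<noteq> 0" by auto
  have degw: "degree w \<le> degree r"
    unfolding w_def using ur degree_map by (intro degree_diff_le) auto
  have "{y. poly (map_poly s \<mu>) y = 0} \<subseteq> {z. poly w z = 0}"
  proof clarify
    fix z assume z: "poly (map_poly s \<mu>) z = 0"
    then have "poly (map_poly s h) z = poly (map_poly s h) y" using contra y by blast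
    then show "poly w z = 0" using sr[OF z] sr[OF y] by (simp add: w_def)
  qed
  then have "degree \<mu> \<le> card {z. poly w z = 0}"
    using card_embedded_roots(1)[OF assms(1)] card_mono[OF poly_roots_finite[OF \<open>w \<noteq> 0\<close>]] by metis
  also have "\<dots> \<le> degree w" by (rule card_poly_roots_bound[OF \<open>w \<noteq> 0\<close>])
  finally show False using degw ur(4) by simp
qed

lemmas adjoin_mem = adjoin_contains[of x]

lemma extend_restrict:
  assumes "embedding K s" "\<forall>h\<in>polys_over K. t (poly h x) = poly (map_poly s h) y"
  shows "z \<in> K \<Longrightarrow> t z = s z" "t x = y"
proof -
  interpret embedding K s by (rule assms)
  show "t z = s z" if "z \<in> K"
    using assms(2) polys_over_const[OF that] by (force simp: map_poly_pCons)
  have "[:0, 1:] \<in> polys_over K" by (auto simp: polys_over_def coeff_pCons split: nat.split)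
  then show "t x = y" using assms(2) by (force simp: map_poly_pCons)
qed

end

lemma (in subfield_C) min_poly_exists:
  assumes "h \<in> polys_over K" "h \<noteq> 0" "poly h x = 0"
  shows "\<exists>\<mu>. min_poly K x \<mu>"
proof -
  have "h \<in> polys_over K \<and> h \<noteq> 0 \<and> poly h x = 0" using assms by simp
  then obtain \<mu> where "\<mu> \<in> polys_over K \<and> \<mu> \<noteq> 0 \<and> poly \<mu> x = 0"
    "\<forall>h. h \<in> polys_over K \<and> h \<noteq> 0 \<and> poly h x = 0 \<longrightarrow> degree \<mu> \<le> degree h"
    using ex_has_least_nat[of "\<lambda>h. h \<in> polys_over K \<and> h \<noteq> 0 \<and> poly h x = 0" h degree] by blast
  then show ?thesis by (intro exI[of _ \<mu>]) (unfold_locales; auto)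
qed

lemma (in subfield_C) min_poly_algebraic:
  assumes "algebraic x" shows "\<exists>\<mu>. min_poly K x \<mu>"
proof -
  obtain h where h: "\<And>i. coeff h i \<in> \<int>" "h \<noteq> 0" "poly h x = 0" using algebraicE[OF assms] by blast
  then have "h \<in> polys_over K" using of_int_in by (auto simp: polys_over_def elim!: Ints_cases) (metis Ints_cases)
  then show ?thesis using min_poly_exists h by blast
qed

lemma extend_finite:
  assumes "finite A" "\<forall>x\<in>A. algebraic x" "embedding K s"
  shows "\<exists>K' s'. embedding K' s' \<and> K \<subseteq> K' \<and> A \<subseteq> K' \<and> (\<forall>x\<in>K. s' x = s x)"
  using assms
proof (induction A arbitrary: K s rule: finite_induct)
  case empty
  then show ?case by auto
next
  case (insert x A)
  interpret embedding K s by (rule insert.prems)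
  obtain \<mu> where "min_poly K x \<mu>" using min_poly_algebraic insert.prems by blast
  then interpret min_poly K x \<mu> .
  have "card {y. poly (map_poly s \<mu>) y = 0} > 0"
    using card_embedded_roots(1)[OF insert.prems(2)] degree_pos by simp
  then obtain y where y: "poly (map_poly s \<mu>) y = 0"
    by (metis (mono_tags, lifting) Collect_empty_eq card.empty less_irrefl)
  obtain t where t: "embedding ((\<lambda>h. poly h x) ` polys_over K) t"
    "\<forall>h\<in>polys_over K. t (poly h x) = poly (map_poly s h) y" using extend[OF insert.prems(2) y] by blast
  obtain K' s' where K': "embedding K' s'" "(\<lambda>h. poly h x) ` polys_over K \<subseteq> K'" "A \<subseteq> K'"
    "\<forall>z\<in>(\<lambda>h. poly h x) ` polys_over K. s' z = t z"
    using insert.IH[OF _ t(1)] insert.prems by blast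
  have "s' z = s z" if "z \<in> K" for z
    using that adjoin_mem(1) K'(4) extend_restrict(1)[OF insert.prems(2) t(2)] by auto
  moreover have "K \<subseteq> K'" "insert x A \<subseteq> K'" using K'(2,3) adjoin_mem by auto
  ultimately show ?case using K'(1) by blast
qed

text \<open>The hypothesis about all \<open>F\<close> says that \<open>z\<close> lies in the field
  generated by \<open>K\<close> and \<open>A\<close>, without forming it. Elements of
  \<open>A\<close> are adjoined until \<open>z\<close> appears; there two images of the new element
  give \<open>z\<close> different values, and both choices extend to the rest of
  \<open>A\<close>.\<close>

lemma separate_finite:
  assumes "finite A" "\<forall>x\<in>A. algebraic x" "embedding K s"
    and "\<And>F. is_subfield_C F \<Longrightarrow> K \<subseteq> F \<Longrightarrow> A \<subseteq> F \<Longrightarrow> z \<in> F" and "z \<notin> K"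
  shows "\<exists>K1 s1 K2 s2. embedding K1 s1 \<and> embedding K2 s2 \<and> K \<subseteq> K1 \<and> K \<subseteq> K2 \<and> A \<subseteq> K1 \<and> A \<subseteq> K2 \<and>
    (\<forall>x\<in>K. s1 x = s x \<and> s2 x = s x) \<and> s1 z \<noteq> s2 z"
  using assms
proof (induction A arbitrary: K s rule: finite_induct)
  case (empty K s)
  interpret embedding K s by (rule empty.prems)
  show ?case using empty subfield by blast
next
  case (insert x A)
  interpret embedding K s by (rule insert.prems)
  obtain \<mu> where "min_poly K x \<mu>" using min_poly_algebraic insert.prems by blast
  then interpret min_poly K x \<mu> .
  let ?K = "(\<lambda>h. poly h x) ` polys_over K"
  have alg: "\<forall>x\<in>A. algebraic x" using insert.prems by blast
  show ?case
  proof (cases "z \<in> ?K")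
    case True
    then obtain h where h: "h \<in> polys_over K" "z = poly h x" by auto
    obtain y y' where y: "poly (map_poly s \<mu>) y = 0" "poly (map_poly s \<mu>) y' = 0"
      "poly (map_poly s h) y \<noteq> poly (map_poly s h) y'"
      using separating_roots[OF insert.prems(2) h(1)] h(2) insert.prems(4) by blast
    obtain t where t: "embedding ?K t" "\<forall>h\<in>polys_over K. t (poly h x) = poly (map_poly s h) y"
      using extend[OF insert.prems(2) y(1)] by blast
    obtain t' where t': "embedding ?K t'" "\<forall>h\<in>polys_over K. t' (poly h x) = poly (map_poly s h) y'"
      using extend[OF insert.prems(2) y(2)] by blast
    obtain K1 s1 where 1: "embedding K1 s1" "?K \<subseteq> K1" "A \<subseteq> K1" "\<forall>x\<in>?K. s1 x = t x"
      using extend_finite[OF insert.hyps(1) alg t(1)] by blast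
    obtain K2 s2 where 2: "embedding K2 s2" "?K \<subseteq> K2" "A \<subseteq> K2" "\<forall>x\<in>?K. s2 x = t' x"
      using extend_finite[OF insert.hyps(1) alg t'(1)] by blast
    have "s1 z \<noteq> s2 z" using True 1 2 t t' h y by auto
    moreover have "\<forall>x\<in>K. s1 x = s x \<and> s2 x = s x"
      using 1(4) 2(4) adjoin_mem(1) extend_restrict(1)[OF insert.prems(2) t(2)]
        extend_restrict(1)[OF insert.prems(2) t'(2)] by (metis subsetD)
    moreover have "K \<subseteq> K1" "K \<subseteq> K2" "insert x A \<subseteq> K1" "insert x A \<subseteq> K2"
      using adjoin_mem 1 2 by auto
    ultimately show ?thesis using 1(1) 2(1) by blast
  next
    case False
    have "card {y. poly (map_poly s \<mu>) y = 0} > 0"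
      using card_embedded_roots(1)[OF insert.prems(2)] degree_pos by simp
    then obtain y where y: "poly (map_poly s \<mu>) y = 0"
      by (metis (mono_tags, lifting) Collect_empty_eq card.empty less_irrefl)
    obtain t where t: "embedding ?K t" "\<forall>h\<in>polys_over K. t (poly h x) = poly (map_poly s h) y"
      using extend[OF insert.prems(2) y] by blast
    have "z \<in> F" if "is_subfield_C F" "?K \<subseteq> F" "A \<subseteq> F" for F
      using insert.prems(3)[OF that(1)] that adjoin_mem by blast
    then obtain K1 s1 K2 s2 where 1: "embedding K1 s1" "embedding K2 s2" "?K \<subseteq> K1" "?K \<subseteq> K2"
      "A \<subseteq> K1" "A \<subseteq> K2" "\<forall>x\<in>?K. s1 x = t x \<and> s2 x = t x" "s1 z \<noteq> s2 z"
      using insert.IH[OF alg t(1) _ False] by metis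
    have "\<forall>x\<in>K. s1 x = s x \<and> s2 x = s x"
      using 1(7) adjoin_mem(1) extend_restrict(1)[OF insert.prems(2) t(2)] by (metis subsetD)
    moreover have "K \<subseteq> K1" "K \<subseteq> K2" "insert x A \<subseteq> K1" "insert x A \<subseteq> K2"
      using adjoin_mem 1 by auto
    ultimately show ?thesis using 1(1,2,8) by blast
  qed
qed

section \<open>The splitting field and its automorphisms\<close>

lemma splitting_field_subfield: "subfield_C (splitting_field_C f)"
  by (auto simp: subfield_C_def splitting_field_C_def is_subfield_C_def)

lemma splitting_field_subring: "subring_C (splitting_field_C f)"
proof -
  interpret subfield_C "splitting_field_C f" by (rule splitting_field_subfield)
  show ?thesis by (rule subring_C_axioms)
qed

lemma roots_in_splitting_field: "complex_roots f \<subseteq> splitting_field_C f"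
  by (auto simp: splitting_field_C_def)

lemma splitting_field_least:
  "is_subfield_C K \<Longrightarrow> complex_roots f \<subseteq> K \<Longrightarrow> splitting_field_C f \<subseteq> K"
  by (auto simp: splitting_field_C_def)

lemma algebraic_root:
  assumes "f \<noteq> 0" "z \<in> complex_roots f"
  shows "algebraic z"
  using assms by (intro algebraicI[of "map_poly of_int f"]) (auto simp: coeff_map_poly complex_roots_def poly_eq_iff)

lemma finite_complex_roots:
  assumes "f \<noteq> 0" shows "finite (complex_roots f)"
  unfolding complex_roots_def using assms by (intro poly_roots_finite) (auto simp: poly_eq_iff coeff_map_poly)

lemma (in embedding) s_poly_of_int:
  assumes z: "z \<in> K"
  shows "s (poly (map_poly of_int h) z) = poly (map_poly of_int h) (s z)"
proof -
  let ?h = "map_poly of_int h :: complex poly"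
  have "poly ?h (s z) = (\<Sum>i\<le>degree ?h. s (coeff ?h i * z ^ i))"
    unfolding poly_altdef using z
    by (intro sum.cong) (simp_all add: coeff_map_poly s_mult s_of_int s_power of_int_in power_in)
  also have "\<dots> = s (poly ?h z)"
    unfolding poly_altdef using z by (intro s_sum[symmetric] mult_in power_in) (auto simp: coeff_map_poly of_int_in)
  finally show ?thesis by simp
qed

lemma (in embedding) map_complex_root:
  "z \<in> K \<Longrightarrow> z \<in> complex_roots f \<Longrightarrow> s z \<in> complex_roots f"
  using s_poly_of_int[of z f] by (simp add: complex_roots_def)

lemma (in embedding) preimage_subfield:
  assumes "is_subfield_C F" shows "is_subfield_C {x \<in> K. s x \<in> F}"
proof -
  interpret F: subfield_C F by unfold_locales (rule assms)
  show ?thesis unfolding is_subfield_C_def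
    by (auto simp: s_add s_mult s_minus s_inverse add_in mult_in minus_in inverse_in
        F.add_in F.mult_in F.minus_in F.inverse_in)
qed

lemma (in embedding) image_subfield:
  assumes "is_subfield_C F" "F \<subseteq> K" shows "is_subfield_C (s ` F)"
proof -
  interpret F: subfield_C F by unfold_locales (rule assms)
  have *: "s x + s y = s (x + y)" "s x * s y = s (x * y)" if "x \<in> F" "y \<in> F" for x y
    using that assms(2) s_add[of x y] s_mult[of x y] by (simp_all add: subset_iff)
  have **: "- s x = s (- x)" "inverse (s x) = s (inverse x)" if "x \<in> F" for x
    using that assms(2) s_minus[of x] s_inverse[of x] by (simp_all add: subset_iff)
  have "0 \<in> s ` F" "1 \<in> s ` F" using imageI[OF F.zero_in, of s] imageI[OF F.one_in, of s] by auto
  then show ?thesis unfolding is_subfield_C_def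
    by (auto simp: * ** F.add_in F.mult_in F.minus_in F.inverse_in)
qed

text \<open>\<open>s\<close> permutes the finite set of roots, so the preimage and the image of the
  splitting field are both fields containing all roots; leastness then gives the two
  inclusions.\<close>

lemma (in embedding) restricts_to_splitting_field:
  assumes f: "f \<noteq> 0" and R: "complex_roots f \<subseteq> K"
  shows "s \<in> gal_auts f"
proof -
  let ?L = "splitting_field_C f"
  have LK: "?L \<subseteq> K" using splitting_field_least[OF subfield R] .
  interpret L: subfield_C ?L by (rule splitting_field_subfield)
  have "?L \<subseteq> {x \<in> K. s x \<in> ?L}"
    using R roots_in_splitting_field map_complex_root
    by (intro splitting_field_least preimage_subfield L.subfield) blast
  then have into: "s ` ?L \<subseteq> ?L" by blast
  have inj: "inj_on s K" using s_inj by (rule inj_onI)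
  have "s ` complex_roots f = complex_roots f"
    using R map_complex_root inj
    by (intro endo_inj_surj finite_complex_roots f) (auto intro: inj_on_subset)
  then have "complex_roots f \<subseteq> s ` ?L" using roots_in_splitting_field by blast
  then have "?L \<subseteq> s ` ?L"
    by (intro splitting_field_least image_subfield L.subfield LK)
  then have "bij_betw s ?L ?L" using into inj LK by (auto simp: bij_betw_def intro: inj_on_subset)
  then show ?thesis using LK by (auto simp: gal_auts_def s_add s_mult subset_iff)
qed

lemma gal_aut_embedding:
  assumes "s \<in> gal_auts f" shows "embedding (splitting_field_C f) s"
proof -
  let ?L = "splitting_field_C f"
  interpret L: subfield_C ?L by (rule splitting_field_subfield)
  have s: "bij_betw s ?L ?L" "\<And>x y. x \<in> ?L \<Longrightarrow> y \<in> ?L \<Longrightarrow> s (x + y) = s x + s y"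
    "\<And>x y. x \<in> ?L \<Longrightarrow> y \<in> ?L \<Longrightarrow> s (x * y) = s x * s y"
    using assms by (auto simp: gal_auts_def)
  have "s 0 = 0" using s(2)[of 0 0] by simp
  then have "s 1 \<noteq> 0" using s(1) by (metis L.one_in L.zero_in bij_betw_imp_inj_on inj_onD zero_neq_one)
  then have "s 1 = 1" using s(3)[of 1 1] by simp
  then show ?thesis using s L.subfield by (simp add: embedding_iff embedding_C_def)
qed

lemma gal_aut_roots:
  assumes "f \<noteq> 0" "s \<in> gal_auts f" shows "bij_betw s (complex_roots f) (complex_roots f)"
proof -
  interpret embedding "splitting_field_C f" s by (rule gal_aut_embedding) fact
  have inj: "inj_on s (complex_roots f)"
    using s_inj roots_in_splitting_field by (meson inj_onI subsetD)
  moreover have "s ` complex_roots f = complex_roots f"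
    using inj map_complex_root roots_in_splitting_field
    by (intro endo_inj_surj finite_complex_roots assms) auto
  ultimately show ?thesis by (simp add: bij_betw_def)
qed

lemma gal_aut_comp: "s \<in> gal_auts f \<Longrightarrow> t \<in> gal_auts f \<Longrightarrow> s \<circ> t \<in> gal_auts f"
  using bij_betw_trans[of t _ _ s] by (auto simp: gal_auts_def dest: bij_betwE)

lemma gal_aut_id: "id \<in> gal_auts f"
  by (auto simp: gal_auts_def)

text \<open>The elements on which two automorphisms agree form a subfield.\<close>

lemma gal_aut_eqI:
  assumes s: "s \<in> gal_auts f" and t: "t \<in> gal_auts f"
    and eq: "\<And>x. x \<in> complex_roots f \<Longrightarrow> s x = t x" and x: "x \<in> splitting_field_C f"
  shows "s x = t x"
proof -
  interpret S: embedding "splitting_field_C f" s by (rule gal_aut_embedding) fact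
  interpret T: embedding "splitting_field_C f" t by (rule gal_aut_embedding) fact
  have "is_subfield_C {x \<in> splitting_field_C f. s x = t x}"
    unfolding is_subfield_C_def
    by (auto simp: S.s_add T.s_add S.s_mult T.s_mult S.s_minus T.s_minus S.s_inverse T.s_inverse
        S.add_in S.mult_in S.minus_in S.inverse_in)
  then have "splitting_field_C f \<subseteq> {x \<in> splitting_field_C f. s x = t x}"
    using eq roots_in_splitting_field by (intro splitting_field_least) auto
  then show ?thesis using x by blast
qed

lemma embedding_Rats: "embedding \<rat> (\<lambda>x. x)"
  by (auto simp: embedding_iff embedding_C_def is_subfield_C_def)

text \<open>An irrational element is separated by two embeddings over the rationals that are defined
  at all roots; both restrict to automorphisms, and they cannot both fix it.\<close>

lemma gal_fixed_rational:
  assumes f: "f \<noteq> 0" and x: "x \<in> splitting_field_C f" and fixed: "\<And>s. s \<in> gal_auts f \<Longrightarrow> s x = x"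
  shows "x \<in> \<rat>"
proof (rule ccontr)
  assume nr: "x \<notin> \<rat>"
  have least: "x \<in> F" if "is_subfield_C F" "\<rat> \<subseteq> F" "complex_roots f \<subseteq> F" for F
    using splitting_field_least[OF that(1,3)] x by blast
  have alg: "\<forall>z\<in>complex_roots f. algebraic z" using algebraic_root[OF f] by blast
  obtain K1 s1 K2 s2 where *: "embedding K1 s1" "embedding K2 s2" "complex_roots f \<subseteq> K1"
    "complex_roots f \<subseteq> K2" "s1 x \<noteq> s2 x"
    using separate_finite[OF finite_complex_roots[OF f] alg embedding_Rats least nr] by blast
  then have "s1 \<in> gal_auts f" "s2 \<in> gal_auts f"
    using embedding.restricts_to_splitting_field[OF _ f] by blast+
  then show False using fixed * by metis
qed

text \<open>Irreducibility concerns polynomials over \<open>rat\<close>, minimality concerns complex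
  polynomials with coefficients in \<open>\<rat>\<close>; the factorisation by a minimal polynomial
  is pulled back along \<open>of_rat\<close>.\<close>

lemma min_poly_irreducible:
  assumes irr: "irreducible (map_poly (of_int :: int \<Rightarrow> rat) f)" and z: "z \<in> complex_roots f"
  shows "min_poly \<rat> z (map_poly of_int f)"
proof -
  let ?F = "map_poly of_int f :: complex poly" and ?Q = "map_poly of_int f :: rat poly"
  interpret subfield_C \<rat> using embedding_Rats by (simp add: embedding_def)
  have "f \<noteq> 0" using irr by auto
  then have F0: "?F \<noteq> 0" by (simp add: map_poly_eq_0_iff)
  have F: "?F \<in> polys_over \<rat>" by (simp add: polys_over_def coeff_map_poly)
  have Fz: "poly ?F z = 0" using z by (simp add: complex_roots_def)
  obtain \<mu> where \<mu>: "min_poly \<rat> z \<mu>" using min_poly_exists[OF F F0 Fz] by blast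
  interpret M: min_poly \<rat> z \<mu> by (rule \<mu>)
  obtain u where u: "u \<in> polys_over \<rat>" "?F = u * \<mu>" using M.multiple[OF F Fz] by blast
  obtain u' where u': "u = map_poly of_rat u'" using u(1) ratpolyE[of u] unfolding polys_over_def by blast
  obtain \<mu>' where \<mu>': "\<mu> = map_poly of_rat \<mu>'" using M.mu(1) ratpolyE[of \<mu>] unfolding polys_over_def by blast
  have "?Q = u' * \<mu>'"
  proof (rule poly_eqI)
    fix i
    have "(of_rat (coeff ?Q i) :: complex) = coeff ?F i" by (simp add: coeff_map_poly)
    also have "\<dots> = of_rat (coeff (u' * \<mu>') i)"
      unfolding u(2) u' \<mu>' coeff_mult by (simp add: coeff_map_poly of_rat_sum of_rat_mult)
    finally show "coeff ?Q i = coeff (u' * \<mu>') i" by simp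
  qed
  then have "u' dvd 1 \<or> \<mu>' dvd 1" using irr by (metis irreducible_def)
  moreover have deg: "degree \<mu> = degree \<mu>'" "degree u = degree u'"
    unfolding \<mu>' u' by (auto intro!: degree_map_poly)
  ultimately have "degree u = 0" using M.degree_pos by (auto simp: is_unit_poly_iff)
  moreover have "u \<noteq> 0" using u F0 by auto
  ultimately have "degree ?F = degree \<mu>" using u M.mu by (simp add: degree_mult_eq)
  then show ?thesis using M.minimal F F0 Fz by unfold_locales auto
qed

lemma gal_transitive:
  assumes irr: "irreducible (map_poly (of_int :: int \<Rightarrow> rat) f)"
    and z: "z \<in> complex_roots f" "z' \<in> complex_roots f"
  shows "\<exists>s\<in>gal_auts f. s z = z'"
proof -
  have f: "f \<noteq> 0" using irr by auto
  interpret M: min_poly \<rat> z "map_poly of_int f" by (rule min_poly_irreducible[OF irr z(1)])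
  let ?K = "(\<lambda>h. poly h z) ` polys_over \<rat>"
  have z': "poly (map_poly (\<lambda>x. x) (map_poly of_int f)) z' = 0" using z by (simp add: complex_roots_def)
  obtain t where t: "embedding ?K t" "\<forall>h\<in>polys_over \<rat>. t (poly h z) = poly (map_poly (\<lambda>x. x) h) z'"
    using M.extend[OF embedding_Rats z'] by blast
  have "t z = z'" using M.extend_restrict(2)[OF embedding_Rats t(2)] .
  obtain K' s where s: "embedding K' s" "?K \<subseteq> K'" "complex_roots f \<subseteq> K'" "\<forall>x\<in>?K. s x = t x"
    using extend_finite[OF finite_complex_roots[OF f] _ t(1)] algebraic_root[OF f] by blast
  have "s \<in> gal_auts f" using embedding.restricts_to_splitting_field[OF s(1) f s(3)] .
  moreover have "s z = z'" using bspec[OF s(4) M.adjoin_mem(2)] \<open>t z = z'\<close> by simp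
  ultimately show ?thesis by blast
qed

lemma irreducible_roots:
  assumes irr: "irreducible (map_poly (of_int :: int \<Rightarrow> rat) f)" and deg: "degree f > 0"
  shows "card (complex_roots f) = degree f" "rsquarefree (map_poly of_int f :: complex poly)"
proof -
  have degF: "degree (map_poly of_int f :: complex poly) = degree f" by (auto intro!: degree_map_poly)
  then obtain z where "poly (map_poly of_int f) z = (0 :: complex)"
    using fundamental_theorem_of_algebra_alt[of "map_poly of_int f"] deg
    by (metis degree_pCons_0 less_irrefl)
  then interpret M: min_poly \<rat> z "map_poly of_int f"
    by (intro min_poly_irreducible[OF irr]) (simp add: complex_roots_def)
  show "card (complex_roots f) = degree f" "rsquarefree (map_poly of_int f :: complex poly)"
    using M.card_embedded_roots[OF embedding_Rats] degF by (simp_all add: complex_roots_def)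
qed

section \<open>Valuation rings in the complex numbers\<close>

text \<open>The last assumption says that every nonzero nonunit has a power divisible by
  \<open>p\<close>. It is what makes the integers prime to \<open>p\<close> units.\<close>

locale valuation_ring_C = subring_C V for V +
  fixes p :: int
  assumes p_prime: "prime p" and inverse_p: "inverse (of_int p) \<notin> V"
    and valuation: "x \<noteq> 0 \<Longrightarrow> x \<in> V \<or> inverse x \<in> V"
    and archimedean: "x \<in> V \<Longrightarrow> inverse x \<notin> V \<Longrightarrow> \<exists>N. x ^ N / of_int p \<in> V"
begin

text \<open>In place of a valuation: that \<open>x\<close> has the valuation of \<open>p ^ j\<close>
  is written as \<open>vunit (x / of_int p ^ j)\<close>.\<close>

definition vunit :: "complex \<Rightarrow> bool" where
  "vunit x \<longleftrightarrow> x \<noteq> 0 \<and> x \<in> V \<and> inverse x \<in> V"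

definition nonunit :: "complex \<Rightarrow> bool" where
  "nonunit x \<longleftrightarrow> x \<in> V \<and> (x = 0 \<or> inverse x \<notin> V)"

lemma in_cases: "x \<in> V \<longleftrightarrow> vunit x \<or> nonunit x" "\<not> (vunit x \<and> nonunit x)"
  by (auto simp: vunit_def nonunit_def)

lemma not_in: "x \<notin> V \<Longrightarrow> x \<noteq> 0 \<and> nonunit (inverse x)"
  using valuation[of x] by (cases "x = 0") (auto simp: nonunit_def)

lemma vunit_1: "vunit 1"
  by (simp add: vunit_def)

lemma vunit_mult: "vunit x \<Longrightarrow> vunit y \<Longrightarrow> vunit (x * y)"
  by (auto simp: vunit_def mult_in)

lemma vunit_inverse: "vunit x \<Longrightarrow> vunit (inverse x)"
  by (auto simp: vunit_def)

lemma vunit_divide: "vunit x \<Longrightarrow> vunit y \<Longrightarrow> vunit (x / y)"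
  by (simp add: divide_inverse vunit_mult vunit_inverse)

lemma vunit_minus: "vunit x \<Longrightarrow> vunit (- x)"
  by (auto simp: vunit_def minus_in)

lemma vunit_power: "vunit x \<Longrightarrow> vunit (x ^ i)"
  by (induction i) (auto simp: vunit_1 vunit_mult)

lemma vunit_prod: "(\<And>i. i \<in> A \<Longrightarrow> vunit (g i)) \<Longrightarrow> vunit (\<Prod>i\<in>A. g i)"
  by (induction A rule: infinite_finite_induct) (auto simp: vunit_1 vunit_mult)

lemma vunit_factor: "x \<in> V \<Longrightarrow> y \<in> V \<Longrightarrow> vunit (x * y) \<Longrightarrow> vunit x"
  using mult_in[of y "inverse (x * y)"] by (auto simp: vunit_def field_simps)

lemma vunit_power_iff: "x \<in> V \<Longrightarrow> i > 0 \<Longrightarrow> vunit (x ^ i) \<longleftrightarrow> vunit x"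
  using vunit_factor[of x "x ^ (i - 1)"] vunit_power[of x i] power_in[of x "i - 1"]
  by (cases i) auto

lemma nonunit_0: "nonunit 0"
  by (simp add: nonunit_def)

lemma nonunit_mult: "nonunit x \<Longrightarrow> y \<in> V \<Longrightarrow> nonunit (x * y)"
  using vunit_factor[of x y] in_cases mult_in by metis

lemma nonunit_mult_right: "y \<in> V \<Longrightarrow> nonunit x \<Longrightarrow> nonunit (y * x)"
  using nonunit_mult by (simp add: mult.commute)

lemma nonunit_power: "nonunit x \<Longrightarrow> i > 0 \<Longrightarrow> nonunit (x ^ i)"
  using vunit_power_iff in_cases power_in by metis

lemma nonunit_minus: "nonunit x \<Longrightarrow> nonunit (- x)"
  using vunit_minus[of "- x"] in_cases minus_in by (metis minus_minus)

lemma nonunit_add_aux: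
  assumes x: "nonunit x" and y: "nonunit y" "y \<noteq> 0" and q: "x / y \<in> V"
  shows "nonunit (x + y)"
proof -
  have "x + y = y * (1 + x / y)" using y by (simp add: field_simps)
  then show ?thesis using nonunit_mult[OF y(1)] q add_in[OF one_in q] by simp
qed

text \<open>Of two nonzero elements one divides the other in \<open>V\<close>, so the sum is a
  multiple of a nonunit. The nonunits thus form the maximal ideal.\<close>

lemma nonunit_add:
  assumes x: "nonunit x" and y: "nonunit y"
  shows "nonunit (x + y)"
proof (cases "x = 0 \<or> y = 0")
  case False
  then have "x / y \<in> V \<or> y / x \<in> V" using valuation[of "x / y"] by simp
  then show ?thesis using nonunit_add_aux[of x y] nonunit_add_aux[of y x] x y False
    by (auto simp: add.commute)
qed (use x y in auto)

lemma nonunit_sum: "(\<And>i. i \<in> A \<Longrightarrow> nonunit (g i)) \<Longrightarrow> nonunit (\<Sum>i\<in>A. g i)"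
  by (induction A rule: infinite_finite_induct) (auto simp: nonunit_0 nonunit_add)

lemma vunit_add_nonunit: "vunit x \<Longrightarrow> nonunit y \<Longrightarrow> vunit (x + y)"
  using nonunit_add[OF _ nonunit_minus, of "x + y" y] in_cases add_in by (metis add_diff_cancel_right' diff_conv_add_uminus)

lemma p_pos: "p > 1" using p_prime by (rule prime_gt_1_int)

lemma nonunit_p: "nonunit (of_int p)"
  using inverse_p of_int_in by (simp add: nonunit_def)

text \<open>If \<open>u\<close> were a nonunit, some power of it would be divisible by
  \<open>p\<close> in \<open>V\<close>; a Bezout relation between \<open>p\<close> and that power,
  divided by \<open>p\<close>, would put the inverse of \<open>p\<close> into
  \<open>V\<close>.\<close>

lemma vunit_of_int:
  assumes "\<not> p dvd u" shows "vunit (of_int u)"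
proof (rule ccontr)
  assume "\<not> ?thesis"
  then have "inverse (of_int u) \<notin> V" using assms of_int_in by (auto simp: vunit_def)
  then obtain N where N: "of_int u ^ N / of_int p \<in> V" using archimedean of_int_in by blast
  have "coprime p (u ^ N)" using assms p_prime by (simp add: prime_imp_coprime)
  then obtain a b where ab: "a * p + b * u ^ N = 1" by (metis bezout_int coprime_iff_gcd_eq_1)
  then have "(of_int a * of_int p + of_int b * of_int u ^ N :: complex) = 1"
    by (metis of_int_1 of_int_add of_int_mult of_int_power)
  then have "inverse (of_int p) = of_int a + of_int b * (of_int u ^ N / of_int p :: complex)"
    using p_pos by (simp add: field_simps)
  then show False using N inverse_p by (metis add_in mult_in of_int_in)
qed

text \<open>For \<open>y\<close> outside \<open>V\<close> the inverse of \<open>y\<close> is in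
  \<open>V\<close>; dividing the equation by \<open>y ^ (d - 1)\<close> writes \<open>y\<close> as a
  polynomial in that inverse.\<close>

lemma integrally_closed:
  assumes P: "P \<in> polys_over V" "lead_coeff P = 1" "poly P y = 0"
  shows "y \<in> V"
proof (rule ccontr)
  assume "y \<notin> V"
  then have y: "y \<noteq> 0" "nonunit (inverse y)" using not_in by auto
  define d where "d = degree P"
  have "d \<noteq> 0"
  proof
    assume "d = 0"
    then obtain c where "P = [:c:]" unfolding d_def by (metis degree_eq_zeroE)
    then show False using P by simp
  qed
  have "poly P y = (\<Sum>i<d. coeff P i * y ^ i) + y ^ d"
    using P(2) \<open>d \<noteq> 0\<close> by (simp add: poly_altdef d_def lessThan_Suc_atMost[symmetric])
  then have "y ^ d = - (\<Sum>i<d. coeff P i * y ^ i)" using P(3) by (simp add: eq_neg_iff_add_eq_0 add.commute)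
  then have "y ^ d * inverse y ^ (d - 1) = - (\<Sum>i<d. coeff P i * (y ^ i * inverse y ^ (d - 1)))"
    by (simp add: sum_distrib_right mult.assoc)
  also have "(\<Sum>i<d. coeff P i * (y ^ i * inverse y ^ (d - 1))) = (\<Sum>i<d. coeff P i * inverse y ^ (d - 1 - i))"
  proof (rule sum.cong)
    fix i assume "i \<in> {..<d}"
    then have "y ^ i * inverse y ^ (d - 1) = inverse y ^ (d - 1 - i)"
      using y power_add[of "inverse y" i "d - 1 - i"] by (simp add: power_inverse)
    then show "coeff P i * (y ^ i * inverse y ^ (d - 1)) = coeff P i * inverse y ^ (d - 1 - i)" by simp
  qed simp
  also have "y ^ d * inverse y ^ (d - 1) = y"
    using y \<open>d \<noteq> 0\<close> power_Suc[of y "d - 1"] by (simp add: power_inverse)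
  finally have "y = - (\<Sum>i<d. coeff P i * inverse y ^ (d - 1 - i))" .
  moreover have "- (\<Sum>i<d. coeff P i * inverse y ^ (d - 1 - i)) \<in> V"
    using P y by (intro minus_in sum_in mult_in power_in) (auto simp: polys_over_def nonunit_def)
  ultimately show False using \<open>y \<notin> V\<close> by simp
qed

lemma vunit_p_powi: "vunit (of_int p powi i) \<longleftrightarrow> i = 0"
proof
  have *: "\<not> vunit (of_int p ^ n)" if "n > 0" for n
    using nonunit_power[OF nonunit_p that] in_cases by blast
  assume "vunit (of_int p powi i)"
  then show "i = 0"
    using *[of "nat \<bar>i\<bar>"] vunit_inverse[of "of_int p powi i"]
    by (cases i rule: int_cases2) (auto simp: power_int_minus)
qed (simp add: vunit_1)

lemma p_nonzero [simp]: "p \<noteq> 0"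
  using p_pos by simp

lemma rational_valuation:
  assumes "r \<in> \<rat>" "r \<noteq> 0"
  shows "\<exists>j. vunit (r / of_int p powi j)"
proof -
  have int: "vunit (of_int a / of_int p powi int (multiplicity p a))" if "a \<noteq> 0" for a
  proof -
    have "\<not> is_unit p" using p_prime by auto
    from multiplicity_decompose'[OF that this]
    obtain u where u: "a = p ^ multiplicity p a * u" "\<not> p dvd u" by blast
    have "(of_int a :: complex) = of_int p ^ multiplicity p a * of_int u"
      by (subst u(1)) simp
    then have "of_int a / of_int p powi int (multiplicity p a) = (of_int u :: complex)" by simp
    then show ?thesis using vunit_of_int[OF u(2)] by simp
  qed
  obtain a b where ab: "r = of_int a / of_int b" "b \<noteq> 0"
    using assms(1) by (elim Rats_cases') auto
  then have "a \<noteq> 0" using assms by auto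
  let ?i = "int (multiplicity p a)" and ?j = "int (multiplicity p b)"
  have "r / of_int p powi (?i - ?j) = (of_int a / of_int p powi ?i) / (of_int b / of_int p powi ?j)"
    using ab by (simp add: power_int_diff)
  then show ?thesis using vunit_divide[OF int[OF \<open>a \<noteq> 0\<close>] int[OF ab(2)]] by metis
qed

text \<open>Rational numbers have integral valuations. Both arithmetic conclusions, the divisibility
  by \<open>q\<close> and the parity of the discriminant, are drawn from this.\<close>

lemma rational_power_valuation:
  assumes "r \<in> \<rat>" "r \<noteq> 0" "vunit (r ^ n / of_int p powi i)"
  shows "int n dvd i"
proof -
  obtain j where j: "vunit (r / of_int p powi j)" using rational_valuation assms by blast
  have "vunit ((r / of_int p powi j) ^ n / (r ^ n / of_int p powi i))"
    using vunit_divide[OF vunit_power[OF j] assms(3)] .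
  moreover have "(of_int p powi j :: complex) ^ n = of_int p powi (j * int n)"
    by (simp add: power_int_mult)
  then have "(r / of_int p powi j) ^ n / (r ^ n / of_int p powi i) = of_int p powi (i - j * int n)"
    using assms(2) by (simp add: power_int_diff power_divide)
  ultimately have "i - j * int n = 0" using vunit_p_powi by simp
  then show ?thesis by simp
qed

end

section \<open>Chevalley's argument: maximal subrings are valuation rings\<close>

locale maximal_subring_C = subring_C V for V +
  fixes p :: int
  assumes p_prime: "prime p" and inverse_p: "inverse (of_int p) \<notin> V"
    and maximal: "x \<notin> V \<Longrightarrow> \<exists>h\<in>polys_over V. poly h x = inverse (of_int p)"
begin

lemma p_nonzero [simp]: "p \<noteq> 0"
  using p_prime by auto

lemma clear_denominators:
  assumes h: "h \<in> polys_over V" and x: "x \<in> V" "x \<noteq> 0"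
  shows "x ^ degree h * poly h (inverse x) \<in> V"
proof -
  have "x ^ degree h * poly h (inverse x) = (\<Sum>i\<le>degree h. coeff h i * x ^ (degree h - i))"
    unfolding poly_altdef sum_distrib_left
  proof (rule sum.cong)
    fix i assume "i \<in> {..degree h}"
    then have "x ^ degree h * inverse x ^ i = x ^ (degree h - i)"
      using x by (simp add: power_inverse power_diff field_simps)
    then show "x ^ degree h * (coeff h i * inverse x ^ i) = coeff h i * x ^ (degree h - i)"
      by (simp add: mult.left_commute)
  qed simp
  also have "\<dots> \<in> V" using h x by (intro sum_in mult_in power_in) (auto simp: polys_over_def)
  finally show ?thesis .
qed

text \<open>Otherwise maximality writes the inverse of \<open>p\<close> as a polynomial in the
  inverse of \<open>1 - of_int p * b\<close>. Multiplying by a power of this element, which is still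
  1 modulo \<open>p\<close>, clears denominators and leaves the inverse of \<open>p\<close> in
  \<open>V\<close>.\<close>

lemma one_minus_p:
  assumes b: "b \<in> V"
  shows "1 - of_int p * b \<noteq> 0" "inverse (1 - of_int p * b) \<in> V"
proof -
  let ?u = "1 - of_int p * b"
  show u0: "?u \<noteq> 0"
  proof
    assume "?u = 0"
    then have "b = inverse (of_int p)" by (simp add: field_simps)
    then show False using b inverse_p by simp
  qed
  have u: "?u \<in> V" by (intro diff_in mult_in of_int_in b one_in)
  have pow: "\<exists>c\<in>V. ?u ^ N = 1 - of_int p * c" for N
  proof (induction N)
    case (Suc N)
    then obtain c where c: "c \<in> V" "?u ^ N = 1 - of_int p * c" by blast
    have "?u ^ Suc N = ?u * (1 - of_int p * c)" by (simp only: power_Suc c(2))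
    then have "?u ^ Suc N = 1 - of_int p * (b + c - of_int p * b * c)" by (simp add: algebra_simps)
    moreover have "b + c - of_int p * b * c \<in> V" by (intro diff_in add_in mult_in of_int_in b c)
    ultimately show ?case by blast
  qed (auto intro: bexI[of _ 0])
  show "inverse ?u \<in> V"
  proof (rule ccontr)
    assume "inverse ?u \<notin> V"
    then obtain h where h: "h \<in> polys_over V" "poly h (inverse ?u) = inverse (of_int p)"
      using maximal by blast
    obtain c where c: "c \<in> V" "?u ^ degree h = 1 - of_int p * c" using pow by blast
    have "?u ^ degree h * inverse (of_int p) \<in> V" using clear_denominators[OF h(1) u u0] h(2) by simp
    then have "(1 - of_int p * c) * inverse (of_int p) + c \<in> V" using c add_in by simp
    then show False using inverse_p by (simp add: field_simps)
  qed
qed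

text \<open>A certificate that \<open>x\<close> is not in \<open>V\<close>: 1 lies in the ideal that
  \<open>p\<close> generates in \<open>V[x]\<close>.\<close>

definition p_relation :: "complex \<Rightarrow> complex poly \<Rightarrow> bool" where
  "p_relation x P \<longleftrightarrow> (\<forall>i. coeff P i / of_int p \<in> V) \<and> poly P x = 1"

lemma p_relation_exists: "x \<notin> V \<Longrightarrow> \<exists>P. p_relation x P"
proof -
  assume "x \<notin> V"
  then obtain h where "h \<in> polys_over V" "poly h x = inverse (of_int p)" using maximal by blast
  then have "p_relation x (smult (of_int p) h)" by (simp add: p_relation_def polys_over_def)
  then show ?thesis by blast
qed

text \<open>Moving the constant term of the relation for \<open>inverse x\<close> to the other side
  and dividing by the resulting unit \<open>u\<close> expresses \<open>x ^ n\<close> through lower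
  powers of \<open>x\<close>. Put in for the leading term of \<open>P\<close>, this lowers the
  degree; so relations of least degree for \<open>x\<close> and \<open>inverse x\<close> cannot
  coexist.\<close>

lemma p_relation_reduce:
  assumes P: "p_relation x P" and Q: "p_relation (inverse x) Q" and deg: "degree Q \<le> degree P" and x: "x \<noteq> 0"
  shows "\<exists>P'. p_relation x P' \<and> degree P' < degree P"
proof -
  define n where "n = degree P"
  define m where "m = degree Q"
  have Pp: "coeff P i / of_int p \<in> V" "coeff P i \<in> V" and Qp: "coeff Q i / of_int p \<in> V" "coeff Q i \<in> V" for i
    using P Q mult_in[OF of_int_in[of p], of "coeff P i / of_int p"]
      mult_in[OF of_int_in[of p], of "coeff Q i / of_int p"] by (auto simp: p_relation_def)
  have "n \<noteq> 0"
  proof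
    assume "n = 0"
    then obtain c where "P = [:c:]" unfolding n_def by (metis degree_eq_zeroE)
    then have "coeff P 0 = 1" using P by (simp add: p_relation_def)
    then show False using Pp(1)[of 0] inverse_p by (simp add: divide_inverse)
  qed
  define u where "u = 1 - of_int p * (coeff Q 0 / of_int p)"
  have u: "u \<noteq> 0" "inverse u \<in> V" using one_minus_p[OF Qp(1)[of 0]] by (auto simp: u_def)
  define c where "c = coeff P n"
  define R where "R = (\<Sum>j=1..m. monom (coeff Q j) (n - j))"
  define P' where "P' = (P - monom c n) + smult (c * inverse u) R"
  have "poly Q (inverse x) = coeff Q 0 + (\<Sum>j=1..m. coeff Q j * inverse x ^ j)"
    unfolding poly_altdef m_def atMost_atLeast0 by (subst sum.atLeast_Suc_atMost) auto
  then have Qs: "(\<Sum>j=1..m. coeff Q j * inverse x ^ j) = u"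
    using Q by (auto simp: p_relation_def u_def eq_diff_eq add.commute)
  have "poly R x = (\<Sum>j=1..m. coeff Q j * x ^ (n - j))" by (simp add: R_def poly_sum poly_monom)
  also have "\<dots> = (\<Sum>j=1..m. x ^ n * (coeff Q j * inverse x ^ j))"
    using deg x by (intro sum.cong) (auto simp: n_def m_def power_inverse power_diff field_simps)
  also have "\<dots> = x ^ n * u" unfolding sum_distrib_left[symmetric] Qs ..
  finally have "poly P' x = 1"
    using P u by (simp add: P'_def p_relation_def poly_monom)
  moreover have "coeff P' i / of_int p \<in> V" for i
  proof -
    have "coeff R i = (\<Sum>j=1..m. if n - j = i then coeff Q j else 0)" by (simp add: R_def coeff_sum)
    then have Ri: "coeff R i \<in> V" using Qp by (auto intro: sum_in)
    have "coeff P' i / of_int p = coeff P i / of_int p - (if n = i then c / of_int p else 0)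
        + (c / of_int p) * inverse u * coeff R i"
      by (simp add: P'_def add_divide_distrib diff_divide_distrib)
    also have "\<dots> \<in> V" using Pp u Ri by (intro add_in diff_in mult_in) (auto simp: c_def)
    finally show ?thesis .
  qed
  moreover have "degree P' < n"
  proof -
    have "degree P' \<le> n - 1"
    proof (rule degree_le, intro allI impI)
      fix i assume i: "n - 1 < i"
      have "coeff R i = 0" using i \<open>n \<noteq> 0\<close> by (auto simp: R_def coeff_sum intro!: sum.neutral)
      moreover have "coeff (P - monom c n) i = 0"
        using i by (cases "i = n") (auto simp: c_def n_def coeff_eq_0)
      ultimately show "coeff P' i = 0" by (simp add: P'_def)
    qed
    then show ?thesis using \<open>n \<noteq> 0\<close> by simp
  qed
  ultimately show ?thesis by (auto simp: p_relation_def n_def)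
qed

lemma valuation:
  assumes x: "x \<noteq> 0" shows "x \<in> V \<or> inverse x \<in> V"
proof (rule ccontr)
  assume "\<not> ?thesis"
  then obtain P0 Q0 where "p_relation x P0" "p_relation (inverse x) Q0" using p_relation_exists by blast
  then obtain P Q where P: "p_relation x P" "\<And>P'. p_relation x P' \<Longrightarrow> degree P \<le> degree P'"
    and Q: "p_relation (inverse x) Q" "\<And>Q'. p_relation (inverse x) Q' \<Longrightarrow> degree Q \<le> degree Q'"
    using ex_has_least_nat[of "p_relation x" P0 degree] ex_has_least_nat[of "p_relation (inverse x)" Q0 degree]
    by blast
  show False
  proof (cases "degree Q \<le> degree P")
    case True
    then show False using p_relation_reduce[OF P(1) Q(1) _ x] P(2) by fastforce
  next
    case False
    then show False using p_relation_reduce[of "inverse x" Q P] P(1) Q x by fastforce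
  qed
qed

lemma valuation_ring: "valuation_ring_C V p"
proof
  show "prime p" by (rule p_prime)
  show "inverse (of_int p) \<notin> V" by (rule inverse_p)
  show "x \<in> V \<or> inverse x \<in> V" if "x \<noteq> 0" for x using valuation[OF that] .
  show "\<exists>N. x ^ N / of_int p \<in> V" if x: "x \<in> V" "inverse x \<notin> V" for x
  proof -
    have "x \<noteq> 0" using x by auto
    obtain h where "h \<in> polys_over V" "poly h (inverse x) = inverse (of_int p)" using maximal x by blast
    then have "x ^ degree h / of_int p \<in> V"
      using clear_denominators[of h x] x \<open>x \<noteq> 0\<close> by (simp add: divide_inverse)
    then show ?thesis by blast
  qed
qed

end

text \<open>Zorn's lemma on the subrings without the inverse of \<open>p\<close>, of which the
  integers are one. Adjoining to a maximal one any \<open>x\<close> outside it must produce that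
  inverse.\<close>

lemma valuation_ring_exists:
  assumes p: "prime (p :: int)" shows "\<exists>V. valuation_ring_C V p"
proof -
  define \<A> where "\<A> = {S. subring_C S \<and> inverse (of_int p) \<notin> S}"
  have "inverse (of_int p :: complex) \<notin> \<int>"
  proof
    assume "inverse (of_int p :: complex) \<in> \<int>"
    then obtain k where "inverse (of_int p :: complex) = of_int k" by (elim Ints_cases)
    then have "(of_int (k * p) :: complex) = of_int 1" using p by (auto simp: field_simps)
    then have "k * p = 1" by (simp only: of_int_eq_iff)
    then have "p dvd 1" by (metis dvd_triv_right)
    then show False using p by auto
  qed
  moreover have "subring_C \<int>" by unfold_locales auto
  ultimately have ne: "\<A> \<noteq> {}" by (auto simp: \<A>_def)
  have "\<exists>M\<in>\<A>. \<forall>X\<in>\<A>. M \<subseteq> X \<longrightarrow> X = M"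
  proof (rule subset_Zorn_nonempty[OF ne])
    fix C assume C: "C \<noteq> {}" "subset.chain \<A> C"
    then have sub: "\<And>S. S \<in> C \<Longrightarrow> subring_C S" "\<And>S. S \<in> C \<Longrightarrow> inverse (of_int p) \<notin> S"
      by (auto simp: subset.chain_def \<A>_def)
    have common: "\<exists>S\<in>C. x \<in> S \<and> y \<in> S" if "x \<in> \<Union>C" "y \<in> \<Union>C" for x y
    proof -
      obtain S T where S: "S \<in> C" "x \<in> S" and T: "T \<in> C" "y \<in> T" using \<open>x \<in> \<Union>C\<close> \<open>y \<in> \<Union>C\<close> by blast
      then have "S \<subseteq> T \<or> T \<subseteq> S" using C(2) by (auto simp: subset_chain_def)
      then show ?thesis using S T by blast
    qed
    have "subring_C (\<Union>C)"
    proof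
      show "0 \<in> \<Union>C" "1 \<in> \<Union>C" using C(1) sub(1) subring_C.zero_in subring_C.one_in by blast+
      show "x + y \<in> \<Union>C" "x * y \<in> \<Union>C" if xy: "x \<in> \<Union>C" "y \<in> \<Union>C" for x y
        using common[OF xy] sub(1) subring_C.add_in subring_C.mult_in by blast+
      show "- x \<in> \<Union>C" if "x \<in> \<Union>C" for x
        using that sub(1) subring_C.minus_in by blast
    qed
    then show "\<Union>C \<in> \<A>" using sub(2) by (auto simp: \<A>_def)
  qed
  then obtain V where V: "V \<in> \<A>" "\<And>X. X \<in> \<A> \<Longrightarrow> V \<subseteq> X \<Longrightarrow> X = V" by blast
  interpret subring_C V using V by (simp add: \<A>_def)
  have "maximal_subring_C V p"
  proof
    show "prime p" by (rule p)
    show "inverse (of_int p) \<notin> V" using V by (simp add: \<A>_def)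
    show "\<exists>h\<in>polys_over V. poly h x = inverse (of_int p)" if x: "x \<notin> V" for x
    proof (rule ccontr)
      assume "\<not> ?thesis"
      then have "inverse (of_int p) \<notin> (\<lambda>h. poly h x) ` polys_over V" by (metis imageE)
      then have "(\<lambda>h. poly h x) ` polys_over V \<in> \<A>" using adjoin_subring by (simp add: \<A>_def)
      then have "(\<lambda>h. poly h x) ` polys_over V = V" using adjoin_contains(1) by (rule V(2))
      then show False using adjoin_contains(2)[of x] x by simp
    qed
  qed
  then show ?thesis using maximal_subring_C.valuation_ring by blast
qed

section \<open>Ramification and the Galois group\<close>

text \<open>Outside the roots the elements are the identity rather than \<open>undefined\<close>, so
  that they are permutations of all complex numbers and compose under
  \<open>\<circ>\<close>.\<close>

definition gal_perms :: "int poly \<Rightarrow> (complex \<Rightarrow> complex) set" where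
  "gal_perms f = (\<lambda>s. restrict_id s (complex_roots f)) ` gal_auts f"

lemma gal_perms_perm_group:
  assumes f: "f \<noteq> 0" shows "perm_group (complex_roots f) (gal_perms f)"
proof
  show "finite (complex_roots f)" using finite_complex_roots[OF f] .
  show "p permutes complex_roots f" if "p \<in> gal_perms f" for p
    using that gal_aut_roots[OF f] by (auto simp: gal_perms_def intro: permutes_restrict_id)
  show "id \<in> gal_perms f"
    unfolding gal_perms_def by (rule image_eqI[OF _ gal_aut_id]) (auto simp: restrict_id_def)
  show "p \<circ> p' \<in> gal_perms f" if pp': "p \<in> gal_perms f" "p' \<in> gal_perms f" for p p'
  proof -
    obtain s s' where s: "s \<in> gal_auts f" "p = restrict_id s (complex_roots f)"
      "s' \<in> gal_auts f" "p' = restrict_id s' (complex_roots f)" using pp' by (auto simp: gal_perms_def)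
    have "p \<circ> p' = restrict_id (s \<circ> s') (complex_roots f)"
      using s gal_aut_roots[OF f s(3)] by (auto simp: fun_eq_iff restrict_id_def dest: bij_betwE)
    then show ?thesis unfolding gal_perms_def using s
      by (intro image_eqI[of _ _ "s \<circ> s'"] gal_aut_comp)
  qed
qed

lemma galois_perm_group_eq_sym:
  assumes "gal_perms f = {p. p permutes complex_roots f}"
  shows "galois_perm_group f = sym_group_roots f"
proof
  show "sym_group_roots f \<subseteq> galois_perm_group f"
  proof
    fix g assume "g \<in> sym_group_roots f"
    then obtain p where p: "bij_betw p (complex_roots f) (complex_roots f)" "g = restrict p (complex_roots f)"
      by (auto simp: sym_group_roots_def)
    then have "restrict_id p (complex_roots f) \<in> gal_perms f" using assms permutes_restrict_id by auto
    then obtain s where s: "s \<in> gal_auts f" "restrict_id p (complex_roots f) = restrict_id s (complex_roots f)"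
      by (auto simp: gal_perms_def)
    then have "p x = s x" if "x \<in> complex_roots f" for x
      using that by (metis restrict_id_def)
    then have "g = restrict s (complex_roots f)" using p(2) by (auto simp: restrict_def)
    then show "g \<in> galois_perm_group f" using s(1) by (simp add: galois_perm_group_def)
  qed
  show "galois_perm_group f \<subseteq> sym_group_roots f"
  proof
    fix g assume "g \<in> galois_perm_group f"
    then obtain s where s: "s \<in> gal_auts f" "g = restrict s (complex_roots f)"
      by (auto simp: galois_perm_group_def)
    define p where "p = restrict_id s (complex_roots f)"
    have "p permutes complex_roots f" using assms s by (auto simp: gal_perms_def p_def)
    moreover have "g = restrict p (complex_roots f)"
      using s by (auto simp: p_def restrict_def restrict_id_def)
    ultimately show "g \<in> sym_group_roots f" by (auto simp: sym_group_roots_def dest: permutes_imp_bij)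
  qed
qed

lemma monic_complex_decompose:
  assumes irr: "irreducible (map_poly (of_int :: int \<Rightarrow> rat) f)" and lc: "lead_coeff f = 1"
  shows "(map_poly of_int f :: complex poly) = (\<Prod>z\<in>complex_roots f. [:- z, 1:])"
    "card (complex_roots f) = degree f" "degree f > 0"
proof -
  show deg: "degree f > 0"
  proof (rule ccontr)
    assume "\<not> ?thesis"
    then obtain c where "f = [:c:]" by (metis degree_eq_zeroE gr0I)
    then have "f = 1" using lc by (simp add: one_pCons)
    then show False using irr by simp
  qed
  have "lead_coeff (map_poly of_int f :: complex poly) = 1"
    using lc by (subst lead_coeff_map_poly_nz) auto
  then show "(map_poly of_int f :: complex poly) = (\<Prod>z\<in>complex_roots f. [:- z, 1:])"
    using complex_poly_decompose_rsquarefree[OF irreducible_roots(2)[OF irr deg]]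
    by (simp add: complex_roots_def)
  show "card (complex_roots f) = degree f" by (rule irreducible_roots(1)[OF irr deg])
qed

context valuation_ring_C
begin

text \<open>Modulo the maximal ideal the product is a power of the variable.\<close>

lemma prod_linear_coeffs:
  assumes "finite A" "\<And>z. z \<in> A \<Longrightarrow> nonunit (g z)"
  shows "coeff (\<Prod>z\<in>A. [:- g z, 1:]) (card A) = 1 \<and>
    (\<forall>i<card A. nonunit (coeff (\<Prod>z\<in>A. [:- g z, 1:]) i)) \<and>
    (\<forall>i>card A. coeff (\<Prod>z\<in>A. [:- g z, 1:]) i = 0)"
  using assms
proof (induction A rule: finite_induct)
  case (insert z A)
  define P where "P = (\<Prod>z\<in>A. [:- g z, 1:])"
  have IH: "coeff P (card A) = 1" "\<And>i. i < card A \<Longrightarrow> nonunit (coeff P i)" "\<And>i. i > card A \<Longrightarrow> coeff P i = 0"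
    using insert by (auto simp: P_def)
  have PV: "coeff P i \<in> V" for i
    using IH in_cases(1) by (metis linorder_neqE_nat one_in zero_in)
  have ins: "(\<Prod>z\<in>insert z A. [:- g z, 1:]) = [:- g z, 1:] * P" "card (insert z A) = Suc (card A)"
    using insert by (simp_all add: P_def)
  have c: "coeff ([:- g z, 1:] * P) i = (case i of 0 \<Rightarrow> 0 | Suc j \<Rightarrow> coeff P j) - g z * coeff P i" for i
    by (cases i) (auto simp: coeff_pCons)
  have z: "nonunit (g z)" using insert by simp
  have "nonunit (coeff ([:- g z, 1:] * P) i)" if "i < Suc (card A)" for i
  proof -
    have "nonunit (- (g z * coeff P i))" using nonunit_mult[OF z PV] nonunit_minus by blast
    moreover have "nonunit (case i of 0 \<Rightarrow> 0 | Suc j \<Rightarrow> coeff P j)"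
      using that IH(2) nonunit_0 by (cases i) auto
    ultimately show ?thesis unfolding c using nonunit_add by (metis diff_conv_add_uminus)
  qed
  moreover have "coeff ([:- g z, 1:] * P) i = 0" if "Suc (card A) < i" for i
    unfolding c using that IH(3) by (auto split: nat.splits)
  moreover have "coeff ([:- g z, 1:] * P) (Suc (card A)) = 1" unfolding c using IH(1,3) by simp
  ultimately show ?case unfolding ins by blast
qed auto

end

section \<open>An element of order q from the Newton polygon\<close>

lemma complex_root_exists: "n > 0 \<Longrightarrow> \<exists>z. z ^ n = (c :: complex)"
proof -
  assume "n > 0"
  then have "degree (monom 1 n - [:c:]) > 0"
    by (intro less_le_trans[OF _ le_degree[of _ n]]) (auto simp: coeff_pCons split: nat.splits)
  then obtain z where "poly (monom 1 n - [:c:]) z = 0"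
    using fundamental_theorem_of_algebra_alt[of "monom 1 n - [:c:]"] by (metis degree_pCons_0 less_irrefl)
  then show ?thesis by (intro exI[of _ z]) (simp add: poly_monom)
qed

lemma sum_conjugates_rational:
  assumes f: "f \<noteq> 0" and fin: "finite X" and X: "X \<subseteq> splitting_field_C f"
    and inv: "\<And>s x. s \<in> gal_auts f \<Longrightarrow> x \<in> X \<Longrightarrow> s x \<in> X"
  shows "\<Sum>X \<in> \<rat>"
proof (rule gal_fixed_rational[OF f])
  interpret L: subfield_C "splitting_field_C f" by (rule splitting_field_subfield)
  show "\<Sum>X \<in> splitting_field_C f" using X by (intro L.sum_in) auto
  fix s assume s: "s \<in> gal_auts f"
  interpret embedding "splitting_field_C f" s by (rule gal_aut_embedding[OF s])
  have inj: "inj_on s X" using s_inj X by (meson inj_onI subsetD)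
  then have "s ` X = X" using inv s fin by (intro endo_inj_surj) auto
  then have "sum s X = \<Sum>X" using sum.reindex[OF inj, of "\<lambda>x. x"] by (simp add: comp_def)
  then show "s (\<Sum>X) = \<Sum>X" using X by (subst s_sum) auto
qed

text \<open>Normalise the roots by \<open>\<pi>\<close> with \<open>\<pi>\<^sup>q = p\<close>. The slope \<open>-1/q\<close> of the Newton polygon yields a nonempty
  set \<open>S\<close> of roots \<open>\<alpha>\<close> with \<open>\<alpha>/\<pi>\<close> a unit, and \<open>\<Prod>S\<close> strictly dominates its other conjugates. Hence
  for \<open>A \<subseteq> S\<close> stable under the stabiliser of \<open>S\<close> the sum of the conjugates of \<open>\<Prod>A * \<Prod>S\<close>, a rational
  number, is \<open>\<pi>^(card A + card S)\<close> up to a unit.\<close>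
lemma newton_edge_element:
  assumes irr: "irreducible (map_poly (of_int :: int \<Rightarrow> rat) f)" and lc: "lead_coeff f = 1"
    and n: "n < degree f" and q: "prime q" "q = degree f - n" "degree f \<le> 2 * q"
    and p: "prime (p :: int)"
    and above: "\<And>i. n < i \<Longrightarrow> i < degree f \<Longrightarrow> p dvd coeff f i"
    and at: "p dvd coeff f n" "\<not> p ^ 2 dvd coeff f n"
    and below: "\<And>i. i < n \<Longrightarrow> p ^ 2 dvd coeff f i"
  shows "\<exists>g\<in>gal_perms f. g \<noteq> id \<and> g ^^ q = id"
proof -
  define R where "R = complex_roots f"
  define G where "G = gal_perms f"
  define d where "d = degree f"
  let ?F = "map_poly of_int f :: complex poly"
  have f0: "f \<noteq> 0" using lc by auto
  have degF: "degree ?F = d" unfolding d_def by (auto intro!: degree_map_poly)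
  note decomp = monic_complex_decompose[OF irr lc, folded R_def d_def]
  interpret G: perm_group R G unfolding R_def G_def by (rule gal_perms_perm_group[OF f0])
  interpret L: subfield_C "splitting_field_C f" by (rule splitting_field_subfield)
  have RL: "R \<subseteq> splitting_field_C f" unfolding R_def by (rule roots_in_splitting_field)
  obtain V where "valuation_ring_C V p" using valuation_ring_exists[OF p] by blast
  then interpret valuation_ring_C V p .
  have q0: "q > 0" using q(1) by (rule prime_gt_0_nat)
  have qnd: "q + n = d" using q(2) n by (simp add: d_def)
  obtain \<pi> :: complex where pi: "\<pi> ^ q = of_int p" using complex_root_exists[OF q0] by blast
  have pi0: "\<pi> \<noteq> 0" using pi q0 by (auto simp: zero_power)
  have piV: "\<pi> \<in> V"
  proof (rule ccontr)
    assume "\<pi> \<notin> V"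
    then have "nonunit (inverse \<pi> ^ q)" using not_in nonunit_power q0 by blast
    then show False using inverse_p pi by (simp add: power_inverse nonunit_def)
  qed
  \<comment> \<open>Rescaling by \<open>\<pi>\<close>, of valuation 1/q, makes the edge horizontal:
    \<open>P\<close> is monic over \<open>V\<close>, and its coefficient at \<open>n\<close> is a
    unit since \<open>q + n = d\<close>. Its roots are the \<open>x / \<pi>\<close>.\<close>
  define P where "P = smult (1 / \<pi> ^ d) (pcompose ?F [:0, \<pi>:])"
  have coeffP: "coeff P i = of_int (coeff f i) * \<pi> ^ i / \<pi> ^ d" for i
    by (simp add: P_def coeff_pcompose_linear coeff_map_poly)
  have quotient: "of_int (p ^ e * t) * \<pi> ^ i / \<pi> ^ d = of_int t * \<pi> ^ (e * q + i - d)"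
    if "d \<le> e * q + i" for e t i
  proof -
    have "of_int (p ^ e * t) * \<pi> ^ i = of_int t * \<pi> ^ (e * q + i)"
      by (simp add: pi[symmetric] power_add power_mult mult.commute[of e])
    also have "\<dots> = of_int t * \<pi> ^ (e * q + i - d) * \<pi> ^ d"
      using that by (simp add: mult.assoc flip: power_add)
    finally have *: "of_int (p ^ e * t) * \<pi> ^ i = of_int t * \<pi> ^ (e * q + i - d) * \<pi> ^ d" .
    show ?thesis unfolding * using pi0 by simp
  qed
  have Pn: "vunit (coeff P n)"
  proof -
    obtain t where t: "coeff f n = p ^ 1 * t" using at(1) by auto
    then have "\<not> p dvd t" using at(2) by (auto simp: power2_eq_square)
    have "coeff P n = of_int t" unfolding coeffP t using quotient[of 1 n t] qnd by simp
    then show ?thesis using vunit_of_int[OF \<open>\<not> p dvd t\<close>] by simp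
  qed
  have Pd: "coeff P d = 1" using lc pi0 by (simp add: coeffP d_def)
  have PV: "P \<in> polys_over V"
    unfolding polys_over_def
  proof (intro CollectI allI)
    fix i
    consider "i > d" | "i = d" | "n < i" "i < d" | "i = n" | "i < n" by linarith
    then show "coeff P i \<in> V"
    proof cases
      case 1
      then show ?thesis by (simp add: coeffP d_def coeff_eq_0)
    next
      case 2
      then show ?thesis using Pd by simp
    next
      case 3
      then obtain t where t: "coeff f i = p ^ 1 * t" using above by (auto simp: d_def)
      show ?thesis unfolding coeffP t using quotient[of 1 i t] 3 qnd
        by (auto intro!: mult_in power_in of_int_in piV)
    next
      case 4
      then show ?thesis using Pn by (simp add: vunit_def)
    next
      case 5
      then obtain t where t: "coeff f i = p ^ 2 * t" using below by auto
      \<comment> \<open>The line through the edge has height at most 2 over every index, so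
        \<open>p ^ 2\<close> suffices below \<open>n\<close>.\<close>
      have "d \<le> 2 * q + i" using q(3) by (simp add: d_def)
      then show ?thesis unfolding coeffP t using quotient[of 2 i t]
        by (auto intro!: mult_in power_in of_int_in piV)
    qed
  qed
  have degP: "degree P = d"
  proof (rule antisym)
    show "degree P \<le> d" by (rule degree_le) (simp add: coeffP d_def coeff_eq_0)
    show "d \<le> degree P" by (rule le_degree) (simp add: Pd)
  qed
  have RV: "x / \<pi> \<in> V" if "x \<in> R" for x
  proof (rule integrally_closed[OF PV])
    show "lead_coeff P = 1" using degP Pd by simp
    show "poly P (x / \<pi>) = 0"
      using that pi0 by (simp add: P_def poly_pcompose R_def complex_roots_def)
  qed
  define S where "S = {x \<in> R. vunit (x / \<pi>)}"
  have finR: "finite R" by (rule G.finite_R)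
  have finS: "finite S" using finR by (simp add: S_def)
  have SR: "S \<subseteq> R" by (auto simp: S_def)
  \<comment> \<open>If every \<open>x / \<pi>\<close> were a nonunit, \<open>P\<close> would reduce
    to a pure power of degree \<open>d\<close>, against the unit coefficient at
    \<open>n < d\<close>.\<close>
  have "S \<noteq> {}"
  proof
    assume "S = {}"
    then have non: "nonunit (x / \<pi>)" if "x \<in> R" for x using that RV in_cases(1) by (auto simp: S_def)
    have "pcompose ?F [:0, \<pi>:] = (\<Prod>z\<in>R. smult \<pi> [:- (z / \<pi>), 1:])"
      using pi0 by (simp add: decomp(1) pcompose_prod pcompose_pCons)
    also have "\<dots> = smult (\<pi> ^ d) (\<Prod>z\<in>R. [:- (z / \<pi>), 1:])"
      unfolding prod_smult by (simp add: decomp(2))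
    finally have "P = (\<Prod>z\<in>R. [:- (z / \<pi>), 1:])" using pi0 by (simp add: P_def)
    then have "nonunit (coeff P n)"
      using prod_linear_coeffs[OF finR non] n decomp(2) by (simp add: d_def)
    then show False using Pn in_cases(2) by blast
  qed
  then obtain x0 where x0: "x0 \<in> S" by blast
  define H where "H = {h \<in> G. h ` S = S}"
  interpret H: perm_group R H
  proof (rule G.sub_perm_group)
    show "p \<circ> p' \<in> H" if "p \<in> H" "p' \<in> H" for p p'
    proof -
      have "(p \<circ> p') ` S = S" using that unfolding image_comp[symmetric] H_def by simp
      then show ?thesis using that G.comp_in unfolding H_def by blast
    qed
  qed (simp_all add: H_def G.id_in)
  have scaled: "(\<Prod>x\<in>A. h x) / \<pi> ^ card A = (\<Prod>x\<in>A. h x / \<pi>)" for A and h :: "complex \<Rightarrow> complex"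
    by (simp add: prod_dividef)
  have key: "q dvd card A + card S" if A: "A \<subseteq> S" "\<And>h. h \<in> H \<Longrightarrow> h ` A = A" for A
  proof -
    define N where "N = card A + card S"
    define \<theta> where "\<theta> h = (\<Prod>x\<in>A. h x) * (\<Prod>x\<in>S. h x)" for h :: "complex \<Rightarrow> complex"
    have AR: "A \<subseteq> R" using A SR by blast
    have \<theta>_scaled: "\<theta> h / \<pi> ^ N = (\<Prod>x\<in>A. h x / \<pi>) * (\<Prod>x\<in>S. h x / \<pi>)" for h
      by (simp add: \<theta>_def N_def power_add scaled[symmetric])
    have unit: "vunit (\<theta> id / \<pi> ^ N)"
      unfolding \<theta>_scaled using A by (intro vunit_mult vunit_prod) (auto simp: S_def)
    have \<theta>0: "\<theta> id \<noteq> 0" using unit by (auto simp: vunit_def)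
    have stable: "\<theta> h = \<theta> id" if h: "h \<in> H" for h
    proof -
      have inj: "inj h" using H.inj_in[OF h] .
      have "prod h B = \<Prod>B" if "h ` B = B" for B
        using prod.reindex[of h B "\<lambda>x. x"] inj that by (simp add: inj_on_subset comp_def)
      then show ?thesis using A(2)[OF h] h by (simp add: \<theta>_def H_def)
    qed
    \<comment> \<open>An \<open>h\<close> that moves \<open>S\<close> takes some element of
      \<open>S\<close> out of it, which makes one factor a nonunit. The product over
      \<open>S\<close> detects this even when \<open>h\<close> keeps \<open>A\<close> inside
      \<open>S\<close>.\<close>
    have other: "nonunit (\<theta> h / \<pi> ^ N)" if h: "h \<in> G" "h ` S \<noteq> S" for h
    proof -
      have hR: "h x / \<pi> \<in> V" if "x \<in> R" for x using RV G.image_R[OF h(1) that] by blast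
      have "card (h ` S) = card S" using G.inj_in[OF h(1)] by (simp add: card_image inj_on_subset)
      then have "\<not> h ` S \<subseteq> S" using h(2) card_subset_eq[OF finS] by blast
      then obtain y where y: "y \<in> S" "h y \<notin> S" by blast
      then have "nonunit (h y / \<pi>)"
        using hR[of y] G.image_R[OF h(1)] in_cases(1) SR by (auto simp: S_def)
      then have "nonunit ((h y / \<pi>) * (\<Prod>x\<in>S - {y}. h x / \<pi>))"
        using hR SR by (intro nonunit_mult prod_in) auto
      moreover have "(\<Prod>x\<in>S. h x / \<pi>) = (h y / \<pi>) * (\<Prod>x\<in>S - {y}. h x / \<pi>)"
        using y finS by (simp add: prod.remove)
      ultimately have "nonunit (\<Prod>x\<in>S. h x / \<pi>)" by (simp only:)
      then show ?thesis unfolding \<theta>_scaled using hR AR by (intro nonunit_mult_right prod_in) auto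
    qed
    \<comment> \<open>As a set, \<open>X\<close> counts the dominating value
      \<open>\<theta> id\<close> once; a sum over \<open>G\<close> would repeat it, perhaps a
      multiple of \<open>p\<close> times.\<close>
    define X where "X = \<theta> ` G"
    have finX: "finite X" using G.finite_G by (simp add: X_def)
    have \<theta>L: "\<theta> h \<in> splitting_field_C f" if "h \<in> G" for h
      unfolding \<theta>_def using RL AR SR G.image_R[OF that] by (intro L.mult_in L.prod_in) auto
    have "\<Sum>X \<in> \<rat>"
    proof (rule sum_conjugates_rational[OF f0 finX])
      show "X \<subseteq> splitting_field_C f" using \<theta>L by (auto simp: X_def)
      fix s x assume s: "s \<in> gal_auts f" and "x \<in> X"
      then obtain h where h: "h \<in> G" "x = \<theta> h" by (auto simp: X_def)
      interpret embedding "splitting_field_C f" s by (rule gal_aut_embedding[OF s])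
      have hR: "h z \<in> R" "h z \<in> splitting_field_C f" if "z \<in> R" for z using G.image_R[OF h(1) that] RL by auto
      have "s (\<theta> h) = (\<Prod>x\<in>A. s (h x)) * (\<Prod>x\<in>S. s (h x))"
      proof -
        have in_L: "h z \<in> splitting_field_C f" if "z \<in> A \<or> z \<in> S" for z using that hR AR SR by blast
        then have "prod h A \<in> splitting_field_C f" "prod h S \<in> splitting_field_C f"
          by (auto intro!: L.prod_in)
        then show ?thesis unfolding \<theta>_def using in_L by (simp add: s_mult s_prod)
      qed
      also have "\<dots> = \<theta> (restrict_id s R \<circ> h)"
        unfolding \<theta>_def using hR AR SR by (intro arg_cong2[where f = "(*)"] prod.cong) (auto simp: restrict_id_def)
      finally have "s x = \<theta> (restrict_id s R \<circ> h)" using h by simp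
      moreover have "restrict_id s R \<in> G" using s by (auto simp: G_def gal_perms_def R_def)
      ultimately show "s x \<in> X" using h G.comp_in by (auto simp: X_def)
    qed
    have "\<Sum>X = \<theta> id + \<Sum>(X - {\<theta> id})"
      using finX G.id_in by (intro sum.remove) (auto simp: X_def)
    then have "\<Sum>X / \<pi> ^ N = \<theta> id / \<pi> ^ N + (\<Sum>t\<in>X - {\<theta> id}. t / \<pi> ^ N)"
      by (simp add: add_divide_distrib sum_divide_distrib)
    moreover have "nonunit (\<Sum>t\<in>X - {\<theta> id}. t / \<pi> ^ N)"
    proof (rule nonunit_sum)
      fix t assume "t \<in> X - {\<theta> id}"
      then obtain h where "h \<in> G" "t = \<theta> h" "t \<noteq> \<theta> id" by (auto simp: X_def)
      then show "nonunit (t / \<pi> ^ N)" using stable other by (auto simp: H_def)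
    qed
    ultimately have unit_sum: "vunit (\<Sum>X / \<pi> ^ N)" using unit vunit_add_nonunit by simp
    then have X0: "\<Sum>X \<noteq> 0" by (auto simp: vunit_def)
    \<comment> \<open>The \<open>q\<close>-th power trades \<open>\<pi>\<close> for
      \<open>p\<close>: the rational number \<open>\<Sum>X\<close> has valuation N/q, which must be
      an integer.\<close>
    have "vunit ((\<Sum>X / \<pi> ^ N) ^ q)" using unit_sum by (rule vunit_power)
    moreover have "(\<pi> ^ N) ^ q = of_int p powi int N"
      by (simp add: pi[symmetric] mult.commute flip: power_mult)
    ultimately have "vunit (\<Sum>X ^ q / of_int p powi int N)" by (simp add: power_divide)
    then have "int q dvd int N" using rational_power_valuation[OF \<open>\<Sum>X \<in> \<rat>\<close> X0] by blast
    then show ?thesis by (simp only: int_dvd_int_iff N_def)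
  qed
  \<comment> \<open>The stabiliser \<open>H\<close> of \<open>S\<close> stands in for a
    decomposition group. Using \<open>key\<close> for this orbit and for the empty set isolates
    \<open>q dvd card A\<close>, and the orbit length divides \<open>card H\<close>.\<close>
  define A where "A = (\<lambda>h. h x0) ` H"
  have "A \<subseteq> S" using x0 by (auto simp: A_def H_def)
  moreover have "h ` A = A" if h: "h \<in> H" for h
  proof (rule endo_inj_surj)
    show "finite A" using H.finite_G by (simp add: A_def)
    show "h ` A \<subseteq> A"
    proof
      fix y assume "y \<in> h ` A"
      then obtain p where "p \<in> H" "y = (h \<circ> p) x0" by (auto simp: A_def)
      then show "y \<in> A" using H.comp_in[OF h] unfolding A_def by blast
    qed
    show "inj_on h A" using H.inj_in[OF h] inj_on_subset by blast
  qed
  ultimately have "q dvd card A + card S" by (rule key)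
  moreover have "q dvd card S" using key[of "{}"] by simp
  ultimately have "q dvd card A" by (simp add: dvd_add_left_iff)
  then have "q dvd card H" using H.card_orbit_mult[of x0] x0 SR by (auto simp: A_def)
  then show ?thesis using H.cauchy[OF q(1)] by (auto simp: H_def G_def)
qed

section \<open>A square root of the discriminant and the alternating case\<close>

lemma sqrt_of_root_differences:
  assumes "finite R" "R \<subseteq> K" "subring_C K"
  shows "\<exists>D\<in>K. D ^ 2 = (\<Prod>x\<in>R. \<Prod>y\<in>R - {x}. (x - y)) \<or> D ^ 2 = - (\<Prod>x\<in>R. \<Prod>y\<in>R - {x}. (x - y))"
  using assms(1,2)
proof (induction R rule: finite_induct)
  case empty
  interpret subring_C K by (rule assms)
  show ?case by (auto intro: bexI[of _ 1])
next
  case (insert z R)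
  interpret subring_C K by (rule assms)
  let ?Q = "\<lambda>R. \<Prod>x\<in>R. \<Prod>y\<in>R - {x}. (x - y)"
  obtain D where D: "D \<in> K" "D ^ 2 = ?Q R \<or> D ^ 2 = - ?Q R" using insert by auto
  \<comment> \<open>\<open>D\<close> takes one difference for each unordered pair and is built up
    without ordering the roots. The new pairs contribute \<open>E\<close> twice, up to the sign
    \<open>(- 1) ^ card R\<close>; this is why only plus or minus the product is claimed to be a
    square.\<close>
  define E where "E = (\<Prod>y\<in>R. (z - y))"
  have EK: "E \<in> K" unfolding E_def using insert.prems by (intro prod_in diff_in) auto
  have "?Q (insert z R) = E * (\<Prod>x\<in>R. \<Prod>y\<in>insert z R - {x}. (x - y))"
    using insert.hyps by (simp add: E_def)
  also have "(\<Prod>x\<in>R. \<Prod>y\<in>insert z R - {x}. (x - y)) = (\<Prod>x\<in>R. (x - z) * (\<Prod>y\<in>R - {x}. (x - y)))"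
  proof (rule prod.cong)
    fix x assume "x \<in> R"
    then have "insert z R - {x} = insert z (R - {x})" using insert.hyps by auto
    then show "(\<Prod>y\<in>insert z R - {x}. (x - y)) = (x - z) * (\<Prod>y\<in>R - {x}. (x - y))"
      using insert.hyps by simp
  qed simp
  also have "\<dots> = (\<Prod>x\<in>R. x - z) * ?Q R" by (rule prod.distrib)
  also have "(\<Prod>x\<in>R. x - z) = (\<Prod>x\<in>R. - 1 * (z - x))" by simp
  also have "\<dots> = (- 1) ^ card R * E" unfolding E_def prod.distrib by simp
  finally have *: "?Q (insert z R) = (- 1) ^ card R * (E ^ 2 * ?Q R)"
    by (simp add: power2_eq_square mult_ac)
  have "(D * E) ^ 2 = ?Q (insert z R) \<or> (D * E) ^ 2 = - ?Q (insert z R)"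
    unfolding * using D(2) by (cases "even (card R)") (auto simp: power_mult_distrib mult.commute)
  then show ?case using D(1) EK mult_in by blast
qed

lemma discriminant_sqrt:
  assumes irr: "irreducible (map_poly (of_int :: int \<Rightarrow> rat) f)" and lc: "lead_coeff f = 1"
  shows "\<exists>D\<in>splitting_field_C f. D \<noteq> 0 \<and>
    (D ^ 2 = (\<Prod>x\<in>complex_roots f. poly (map_poly of_int (pderiv f)) x) \<or>
     D ^ 2 = - (\<Prod>x\<in>complex_roots f. poly (map_poly of_int (pderiv f)) x))"
proof -
  define R where "R = complex_roots f"
  have f0: "f \<noteq> 0" using lc by auto
  have finR: "finite R" unfolding R_def by (rule finite_complex_roots[OF f0])
  have dF: "map_poly of_int (pderiv f) = pderiv (map_poly of_int f :: complex poly)"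
    by (rule poly_eqI) (simp add: coeff_map_poly coeff_pderiv)
  have "poly (map_poly of_int (pderiv f)) x = (\<Prod>y\<in>R - {x}. (x - y))" if x: "x \<in> R" for x
  proof -
    have *: "map_poly of_int f = [:- x, 1:] * (\<Prod>y\<in>R - {x}. [:- y, 1:])"
      using monic_complex_decompose(1)[OF irr lc] x finR by (simp add: R_def prod.remove)
    show ?thesis unfolding dF * pderiv_mult by (simp add: pderiv_pCons poly_prod)
  qed
  then have eq: "(\<Prod>x\<in>R. poly (map_poly of_int (pderiv f)) x) = (\<Prod>x\<in>R. \<Prod>y\<in>R - {x}. (x - y))" by simp
  have ne: "(\<Prod>x\<in>R. \<Prod>y\<in>R - {x}. (x - y)) \<noteq> 0" using finR by simp
  obtain D where D: "D \<in> splitting_field_C f"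
    "D ^ 2 = (\<Prod>x\<in>R. \<Prod>y\<in>R - {x}. (x - y)) \<or> D ^ 2 = - (\<Prod>x\<in>R. \<Prod>y\<in>R - {x}. (x - y))"
    using sqrt_of_root_differences[OF finR roots_in_splitting_field[of f, folded R_def] splitting_field_subring]
    by blast
  then have D0: "D \<noteq> 0" using ne by auto
  have d: "D ^ 2 = (\<Prod>x\<in>R. poly (map_poly of_int (pderiv f)) x) \<or>
    D ^ 2 = - (\<Prod>x\<in>R. poly (map_poly of_int (pderiv f)) x)" using D(2) by (simp only: eq)
  show ?thesis unfolding R_def[symmetric] by (rule bexI[where x = D], rule conjI[OF D0 d], rule D(1))
qed

text \<open>The elements fixing \<open>D\<close> take the place of the alternating group. Every
  automorphism sends \<open>D\<close> to \<open>D\<close> or \<open>- D\<close>, and one inducing a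
  3-cycle has cube the identity, hence fixes \<open>D\<close>. If all automorphisms fixed
  \<open>D\<close>, it would be rational, which \<open>nonsquare\<close> excludes.\<close>

lemma symmetric_group_criterion:
  assumes irr: "irreducible (map_poly (of_int :: int \<Rightarrow> rat) f)" and lc: "lead_coeff f = 1"
    and cyc: "\<And>a b c. a \<in> complex_roots f \<Longrightarrow> b \<in> complex_roots f \<Longrightarrow> c \<in> complex_roots f \<Longrightarrow>
      a \<noteq> b \<Longrightarrow> b \<noteq> c \<Longrightarrow> a \<noteq> c \<Longrightarrow> transpose a b \<circ> transpose b c \<in> gal_perms f"
    and deg: "degree f \<ge> 2"
    and nonsquare: "\<And>r. r \<in> \<rat> \<Longrightarrow> r ^ 2 \<noteq> (\<Prod>x\<in>complex_roots f. poly (map_poly of_int (pderiv f)) x)"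
      "\<And>r. r \<in> \<rat> \<Longrightarrow> r ^ 2 \<noteq> - (\<Prod>x\<in>complex_roots f. poly (map_poly of_int (pderiv f)) x)"
  shows "gal_perms f = {p. p permutes complex_roots f}"
proof -
  define R where "R = complex_roots f"
  define c where "c = (\<Prod>x\<in>R. poly (map_poly of_int (pderiv f) :: complex poly) x)"
  have f0: "f \<noteq> 0" using lc by auto
  interpret G: perm_group R "gal_perms f" unfolding R_def by (rule gal_perms_perm_group[OF f0])
  obtain D where D: "D \<in> splitting_field_C f" "D \<noteq> 0" "D ^ 2 = c \<or> D ^ 2 = - c"
    using discriminant_sqrt[OF irr lc] by (auto simp: c_def R_def)
  have sign: "s D = D \<or> s D = - D" if s: "s \<in> gal_auts f" for s
  proof -
    interpret embedding "splitting_field_C f" s by (rule gal_aut_embedding[OF s])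
    have bij: "bij_betw s R R" unfolding R_def by (rule gal_aut_roots[OF f0 s])
    have RL: "R \<subseteq> splitting_field_C f" unfolding R_def by (rule roots_in_splitting_field)
    have poly_in': "poly (map_poly of_int h) x \<in> splitting_field_C f" if "x \<in> R" for h x
      using that RL by (intro poly_in) (auto simp: polys_over_def coeff_map_poly of_int_in)
    have "s c = (\<Prod>x\<in>R. s (poly (map_poly of_int (pderiv f)) x))"
      unfolding c_def by (rule s_prod) (rule poly_in')
    also have "\<dots> = (\<Prod>x\<in>R. poly (map_poly of_int (pderiv f)) (s x))"
      using RL by (intro prod.cong) (auto simp: s_poly_of_int)
    also have "\<dots> = c" unfolding c_def by (rule prod.reindex_bij_betw[OF bij])
    finally have "s c = c" .
    moreover have "c \<in> splitting_field_C f" unfolding c_def by (intro prod_in poly_in')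
    ultimately have "s (D ^ 2) = D ^ 2" using D(3) s_minus[of c] by auto
    then have "(s D) ^ 2 = D ^ 2" using s_power[OF D(1), of 2] by simp
    then show ?thesis by (simp add: power2_eq_iff)
  qed
  define A where "A = (\<lambda>s. restrict_id s R) ` {s \<in> gal_auts f. s D = D}"
  have AG: "A \<subseteq> gal_perms f" by (auto simp: A_def gal_perms_def R_def)
  have restrict_comp: "restrict_id s R \<circ> restrict_id s' R = restrict_id (s \<circ> s') R"
    if "s' \<in> gal_auts f" for s s'
    using gal_aut_roots[OF f0 that] by (auto simp: fun_eq_iff restrict_id_def R_def dest: bij_betwE)
  have cycA: "transpose a b \<circ> transpose b c \<in> A"
    if abc: "a \<in> R" "b \<in> R" "c \<in> R" "a \<noteq> b" "b \<noteq> c" "a \<noteq> c" for a b c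
  proof -
    obtain s where s: "s \<in> gal_auts f" "transpose a b \<circ> transpose b c = restrict_id s R"
      using cyc[of a b c] abc by (auto simp: gal_perms_def R_def)
    interpret embedding "splitting_field_C f" s by (rule gal_aut_embedding[OF s(1)])
    have sx: "s x = (transpose a b \<circ> transpose b c) x" if "x \<in> R" for x using s(2) that by simp
    have "s (s (s x)) = x" if "x \<in> R" for x
    proof -
      have "s x \<in> R" "s (s x) \<in> R" using that gal_aut_roots[OF f0 s(1)] by (auto simp: R_def dest: bij_betwE)
      then have "s (s (s x)) = (transpose a b \<circ> transpose b c) ((transpose a b \<circ> transpose b c)
          ((transpose a b \<circ> transpose b c) x))" using sx that by simp
      also have "\<dots> = x" using abc by (auto simp: transpose_def)
      finally show ?thesis .
    qed
    then have "(s \<circ> (s \<circ> s)) D = id D"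
      by (intro gal_aut_eqI[OF gal_aut_comp[OF s(1) gal_aut_comp[OF s(1) s(1)]] gal_aut_id _ D(1)])
        (simp add: R_def)
    then have "s (s (s D)) = D" by simp
    then have "s D = D" using sign[OF s(1)] s_minus[OF D(1)] D(2) by auto
    then show ?thesis using s by (auto simp: A_def)
  qed
  have idA: "id \<in> A"
    unfolding A_def by (rule image_eqI[of _ _ id]) (auto simp: restrict_id_def gal_aut_id)
  have compA: "p \<circ> p' \<in> A" if pp': "p \<in> A" "p' \<in> A" for p p'
  proof -
    obtain s s' where "s \<in> gal_auts f" "s D = D" "p = restrict_id s R"
      "s' \<in> gal_auts f" "s' D = D" "p' = restrict_id s' R" using pp' by (auto simp: A_def)
    then show ?thesis using restrict_comp gal_aut_comp[of s f s'] unfolding A_def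
      by (intro image_eqI[of _ _ "s \<circ> s'"]) auto
  qed
  have "card R \<ge> 2" using monic_complex_decompose(2)[OF irr lc] deg by (simp add: R_def)
  then obtain T where "T \<subseteq> R" "card T = 2" by (meson obtain_subset_with_card_n)
  then obtain u v where uv: "u \<in> R" "v \<in> R" "u \<noteq> v" by (auto simp: card_2_iff)
  have "\<not> gal_perms f \<subseteq> A"
  proof
    assume sub: "gal_perms f \<subseteq> A"
    have "s D = D" if s: "s \<in> gal_auts f" for s
    proof -
      have "restrict_id s R \<in> A" using sub s by (auto simp: gal_perms_def R_def)
      then obtain t where t: "t \<in> gal_auts f" "t D = D" "restrict_id s R = restrict_id t R"
        by (auto simp: A_def)
      have "s x = t x" if "x \<in> R" for x using fun_cong[OF t(3), of x] that by simp
      then show ?thesis using gal_aut_eqI[OF s t(1) _ D(1)] t(2) by (auto simp: R_def)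
    qed
    then have "D \<in> \<rat>" by (rule gal_fixed_rational[OF f0 D(1)])
    then show False using nonsquare D(3) by (auto simp: c_def R_def)
  qed
  then show ?thesis
    using G.symmetric_or_three_cycles[OF cycA AG idA compA uv] by (auto simp: R_def)
qed

lemma coeff_monom_plus_const_power:
  "coeff ((monom 1 k + [:c:]) ^ m) i = (\<Sum>j\<le>m. if k * j = i then of_nat (m choose j) * c ^ (m - j) else 0)"
  for c :: "'a :: comm_semiring_1"
proof -
  have "(monom 1 k + [:c:]) ^ m = (\<Sum>j\<le>m. of_nat (m choose j) * monom 1 k ^ j * [:c:] ^ (m - j))"
    by (rule binomial_ring)
  also have "\<dots> = (\<Sum>j\<le>m. monom (of_nat (m choose j) * c ^ (m - j)) (k * j))"
    by (intro sum.cong) (auto simp: monom_power of_nat_poly poly_const_pow smult_monom mult.commute)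
  finally show ?thesis by (simp add: coeff_sum)
qed

text \<open>At a root \<open>x f'(x) = (x^k + c)^(m-1) ((km - n) x^k - nc)\<close> and \<open>(x^k + c)^m = a x^n\<close>, so
  at a prime \<open>l\<close> the \<open>m\<close>-th power of the discriminant is \<open>a^(km(m-1))\<close> up to an \<open>l\<close>-adic unit.\<close>
lemma discriminant_not_square:
  fixes a c l :: int and k m n :: nat and f :: "int poly"
  assumes f: "f = (monom 1 k + [:c:]) ^ m - monom a n" and lc: "lead_coeff f = 1"
    and card: "card (complex_roots f) = k * m" and odd: "odd (k * (m - 1))" and n: "n > 0"
    and l: "prime l" "odd (multiplicity l a)" "\<not> l dvd int (k * m) * c"
    and r: "r \<in> \<rat>"
    and e: "e = 1 \<or> e = - 1"
  shows "r ^ 2 \<noteq> e * (\<Prod>x\<in>complex_roots f. poly (map_poly of_int (pderiv f)) x)"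
proof
  assume r2: "r ^ 2 = e * (\<Prod>x\<in>complex_roots f. poly (map_poly of_int (pderiv f)) x)"
  define R where "R = complex_roots f"
  define v where "v = multiplicity l a"
  obtain V where "valuation_ring_C V l" using valuation_ring_exists[OF l(1)] by blast
  then interpret valuation_ring_C V l .
  \<comment> \<open>Zero is even, so the parity condition also yields \<open>k > 0\<close> and
    \<open>m > 1\<close>.\<close>
  have "k \<noteq> 0" "m - 1 \<noteq> 0" using odd by (metis even_zero mult_0, metis even_zero mult_0_right)
  then have km: "k > 0" "m > 1" by auto
  have v0: "v > 0" using l(2) by (auto simp: v_def intro: gr0I)
  have a0: "a \<noteq> 0" using l(2) by (intro notI) simp
  have c: "vunit (of_int c)" using l(3) by (intro vunit_of_int) auto
  have kmc: "vunit (of_int (int (k * m) * c))" using l(3) by (intro vunit_of_int)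
  have av: "vunit (of_int a / of_int l ^ v)"
  proof -
    have "\<not> is_unit l" using l(1) by auto
    from multiplicity_decompose'[OF a0 this]
    obtain u where u: "a = l ^ v * u" "\<not> l dvd u" by (auto simp: v_def)
    have "(of_int a :: complex) = of_int l ^ v * of_int u" by (subst u(1)) simp
    then have "of_int a / of_int l ^ v = (of_int u :: complex)" by simp
    then show ?thesis using vunit_of_int[OF u(2)] by simp
  qed
  have a_non: "nonunit (of_int a)"
  proof -
    have "nonunit (of_int l ^ v * (of_int a / of_int l ^ v))"
      using nonunit_power[OF nonunit_p v0] av by (intro nonunit_mult) (auto simp: vunit_def)
    then show ?thesis by simp
  qed
  have F: "map_poly of_int f = (monom 1 k + [:of_int c:]) ^ m - monom (of_int a :: complex) n"
    unfolding f by (rule poly_eqI) (simp add: coeff_map_poly coeff_monom_plus_const_power if_distrib[of of_int] cong: if_cong)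
  have root: "(x ^ k + of_int c) ^ m = of_int a * x ^ n" if "x \<in> R" for x
    using that F by (simp add: R_def complex_roots_def poly_monom)
  have deriv: "poly (map_poly of_int (pderiv f)) x =
      of_nat m * (x ^ k + of_int c) ^ (m - 1) * (of_nat k * x ^ (k - 1)) - of_int a * of_nat n * x ^ (n - 1)" for x :: complex
  proof -
    have "map_poly of_int (pderiv f) = pderiv (map_poly of_int f :: complex poly)"
      by (rule poly_eqI) (simp add: coeff_map_poly coeff_pderiv)
    also have "\<dots> = smult (of_nat m) ((monom 1 k + [:of_int c:]) ^ (m - 1)) * monom (of_nat k) (k - 1)
        - monom (of_nat n * of_int a) (n - 1)"
      using km unfolding F
      by (simp add: pderiv_diff pderiv_power pderiv_add pderiv_monom pderiv_pCons)
    finally show ?thesis by (simp add: poly_monom mult_ac)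
  qed
  \<comment> \<open>The valuation of \<open>w\<close> may be fractional; the \<open>m\<close>-th
    power turns \<open>w ^ m\<close> into \<open>of_int a * x ^ n\<close>, whose valuation is the
    integer \<open>v\<close> because \<open>x\<close> is a unit.\<close>
  have main: "vunit (poly (map_poly of_int (pderiv f)) x ^ m / of_int l ^ (v * (m - 1)))" if x: "x \<in> R" for x
  proof -
    define w where "w = x ^ k + of_int c"
    have wm: "w ^ m = of_int a * x ^ n" using root[OF x] by (simp add: w_def)
    have xV: "x \<in> V"
    proof (rule integrally_closed)
      show "map_poly of_int f \<in> polys_over V" by (simp add: polys_over_def coeff_map_poly of_int_in)
      show "lead_coeff (map_poly of_int f :: complex poly) = 1"
        using lc by (subst lead_coeff_map_poly_nz) auto
      show "poly (map_poly of_int f) x = 0" using x by (simp add: R_def complex_roots_def)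
    qed
    have wV: "w \<in> V" unfolding w_def by (intro add_in power_in xV of_int_in)
    have wm_non: "nonunit (w ^ m)" unfolding wm by (intro nonunit_mult a_non power_in xV)
    have w_non: "nonunit w"
      using wm_non wV in_cases vunit_power by blast
    \<comment> \<open>\<open>w\<close> is a nonunit because its \<open>m\<close>-th power is a
      multiple of \<open>a\<close>; if \<open>x\<close> were a nonunit as well, \<open>w\<close>
      would be the unit \<open>c\<close> plus a nonunit.\<close>
    have xu: "vunit x"
    proof (rule ccontr)
      assume "\<not> vunit x"
      then have "nonunit (x ^ k)" using xV in_cases(1) nonunit_power km by blast
      then have "vunit w" unfolding w_def using vunit_add_nonunit[OF c, of "x ^ k"] by (simp add: add.commute)
      then show False using w_non in_cases(2) by blast
    qed
    \<comment> \<open>The factor (km - n) x^k - nc with x^k = w - c inserted. Modulo nonunits only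
      -kmc remains, and \<open>l\<close> does not divide kmc.\<close>
    define t where "t = (of_nat (k * m) - of_nat n) * w - of_int (int (k * m) * c)"
    have t: "vunit t"
    proof -
      have "nonunit ((of_nat (k * m) - of_nat n) * w)"
        by (intro nonunit_mult_right w_non diff_in of_nat_in)
      then show ?thesis using vunit_add_nonunit[OF vunit_minus[OF kmc]] unfolding t_def
        by (metis add.commute diff_conv_add_uminus)
    qed
    have x0: "x \<noteq> 0" using xu by (simp add: vunit_def)
    have "x * poly (map_poly of_int (pderiv f)) x =
        of_nat m * w ^ (m - 1) * (of_nat k * (x * x ^ (k - 1))) - of_nat n * (of_int a * (x * x ^ (n - 1)))"
      unfolding deriv w_def[symmetric] by (simp add: algebra_simps)
    also have "x * x ^ (k - 1) = w - of_int c" using km by (simp add: w_def flip: power_Suc)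
    also have "of_int a * (x * x ^ (n - 1)) = w ^ (m - 1) * w"
      using n km wm by (simp flip: power_Suc power_Suc2)
    finally have xd: "x * poly (map_poly of_int (pderiv f)) x = w ^ (m - 1) * t"
      by (simp add: t_def algebra_simps)
    have "poly (map_poly of_int (pderiv f)) x ^ m = (w ^ m) ^ (m - 1) * t ^ m / x ^ m"
      using arg_cong[OF xd, of "\<lambda>z. z ^ m"] x0
      by (simp add: power_mult_distrib field_simps flip: power_mult)
    then have "poly (map_poly of_int (pderiv f)) x ^ m / of_int l ^ (v * (m - 1)) =
        (of_int a / of_int l ^ v * x ^ n) ^ (m - 1) * t ^ m / x ^ m"
      unfolding wm by (simp add: power_mult power_mult_distrib power_divide)
    also have "vunit \<dots>" by (intro vunit_divide vunit_mult vunit_power av xu t)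
    finally show ?thesis .
  qed
  define C where "C = (\<Prod>x\<in>R. poly (map_poly of_int (pderiv f)) x :: complex)"
  have "vunit (\<Prod>x\<in>R. poly (map_poly of_int (pderiv f)) x ^ m / of_int l ^ (v * (m - 1)))"
    by (intro vunit_prod main)
  also have "(\<Prod>x\<in>R. poly (map_poly of_int (pderiv f)) x ^ m / of_int l ^ (v * (m - 1))) =
      C ^ m / of_int l ^ (v * (m - 1) * (k * m))"
    using card by (simp add: C_def R_def prod_dividef prod_power_distrib power_mult)
  finally have C: "vunit (C ^ m / of_int l ^ (v * (m - 1) * (k * m)))" .
  have "vunit (e ^ m)" using e vunit_1 vunit_minus vunit_power by blast
  then have "vunit (e ^ m * (C ^ m / of_int l ^ (v * (m - 1) * (k * m))))" using C vunit_mult by blast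
  also have "e ^ m * (C ^ m / of_int l ^ (v * (m - 1) * (k * m))) =
      r ^ (2 * m) / of_int l powi int (v * (m - 1) * (k * m))"
  proof -
    have "r ^ (2 * m) = e ^ m * C ^ m" by (simp add: power_mult r2 C_def R_def power_mult_distrib)
    then show ?thesis unfolding power_int_of_nat by simp
  qed
  \<comment> \<open>Over the k m roots the valuations add up to v (m - 1) k m. The auxiliary factor
    \<open>m\<close> cancels again, and what is left is the parity of v k (m - 1).\<close>
  finally have "int (2 * m) dvd int (v * (m - 1) * (k * m))"
    using rational_power_valuation[OF r, of "2 * m"] C km by (auto simp: vunit_def)
  then have "2 * m dvd v * (k * (m - 1)) * m" by (simp only: int_dvd_int_iff) (simp add: mult_ac)
  then have "2 dvd v * (k * (m - 1))" using km by simp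
  then show False using l(2) odd by (simp add: v_def)
qed

theorem mainTheorem9:
  fixes a c :: int and k m n :: nat and f :: "int poly"
  assumes f_def: "f = (monom 1 k + [:c:]) ^ m - monom a n"
    and kmn: "k * m > n"
    and irr: "irreducible (map_poly (of_int :: int \<Rightarrow> rat) f)"
    and deg: "degree f = k * m"
    and q_prime: "prime (k * m - n)"
    and q_lower: "real (k * m) / 2 < real (k * m - n)"
    and q_upper: "real (k * m - n) < real (k * m) - 2"
    and p_cond: "\<exists>p::int. prime p \<and> p dvd c \<and> p dvd a \<and> \<not> p ^ 2 dvd a"
    and odd_cond: "odd (k * (m - 1))"
    and l_cond: "\<exists>l::int. prime l \<and> odd (multiplicity l a) \<and> \<not> l dvd (int (k * m) * c)"
  shows "galois_perm_group f = sym_group_roots f"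
proof -
  define q where "q = k * m - n"
  have "k \<noteq> 0" "m - 1 \<noteq> 0" using odd_cond by (metis even_zero mult_0, metis even_zero mult_0_right)
  then have km: "k > 0" "m > 1" by auto
  \<comment> \<open>The bounds on q in terms of n: the cycle leaves at least three fixed points and
    moves more than half of the roots.\<close>
  have "real (2 * n) < real (k * m)" "real 2 < real n"
    using q_upper q_lower kmn by (simp_all add: of_nat_diff)
  then have n: "2 < n" "2 * n < k * m" by (simp_all only: of_nat_less_iff)
  have coeff: "coeff f i = (\<Sum>j\<le>m. if k * j = i then of_nat (m choose j) * c ^ (m - j) else 0)
      - (if n = i then a else 0)" for i
    unfolding f_def by (simp only: coeff_diff coeff_monom coeff_monom_plus_const_power)
  have lc: "lead_coeff f = 1"
  proof -
    have "coeff f (k * m) = (\<Sum>j\<le>m. if m = j then of_nat (m choose j) * c ^ (m - j) else 0)"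
      unfolding coeff using km kmn by (auto intro!: sum.cong)
    then show ?thesis by (simp add: deg)
  qed
  note card = monic_complex_decompose(2)[OF irr lc, unfolded deg]
  have f0: "f \<noteq> 0" using lc by auto
  interpret G: perm_group "complex_roots f" "gal_perms f" by (rule gal_perms_perm_group[OF f0])
  obtain p :: int where p: "prime p" "p dvd c" "p dvd a" "\<not> p ^ 2 dvd a" using p_cond by blast
  have one: "p dvd (\<Sum>j\<le>m. if k * j = i then of_nat (m choose j) * c ^ (m - j) else 0)"
    if i: "i < k * m" for i
  proof (rule dvd_sum)
    fix j assume "j \<in> {..m}"
    have "p dvd c ^ (m - j)" if "k * j = i"
    proof -
      have "j < m" using that i by auto
      then show ?thesis by (intro dvd_trans[OF p(2) dvd_power]) auto
    qed
    then show "p dvd (if k * j = i then of_nat (m choose j) * c ^ (m - j) else 0)" by auto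
  qed
  have two: "p ^ 2 dvd (\<Sum>j\<le>m. if k * j = i then of_nat (m choose j) * c ^ (m - j) else 0)"
    if i: "i \<le> n" for i
  proof (rule dvd_sum)
    fix j assume "j \<in> {..m}"
    have "p ^ 2 dvd c ^ (m - j)" if "k * j = i"
    proof -
      \<comment> \<open>Since \<open>2 * n < k * m\<close>, an index \<open>k * j \<le> n\<close>
        has \<open>2 * j < m\<close>, so at least two factors \<open>c\<close> remain.\<close>
      have "k * (2 * j) = 2 * i" using that by auto
      then have "k * (2 * j) < k * m" using i n(2) by linarith
      then have "2 * j < m" by simp
      then have "2 \<le> m - j" using km by linarith
      then show ?thesis using p(2) by (meson dvd_power_same dvd_trans le_imp_power_dvd)
    qed
    then show "p ^ 2 dvd (if k * j = i then of_nat (m choose j) * c ^ (m - j) else 0)" by auto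
  qed
  have "\<exists>g\<in>gal_perms f. g \<noteq> id \<and> g ^^ q = id"
  proof (rule newton_edge_element[OF irr lc _ _ _ _ p(1)])
    show "n < degree f" "prime q" "q = degree f - n" "degree f \<le> 2 * q"
      using kmn q_prime n by (simp_all add: q_def deg)
    show "p dvd coeff f i" if "n < i" "i < degree f" for i
      using one[of i] that by (simp add: coeff deg)
    show "p dvd coeff f n" using one[of n] p(3) kmn by (simp add: coeff)
    show "p ^ 2 dvd coeff f i" if "i < n" for i using two[of i] that by (simp add: coeff)
    \<comment> \<open>The binomial part at \<open>n\<close> is divisible by \<open>p ^ 2\<close>, so
      \<open>- a\<close> alone decides.\<close>
    show "\<not> p ^ 2 dvd coeff f n"
      using two[of n] p(4) by (auto simp: coeff dvd_diff_right_iff)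
  qed
  then obtain g where g: "g \<in> gal_perms f" "g \<noteq> id" "g ^^ q = id" by blast
  interpret T: transitive_prime_cycle "complex_roots f" "gal_perms f" q g
  proof
    show "\<exists>p\<in>gal_perms f. p x = y" if xy: "x \<in> complex_roots f" "y \<in> complex_roots f" for x y
    proof -
      obtain s where "s \<in> gal_auts f" "s x = y" using gal_transitive[OF irr xy] by blast
      then show ?thesis using xy by (auto simp: gal_perms_def)
    qed
    show "prime q" "card (complex_roots f) < 2 * q" using q_prime card n by (simp_all add: q_def)
  qed (use g in auto)
  have large: "q + 3 \<le> card (complex_roots f)" using card n kmn by (simp add: q_def)
  obtain l :: int where l: "prime l" "odd (multiplicity l a)" "\<not> l dvd int (k * m) * c" using l_cond by blast
  note nonsquare = discriminant_not_square[OF f_def lc card odd_cond _ l]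
  have "gal_perms f = {p. p permutes complex_roots f}"
  proof (rule symmetric_group_criterion[OF irr lc])
    show "transpose x y \<circ> transpose y z \<in> gal_perms f"
      if "x \<in> complex_roots f" "y \<in> complex_roots f" "z \<in> complex_roots f" "x \<noteq> y" "y \<noteq> z" "x \<noteq> z"
      for x y z using T.three_cycle_in[OF large] that by blast
    show "2 \<le> degree f" using deg n by simp
    fix r :: complex assume r: "r \<in> \<rat>"
    show "r ^ 2 \<noteq> (\<Prod>x\<in>complex_roots f. poly (map_poly of_int (pderiv f)) x)"
      using nonsquare[OF _ r, of 1] n by simp
    show "r ^ 2 \<noteq> - (\<Prod>x\<in>complex_roots f. poly (map_poly of_int (pderiv f)) x)"
      using nonsquare[OF _ r, of "- 1"] n by simp
  qed
  then show ?thesis by (rule galois_perm_group_eq_sym)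
qed

end
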